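(* Consider the quadratic program, the PIPG operator $T$ with parameters $\alpha,\beta>0$, the norm $\|\cdot\|_M$ and the Newton-PIPG algorithm (with parameters $c\in[0,1)$ and $\sigma>0$) described in the context. Suppose $\alpha(\|P\|+\beta\|H\|^2)<1$ and the fixed-point set $\operatorname{Fix}(T)$ is nonempty. Let the algorithm run indefinitely (disregarding termination criteria), producing $\tilde z^k=(z^k,w^k)$. Then: 1. $R(\tilde z^k)\to0$ as $k\to\infty$. 2. Suppose in addition that (i) the solution $z^\star$ of the quadratic program satisfies the extended LICQ, and each set $\mathbb D_{ij}$ is either a second-order cone, or an affine subspace, or a set $\{x:\Phi_{ij}(x)\preceq 0\}$ with smooth convex component functions such that at every point $x_0\in\mathbb D_{ij}$ the gradients at $x_0$ of those components of $\Phi_{ij}$ that vanish at $x_0$ form a linearly independent (or empty) set; (ii) the Jacobian of $\pi_{\mathbb D}$, wherever it exists, is symmetric; (iii) the fixed point $(z^\star,w^\star)$ of $T$ satisfies $-(Pz^\star+q+H^\top w^\star)\in\operatorname{ri}N_{\mathbb D}(z^\star)$ and $Hz^\star-g\in\operatorname{ri}N_{\mathbb K^\circ}(w^\star)$. Then, if the algorithm parameter $\sigma$ is sufficiently large and $p^k$ is computed from the Newton equation $(I-J_T(\tilde z^k))p^k=T(\tilde z^k)-\tilde z^k$ at every iteration unless $I-J_T(\tilde z^k)$ is singular, Newton-PIPG converges to the unique fixed point $\tilde z^\star=(z^\star,w^\star)$ of $T$ with a quadratic local convergence rate, i.e. there are $C>0$ and $k_0$ with $\|\tilde z^{k+1}-\tilde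 z^\star\|_M\le C\|\tilde z^k-\tilde z^\star\|_M^2$ for all $k\ge k_0$.
   Context: Quadratic program: $\min_z \tfrac12 z^\top P z+q^\top z$ subject to $Hz-g\in\mathbb K$, $z\in\mathbb D$. Here $z=(z_0,\dots,z_{N+1})\in\mathbb R^{n_z}$, $z_i=(z_{i1},\dots,z_{im_i})\in\mathbb R^{n_{z_i}}$, $z_{ij}\in\mathbb R^{n_{ij}}$. $P=\operatorname{blkdiag}(\rho_{ij}I_{n_{ij}})$ with all $\rho_{ij}>0$; $q\in\mathbb R^{n_z}$. $\mathbb D=\prod_{i=0}^{N+1}\prod_{j=1}^{m_i}\mathbb D_{ij}$ is nonempty, where $\mathbb D_{ij}=\{x\in\mathbb R^{n_{ij}}:\Phi_{ij}(x)\preceq0\}$ is convex, $\Phi_{ij}$ is a smooth vector-valued function (or $\mathbb D_{ij}$ is a second-order cone) and $\preceq$ is the componentwise order. $H\in\mathbb R^{n_w\times n_z}$ is block bidiagonal: block row $i\in\{0,\dots,N\}$ has $A_i\in\mathbb R^{n_i\times n_{z_i}}$ in block column $i$, $B_i\in\mathbb R^{n_i\times n_{z_{i+1}}}$ in block column $i+1$, and zeros elsewhere; $n_i=n_{E_i}+n_{I_i}$, the first $n_{E_i}$ rows of block $i$ being equality rows and the remaining $n_{I_i}$ inequality rows; $n_w=\sum_i n_i$; $g\in\mathbb R^{n_w}$. $\mathbb K=\prod_{i=0}^N(\{0\}^{n_{E_i}}\times\mathbb R_+^{n_{I_i}})$, $\mathbb K^\circ=\prod_{i=0}^N(\mathbb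 R^{n_{E_i}}\times\mathbb R_-^{n_{I_i}})$, with $\mathbb R_+$, $\mathbb R_-$ the nonnegative and nonpositive reals. $H_E$, $H_I$ denote the submatrices of $H$ of equality rows and inequality rows. Second-order cone: a set $\{(x,y)\in\mathbb R^{n}\times\mathbb R:\|x\|\le ty,\ y\ge0\}$ with fixed $t\in\mathbb R_+$. Extended LICQ: with $z^\star$ the optimal solution of the quadratic program and $H_{A_I}$ the matrix of those rows of $H_I$ whose inequality constraint holds with equality at $z^\star$, one has $\operatorname{range}([H_E^\top,H_{A_I}^\top])\cap\operatorname{span}(N_{\mathbb D}(z^\star))=\{0\}$ and $[H_E^\top,H_{A_I}^\top]$ has full column rank. $N_C(x)$ is the normal cone of the convex set $C$ at $x\in C$, $\pi_C$ the Euclidean projection onto $C$, $\operatorname{ri}$ the relative interior; $\|\cdot\|$ is the Euclidean (spectral) norm. PIPG operator: $T(z,w)=(z^+,w^+)$ with $z^+=\pi_{\mathbb D}[z-\alpha(Pz+q+H^\top w)]$ and $w^+=\pi_{\mathbb K^\circ}[w+\beta(H(2z^+-z)-g)]$. $\operatorname{Fix}(T)$ is its set of fixed points. Residual: $R(\tilde z)=\tilde z-T(\tilde z)$, $\tilde z=(z,w)$. $J_T(z,w)=\begin{pmatrix}J_{\mathbb D}(I-\alpha P)&-\alpha J_{\mathbb D}H^\top\\ \beta J_{\mathbb K^\circ}H(-I+2J_{\mathbb D}(I-\alpha P))&J_{\mathbb K^\circ}-2\alpha\beta J_{\mathbb K^\circ}HJ_{\mathbb D}H^\top\end{pmatrix}$,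 where $J_{\mathbb D}$ is the Jacobian of $\pi_{\mathbb D}$ at $z-\alpha(Pz+q+H^\top w)$ and $J_{\mathbb K^\circ}$ is the Jacobian of $\pi_{\mathbb K^\circ}$ at $w+\beta(H(2z^+-z)-g)$ (defined whenever both exist). Norm: $\|v\|_M=\sqrt{v^\top Mv}$ with $M=\begin{pmatrix}\frac1\alpha I-P&-H^\top\\-H&\frac1\beta I\end{pmatrix}$, which is positive definite when $\alpha(\|P\|+\beta\|H\|^2)<1$. Newton-PIPG algorithm, with parameters $c\in[0,1)$, $\sigma>0$ and initial point $\tilde z^0$. At iteration $k$, choose $p^k$ to be either $0$ or the solution of the Newton equation $(I-J_T(\tilde z^k))p^k=T(\tilde z^k)-\tilde z^k$, where in the Newton equation $J_T$ is replaced by $0$ (so $p^k=T(\tilde z^k)-\tilde z^k$) if $J_T(\tilde z^k)$ is undefined or $I-J_T(\tilde z^k)$ is singular. If $\|R(\tilde z^k+p^k)\|_M\le c\|R(\tilde z^k)\|_M$ and $\|p^k\|_M<\sigma\|R(\tilde z^k)\|_M$, set $\tilde z^{k+1}=\tilde z^k+p^k$ (Newton update); otherwise set $\tilde z^{k+1}=T(\tilde z^k)$ (PIPG update).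
   Formalization: The quadratic rate is asserted only for c > 0 (residual convergence and convergence to the unique fixed point still cover c = 0), because for c = 0 Newton updates are accepted only when they land exactly on a fixed point and the rate can then be merely linear. *)

theory Defs
  imports "HOL-Analysis.Analysis"
begin

section \<open>Coordinate blocks, smooth functions, normal cones\<close>

text \<open>
  The factor space of a block of coordinates \<open>S\<close> is represented by the coordinate subspace
  \<open>coord_space S\<close> of the ambient space, i.e. by the vectors vanishing off \<open>S\<close>; its dimension
  is \<open>card S\<close>.
\<close>

definition restrict_to :: "'n set \<Rightarrow> real^'n \<Rightarrow> real^'n::finite" where
  "restrict_to S x = (\<chi> k. if k \<in> S then x $ k else 0)"

definition coord_space :: "'n set \<Rightarrow> (real^'n::finite) set" where
  "coord_space S = {x. \<forall>k. k \<notin> S \<longrightarrow> x $ k = 0}"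

text \<open>
  \<open>Ck n f\<close> says that \<open>f\<close> is \<open>n\<close> times continuously differentiable on the whole space: it is
  continuous (\<open>n = 0\<close>), or differentiable with all partial derivatives \<open>n - 1\<close> times
  continuously differentiable.
\<close>

primrec Ck :: "nat \<Rightarrow> ('a::euclidean_space \<Rightarrow> real) \<Rightarrow> bool" where
  "Ck 0 = (\<lambda>f. continuous_on UNIV f)"
| "Ck (Suc n) = (\<lambda>f. (\<forall>x. f differentiable (at x)) \<and>
      (\<forall>b\<in>Basis. Ck n (\<lambda>x. frechet_derivative f (at x) b)))"

definition smooth_fun :: "('a::euclidean_space \<Rightarrow> real) \<Rightarrow> bool" where
  "smooth_fun f \<longleftrightarrow> (\<forall>n. Ck n f)"

definition gradient :: "('a::euclidean_space \<Rightarrow> real) \<Rightarrow> 'a \<Rightarrow> 'a" where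
  "gradient f x = (THE d. GDERIV f x :> d)"

text \<open>Linear independence of a family, so repeated vectors count as dependent.\<close>

definition lin_indep_family :: "('i \<Rightarrow> 'a::real_vector) \<Rightarrow> 'i set \<Rightarrow> bool" where
  "lin_indep_family f A \<longleftrightarrow> inj_on f A \<and> independent (f ` A)"

definition normal_cone :: "'a::real_inner set \<Rightarrow> 'a \<Rightarrow> 'a set" where
  "normal_cone C x = {v. x \<in> C \<and> (\<forall>y\<in>C. v \<bullet> (y - x) \<le> 0)}"

text \<open>
  The following predicates describe a set in the factor space of the block \<open>S\<close>. In the
  second-order cone, the coordinate \<open>k\<close> plays the role of the scalar variable \<open>y\<close>, the
  remaining coordinates of \<open>S\<close> that of \<open>x\<close>. In the sublevel sets, the functions \<open>\<Phi> 0, \<dots>, \<Phi> (p - 1)\<close>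
  are the components of a smooth vector-valued function on the factor space; every
  smooth function there is the restriction of a smooth function on the ambient space, and its
  gradient is the block part of the gradient of any such extension.
\<close>

definition second_order_cone :: "'n set \<Rightarrow> (real^'n::finite) set \<Rightarrow> bool" where
  "second_order_cone S C \<longleftrightarrow> (\<exists>k\<in>S. \<exists>t\<ge>0.
     C = {v \<in> coord_space S. norm (restrict_to (S - {k}) v) \<le> t * v $ k \<and> 0 \<le> v $ k})"

definition sublevel_set :: "'n set \<Rightarrow> nat \<Rightarrow> (nat \<Rightarrow> real^'n::finite \<Rightarrow> real) \<Rightarrow> (real^'n) set" where
  "sublevel_set S p \<Phi> = {x \<in> coord_space S. \<forall>l<p. \<Phi> l x \<le> 0}"

definition smooth_sublevel :: "'n set \<Rightarrow> (real^'n::finite) set \<Rightarrow> bool" where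
  "smooth_sublevel S C \<longleftrightarrow> (\<exists>p \<Phi>. (\<forall>l<p. smooth_fun (\<Phi> l)) \<and> C = sublevel_set S p \<Phi>)"

definition regular_convex_sublevel :: "'n set \<Rightarrow> (real^'n::finite) set \<Rightarrow> bool" where
  "regular_convex_sublevel S C \<longleftrightarrow> (\<exists>p \<Phi>.
     (\<forall>l<p. smooth_fun (\<Phi> l) \<and> convex_on (coord_space S) (\<Phi> l)) \<and>
     C = sublevel_set S p \<Phi> \<and>
     (\<forall>x0\<in>C. lin_indep_family (\<lambda>l. restrict_to S (gradient (\<Phi> l) x0)) {l. l < p \<and> \<Phi> l x0 = 0}))"

section \<open>The quadratic program\<close>

text \<open>
  The scalar coordinates of \<open>z\<close> and the rows of \<open>H\<close> are indexed by finite types \<open>'z\<close> and \<open>'w\<close>.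
  \<open>zblk k = (i, j)\<close> says that coordinate \<open>k\<close> belongs to the subvector \<open>z\<^sub>i\<^sub>j\<close>, and \<open>wblk r = i\<close>
  that row \<open>r\<close> belongs to block row \<open>i\<close>; the dimensions of the blocks are the cardinalities of
  the fibres. \<open>eqrows\<close> is the set of equality rows, all other rows being inequality rows.
\<close>

record ('z::finite, 'w::finite) qp =
  horizon :: nat
  mult :: "nat \<Rightarrow> nat"
  zblk :: "'z \<Rightarrow> nat \<times> nat"
  wblk :: "'w \<Rightarrow> nat"
  eqrows :: "'w set"
  rho :: "nat \<times> nat \<Rightarrow> real"
  qvec :: "real^'z"
  Hmat :: "real^'z^'w"
  gvec :: "real^'w"
  Dblk :: "nat \<times> nat \<Rightarrow> (real^'z) set"

definition blocks :: "('z::finite, 'w::finite) qp \<Rightarrow> (nat \<times> nat) set" where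
  "blocks Q = {(i, j). i \<le> horizon Q + 1 \<and> 1 \<le> j \<and> j \<le> mult Q i}"

definition block :: "('z::finite, 'w::finite) qp \<Rightarrow> nat \<times> nat \<Rightarrow> 'z set" where
  "block Q b = {k. zblk Q k = b}"

definition Pmat :: "('z::finite, 'w::finite) qp \<Rightarrow> real^'z^'z" where
  "Pmat Q = (\<chi> k l. if k = l then rho Q (zblk Q k) else 0)"

definition Dset :: "('z::finite, 'w::finite) qp \<Rightarrow> (real^'z) set" where
  "Dset Q = {z. \<forall>b\<in>blocks Q. restrict_to (block Q b) z \<in> Dblk Q b}"

definition Kset :: "('z::finite, 'w::finite) qp \<Rightarrow> (real^'w) set" where
  "Kset Q = {v. \<forall>r. if r \<in> eqrows Q then v $ r = 0 else 0 \<le> v $ r}"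

definition Kpolar :: "('z::finite, 'w::finite) qp \<Rightarrow> (real^'w) set" where
  "Kpolar Q = {w. \<forall>r. r \<notin> eqrows Q \<longrightarrow> w $ r \<le> 0}"

definition valid_qp :: "('z::finite, 'w::finite) qp \<Rightarrow> bool" where
  "valid_qp Q \<longleftrightarrow>
     (\<forall>k. zblk Q k \<in> blocks Q) \<and>
     (\<forall>r. wblk Q r \<le> horizon Q) \<and>
     (\<forall>b\<in>blocks Q. 0 < rho Q b) \<and>
     (\<forall>r k. Hmat Q $ r $ k \<noteq> 0 \<longrightarrow>
        fst (zblk Q k) = wblk Q r \<or> fst (zblk Q k) = wblk Q r + 1) \<and>
     (\<forall>b\<in>blocks Q. convex (Dblk Q b) \<and>
        (smooth_sublevel (block Q b) (Dblk Q b) \<or> second_order_cone (block Q b) (Dblk Q b))) \<and>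
     Dset Q \<noteq> {}"

definition objective :: "('z::finite, 'w::finite) qp \<Rightarrow> real^'z \<Rightarrow> real" where
  "objective Q z = 1/2 * (z \<bullet> (Pmat Q *v z)) + qvec Q \<bullet> z"

definition feasible :: "('z::finite, 'w::finite) qp \<Rightarrow> (real^'z) set" where
  "feasible Q = {z. Hmat Q *v z - gvec Q \<in> Kset Q \<and> z \<in> Dset Q}"

definition optimal :: "('z::finite, 'w::finite) qp \<Rightarrow> real^'z \<Rightarrow> bool" where
  "optimal Q z \<longleftrightarrow> z \<in> feasible Q \<and> (\<forall>y\<in>feasible Q. objective Q z \<le> objective Q y)"

text \<open>The rows of \<open>H\<^sub>E\<close> together with the rows of \<open>H\<^sub>I\<close> that are active at \<open>z\<close>.\<close>

definition active_rows :: "('z::finite, 'w::finite) qp \<Rightarrow> real^'z \<Rightarrow> 'w set" where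
  "active_rows Q z = eqrows Q \<union> {r. r \<notin> eqrows Q \<and> (Hmat Q *v z) $ r = gvec Q $ r}"

definition extended_LICQ :: "('z::finite, 'w::finite) qp \<Rightarrow> real^'z \<Rightarrow> bool" where
  "extended_LICQ Q z \<longleftrightarrow>
     span ((\<lambda>r. row r (Hmat Q)) ` active_rows Q z) \<inter> span (normal_cone (Dset Q) z) = {0} \<and>
     lin_indep_family (\<lambda>r. row r (Hmat Q)) (active_rows Q z)"

section \<open>The PIPG operator\<close>

abbreviation opnorm :: "real^'n::finite^'m::finite \<Rightarrow> real" where
  "opnorm A \<equiv> onorm ((*v) A)"

definition z_arg :: "('z::finite, 'w::finite) qp \<Rightarrow> real \<Rightarrow> (real^'z) \<times> (real^'w) \<Rightarrow> real^'z" where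
  "z_arg Q \<alpha> x = (case x of (z, w) \<Rightarrow>
     z - \<alpha> *\<^sub>R (Pmat Q *v z + qvec Q + transpose (Hmat Q) *v w))"

definition z_next :: "('z::finite, 'w::finite) qp \<Rightarrow> real \<Rightarrow> (real^'z) \<times> (real^'w) \<Rightarrow> real^'z" where
  "z_next Q \<alpha> x = closest_point (Dset Q) (z_arg Q \<alpha> x)"

definition w_arg :: "('z::finite, 'w::finite) qp \<Rightarrow> real \<Rightarrow> real \<Rightarrow> (real^'z) \<times> (real^'w) \<Rightarrow> real^'w" where
  "w_arg Q \<alpha> \<beta> x = (case x of (z, w) \<Rightarrow>
     w + \<beta> *\<^sub>R (Hmat Q *v (2 *\<^sub>R z_next Q \<alpha> x - z) - gvec Q))"

definition pipg ::
    "('z::finite, 'w::finite) qp \<Rightarrow> real \<Rightarrow> real \<Rightarrow> (real^'z) \<times> (real^'w) \<Rightarrow> (real^'z) \<times> (real^'w)" where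
  "pipg Q \<alpha> \<beta> x = (z_next Q \<alpha> x, closest_point (Kpolar Q) (w_arg Q \<alpha> \<beta> x))"

definition Fix :: "('a \<Rightarrow> 'a) \<Rightarrow> 'a set" where
  "Fix T = {x. T x = x}"

definition residual ::
    "('z::finite, 'w::finite) qp \<Rightarrow> real \<Rightarrow> real \<Rightarrow> (real^'z) \<times> (real^'w) \<Rightarrow> (real^'z) \<times> (real^'w)" where
  "residual Q \<alpha> \<beta> x = x - pipg Q \<alpha> \<beta> x"

text \<open>The action on pairs of the block matrix with first block row \<open>A, B\<close> and second \<open>C, D\<close>.\<close>

definition block_op ::
    "real^'z^'z \<Rightarrow> real^'w^'z \<Rightarrow> real^'z^'w \<Rightarrow> real^'w^'w \<Rightarrow>
     (real^'z::finite) \<times> (real^'w::finite) \<Rightarrow> (real^'z) \<times> (real^'w)" where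
  "block_op A B C D v = (A *v fst v + B *v snd v, C *v fst v + D *v snd v)"

definition Mop :: "('z::finite, 'w::finite) qp \<Rightarrow> real \<Rightarrow> real \<Rightarrow>
    (real^'z) \<times> (real^'w) \<Rightarrow> (real^'z) \<times> (real^'w)" where
  "Mop Q \<alpha> \<beta> = block_op
     ((1 / \<alpha>) *\<^sub>R mat 1 - Pmat Q) (- transpose (Hmat Q))
     (- Hmat Q) ((1 / \<beta>) *\<^sub>R mat 1)"

definition mnorm :: "('z::finite, 'w::finite) qp \<Rightarrow> real \<Rightarrow> real \<Rightarrow> (real^'z) \<times> (real^'w) \<Rightarrow> real" where
  "mnorm Q \<alpha> \<beta> v = sqrt (v \<bullet> Mop Q \<alpha> \<beta> v)"

definition JT_defined :: "('z::finite, 'w::finite) qp \<Rightarrow> real \<Rightarrow> real \<Rightarrow> (real^'z) \<times> (real^'w) \<Rightarrow> bool" where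
  "JT_defined Q \<alpha> \<beta> x \<longleftrightarrow>
     closest_point (Dset Q) differentiable (at (z_arg Q \<alpha> x)) \<and>
     closest_point (Kpolar Q) differentiable (at (w_arg Q \<alpha> \<beta> x))"

definition JT :: "('z::finite, 'w::finite) qp \<Rightarrow> real \<Rightarrow> real \<Rightarrow> (real^'z) \<times> (real^'w) \<Rightarrow>
    (real^'z) \<times> (real^'w) \<Rightarrow> (real^'z) \<times> (real^'w)" where
  "JT Q \<alpha> \<beta> x =
     (let JD = jacobian (closest_point (Dset Q)) (at (z_arg Q \<alpha> x));
          JK = jacobian (closest_point (Kpolar Q)) (at (w_arg Q \<alpha> \<beta> x));
          P = Pmat Q; H = Hmat Q
      in block_op
           (JD ** (mat 1 - \<alpha> *\<^sub>R P))
           (- (\<alpha> *\<^sub>R (JD ** transpose H)))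
           (\<beta> *\<^sub>R (JK ** H ** (- mat 1 + 2 *\<^sub>R (JD ** (mat 1 - \<alpha> *\<^sub>R P)))))
           (JK - (2 * \<alpha> * \<beta>) *\<^sub>R (JK ** H ** JD ** transpose H)))"

section \<open>The Newton-PIPG algorithm\<close>

definition newton_regular :: "('z::finite, 'w::finite) qp \<Rightarrow> real \<Rightarrow> real \<Rightarrow> (real^'z) \<times> (real^'w) \<Rightarrow> bool" where
  "newton_regular Q \<alpha> \<beta> x \<longleftrightarrow> JT_defined Q \<alpha> \<beta> x \<and> bij (\<lambda>p. p - JT Q \<alpha> \<beta> x p)"

definition newton_step ::
    "('z::finite, 'w::finite) qp \<Rightarrow> real \<Rightarrow> real \<Rightarrow> (real^'z) \<times> (real^'w) \<Rightarrow> (real^'z) \<times> (real^'w) \<Rightarrow> bool" where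
  "newton_step Q \<alpha> \<beta> x p \<longleftrightarrow>
     (if newton_regular Q \<alpha> \<beta> x then p - JT Q \<alpha> \<beta> x p = pipg Q \<alpha> \<beta> x - x
      else p = pipg Q \<alpha> \<beta> x - x)"

text \<open>
  \<open>x\<close> is the sequence of iterates of a run of the algorithm with arbitrary initial point \<open>x 0\<close>,
  and \<open>p\<close> the sequence of candidate steps chosen in this run.
\<close>

definition newton_pipg_run ::
    "('z::finite, 'w::finite) qp \<Rightarrow> real \<Rightarrow> real \<Rightarrow> real \<Rightarrow> real \<Rightarrow>
     (nat \<Rightarrow> (real^'z) \<times> (real^'w)) \<Rightarrow> (nat \<Rightarrow> (real^'z) \<times> (real^'w)) \<Rightarrow> bool" where
  "newton_pipg_run Q \<alpha> \<beta> c \<sigma> x p \<longleftrightarrow> (\<forall>k.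
     (p k = 0 \<or> newton_step Q \<alpha> \<beta> (x k) (p k)) \<and>
     x (Suc k) =
       (if mnorm Q \<alpha> \<beta> (residual Q \<alpha> \<beta> (x k + p k)) \<le> c * mnorm Q \<alpha> \<beta> (residual Q \<alpha> \<beta> (x k)) \<and>
           mnorm Q \<alpha> \<beta> (p k) < \<sigma> * mnorm Q \<alpha> \<beta> (residual Q \<alpha> \<beta> (x k))
        then x k + p k
        else pipg Q \<alpha> \<beta> (x k)))"

end

theory Submission
  imports Defs
begin

text \<open>
  \<open>T\<close> is the resolvent of a monotone operator in the metric of \<open>M\<close>, hence
  \<open>\<parallel>T x - T y\<parallel>\<^sup>2 + \<parallel>R x - R y\<parallel>\<^sup>2 \<le> \<parallel>x - y\<parallel>\<^sup>2\<close>. The residual norm never increases, and drops by the factor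
  \<open>c\<close> at a Newton update. So it tends to \<open>0\<close> when there are infinitely many Newton updates, and
  otherwise by the usual Fejer argument. Newton updates move the iterate by at most
  \<open>\<sigma>\<close> times a geometrically decreasing sequence, so runs are bounded and converge to the unique
  fixed point.

  For the quadratic rate, strict complementarity and the regularity of the active constraints make
  the projection onto \<open>D\<close> the local solution map of a nonsingular KKT system near the fixed
  point, so its derivative is Lipschitz there, with kernel inside the span of the normal cone.
  If \<open>J v = v\<close> for the derivative \<open>J\<close> of \<open>T\<close>, linearising the resolvent inequality gives
  \<open>dz \<bullet> P dz \<le> 0\<close>, hence \<open>dz = 0\<close>; then \<open>H\<^sup>T dw\<close> lies in both spaces of the extended LICQ, so \<open>dw = 0\<close>.
  Thus \<open>I - J\<close> is invertible, the Newton steps contract quadratically and they pass both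
  acceptance tests once \<open>\<sigma>\<close> exceeds a bound for the inverse.
\<close>

section \<open>Functions whose derivative is Lipschitz at a point\<close>

text \<open>The Jacobian in the Newton equation is taken at the current iterate, so
  differentiability at the fixed point alone is too little: the projections must be differentiable
  on a whole neighbourhood, where \<open>JT\<close> is then the true derivative. Projections have
  kinks, and the relative interior hypotheses keep their arguments off them: every active multiplier
  is positive and stays so under perturbation, which freezes the set of active constraints.

  The second-order cone resists a description by smooth convex constraints: its norm constraint is
  not differentiable along the axis, the squared constraint is smooth but not convex, and the
  gradient of the latter vanishes at the apex. Hence the local description of a convex set asks for
  nonnegative curvature along tangent directions instead of convex constraint functions, and the
  apex is handled through a normal cone with nonempty interior.

  Newton updates need not decrease the distance to the fixed point. Only the two acceptance tests
  control them, the first through the residual, the second through the length of the step.\<close>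

text \<open>Only the deviation from the derivative at \<open>a\<close> is controlled: this suffices for the Newton
  estimates and is stable under local inversion.\<close>

definition c11_at :: "('a::euclidean_space \<Rightarrow> 'b::euclidean_space) \<Rightarrow> ('a \<Rightarrow> 'a \<Rightarrow> 'b) \<Rightarrow> 'a \<Rightarrow> bool" where
  "c11_at f f' a \<longleftrightarrow> (\<exists>L\<ge>0. \<exists>e>0. \<forall>x\<in>ball a e. (f has_derivative f' x) (at x) \<and>
     (\<forall>h. norm (f' x h - f' a h) \<le> L * norm (x - a) * norm h))"

lemma c11_atI:
  assumes "e > 0" "0 \<le> L" "\<And>x. x \<in> ball a e \<Longrightarrow> (f has_derivative f' x) (at x)"
    "\<And>x h. x \<in> ball a e \<Longrightarrow> norm (f' x h - f' a h) \<le> L * norm (x - a) * norm h"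
  shows "c11_at f f' a"
  using assms unfolding c11_at_def by blast

lemma c11_atE:
  assumes "c11_at f f' a"
  obtains e L where "e > 0" "0 \<le> L" "\<And>x. x \<in> ball a e \<Longrightarrow> (f has_derivative f' x) (at x)"
    "\<And>x h. x \<in> ball a e \<Longrightarrow> norm (f' x h - f' a h) \<le> L * norm (x - a) * norm h"
  using assms unfolding c11_at_def by blast

lemma c11_at_has_derivative: "c11_at f f' a \<Longrightarrow> (f has_derivative f' a) (at a)"
  unfolding c11_at_def by (meson centre_in_ball)

lemma c11_at_continuous: "c11_at f f' a \<Longrightarrow> continuous (at a) f"
  using c11_at_has_derivative has_derivative_continuous by blast

lemma c11_at_has_derivative_near:
  assumes "c11_at f f' a"
  shows "\<exists>e>0. \<forall>x\<in>ball a e. (f has_derivative f' x) (at x)"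
  using assms unfolding c11_at_def by blast

text \<open>Tolerance 1 in the definition of the derivative gives the constant
  \<open>onorm f' + 1\<close>; only increments from \<open>a\<close> are controlled.\<close>

lemma has_derivative_imp_locally_Lipschitz_at:
  fixes f :: "'a::real_normed_vector \<Rightarrow> 'b::real_normed_vector"
  assumes "(f has_derivative f') (at a)"
  obtains e L where "e > 0" "0 \<le> L" "\<And>x. x \<in> ball a e \<Longrightarrow> norm (f x - f a) \<le> L * norm (x - a)"
proof -
  have bl: "bounded_linear f'"
    using assms has_derivative_bounded_linear by blast
  obtain d where d: "d > 0"
    "\<And>y. norm (y - a) < d \<Longrightarrow> norm (f y - f a - f' (y - a)) \<le> 1 * norm (y - a)"
    using assms unfolding has_derivative_at_alt by (meson zero_less_one)
  show thesis
  proof (rule that[of d "onorm f' + 1"])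
    show "d > 0" by fact
    show "0 \<le> onorm f' + 1" using onorm_pos_le[OF bl] by linarith
    fix x assume "x \<in> ball a d"
    then have "norm (x - a) < d" by (simp add: dist_norm norm_minus_commute)
    then have "norm (f x - f a - f' (x - a)) \<le> norm (x - a)" using d(2) by fastforce
    moreover have "norm (f' (x - a)) \<le> onorm f' * norm (x - a)" by (rule onorm[OF bl])
    moreover have "norm (f x - f a) \<le> norm (f x - f a - f' (x - a)) + norm (f' (x - a))"
      by (metis diff_add_cancel norm_triangle_ineq)
    ultimately show "norm (f x - f a) \<le> (onorm f' + 1) * norm (x - a)"
      by (simp add: algebra_simps)
  qed
qed

lemma c11_at_affine:
  assumes "bounded_linear A"
  shows "c11_at (\<lambda>x. A x + c) (\<lambda>x. A) a"
proof (rule c11_atI[of 1 0])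
  show "((\<lambda>x. A x + c) has_derivative A) (at x)" for x
    using assms by (auto intro!: derivative_eq_intros bounded_linear_imp_has_derivative)
qed auto

lemma c11_at_linear: "bounded_linear A \<Longrightarrow> c11_at A (\<lambda>x. A) a"
  using c11_at_affine[of A 0] by simp

lemma c11_at_const: "c11_at (\<lambda>x. c) (\<lambda>x h. 0) a"
  using c11_at_affine[of "\<lambda>x. 0" c] by simp

lemma c11_at_cong:
  assumes "c11_at f f' a" "e > 0" "\<And>x. x \<in> ball a e \<Longrightarrow> g x = f x"
  shows "c11_at g f' a"
proof -
  obtain d L where d: "d > 0" "0 \<le> L" "\<And>x. x \<in> ball a d \<Longrightarrow> (f has_derivative f' x) (at x)"
    "\<And>x h. x \<in> ball a d \<Longrightarrow> norm (f' x h - f' a h) \<le> L * norm (x - a) * norm h"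
    by (rule c11_atE[OF assms(1)]) (rule that)
  show ?thesis
  proof (rule c11_atI[of "min d e" L])
    fix x assume x: "x \<in> ball a (min d e)"
    show "(g has_derivative f' x) (at x)"
      by (rule has_derivative_transform_within_open[of f _ _ _ "ball a e"]) (use d x assms in auto)
    show "norm (f' x h - f' a h) \<le> L * norm (x - a) * norm h" for h
      using d(4) x by simp
  qed (use d assms in auto)
qed

lemma c11_at_Pair:
  assumes "c11_at f f' a" "c11_at g g' a"
  shows "c11_at (\<lambda>x. (f x, g x)) (\<lambda>x h. (f' x h, g' x h)) a"
proof -
  obtain d L where d: "d > 0" "0 \<le> L" "\<And>x. x \<in> ball a d \<Longrightarrow> (f has_derivative f' x) (at x)"
    "\<And>x h. x \<in> ball a d \<Longrightarrow> norm (f' x h - f' a h) \<le> L * norm (x - a) * norm h"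
    by (rule c11_atE[OF assms(1)]) (rule that)
  obtain e M where e: "e > 0" "0 \<le> M" "\<And>x. x \<in> ball a e \<Longrightarrow> (g has_derivative g' x) (at x)"
    "\<And>x h. x \<in> ball a e \<Longrightarrow> norm (g' x h - g' a h) \<le> M * norm (x - a) * norm h"
    by (rule c11_atE[OF assms(2)]) (rule that)
  show ?thesis
  proof (rule c11_atI[of "min d e" "L + M"])
    fix x assume x: "x \<in> ball a (min d e)"
    show "((\<lambda>x. (f x, g x)) has_derivative (\<lambda>h. (f' x h, g' x h))) (at x)"
      using d e x by (intro has_derivative_Pair) auto
    fix h
    have "norm ((f' x h, g' x h) - (f' a h, g' a h)) \<le> norm (f' x h - f' a h) + norm (g' x h - g' a h)"
      by (simp add: norm_Pair_le)
    also have "\<dots> \<le> L * norm (x - a) * norm h + M * norm (x - a) * norm h"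
      using d(4)[of x h] e(4)[of x h] x by simp
    finally show "norm ((f' x h, g' x h) - (f' a h, g' a h)) \<le> (L + M) * norm (x - a) * norm h"
      by (simp add: algebra_simps)
  qed (use d e in auto)
qed

lemma c11_at_compose:
  assumes f: "c11_at f f' a" and g: "c11_at g g' (f a)"
  shows "c11_at (\<lambda>x. g (f x)) (\<lambda>x h. g' (f x) (f' x h)) a"
proof -
  obtain d L where d: "d > 0" "0 \<le> L" "\<And>x. x \<in> ball a d \<Longrightarrow> (f has_derivative f' x) (at x)"
    "\<And>x h. x \<in> ball a d \<Longrightarrow> norm (f' x h - f' a h) \<le> L * norm (x - a) * norm h"
    by (rule c11_atE[OF f]) (rule that)
  obtain e M where e: "e > 0" "0 \<le> M" "\<And>x. x \<in> ball (f a) e \<Longrightarrow> (g has_derivative g' x) (at x)"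
    "\<And>x h. x \<in> ball (f a) e \<Longrightarrow> norm (g' x h - g' (f a) h) \<le> M * norm (x - f a) * norm h"
    by (rule c11_atE[OF g]) (rule that)
  obtain r K where r: "r > 0" "0 \<le> K" "\<And>x. x \<in> ball a r \<Longrightarrow> norm (f x - f a) \<le> K * norm (x - a)"
    using has_derivative_imp_locally_Lipschitz_at[OF c11_at_has_derivative[OF f]] by blast
  have blf: "bounded_linear (f' a)" and blg: "bounded_linear (g' (f a))"
    using f g c11_at_has_derivative has_derivative_bounded_linear by blast+
  define kf where "kf = onorm (f' a)"
  define kg where "kg = onorm (g' (f a))"
  have kf: "norm (f' a h) \<le> kf * norm h" "0 \<le> kf" for h
    unfolding kf_def using onorm[OF blf] onorm_pos_le[OF blf] by auto
  have kg: "norm (g' (f a) h) \<le> kg * norm h" "0 \<le> kg" for h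
    unfolding kg_def using onorm[OF blg] onorm_pos_le[OF blg] by auto
  \<comment> \<open>The bound 1 turns \<open>L * norm (x - a) * norm h\<close> into
    \<open>L * norm h\<close>, and \<open>e / (K + 1)\<close> keeps \<open>f x\<close> in the ball
    around \<open>f a\<close>; the added 1 avoids division by zero.\<close>
  define s where "s = min (min d r) (min 1 (e / (K + 1)))"
  have s: "s > 0" using d r e by (simp add: s_def)
  show ?thesis
  proof (rule c11_atI[of s "M * K * (kf + L) + kg * L"])
    fix x assume x: "x \<in> ball a s"
    then have xx: "x \<in> ball a d" "x \<in> ball a r" "norm (x - a) < 1" "norm (x - a) < e / (K + 1)"
      by (auto simp: s_def dist_norm norm_minus_commute)
    have fa: "norm (f x - f a) \<le> K * norm (x - a)" using r xx by blast
    have "K * norm (x - a) \<le> (K + 1) * norm (x - a)" by (simp add: algebra_simps)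
    also have "\<dots> < e" using xx(4) r(2) by (simp add: field_simps)
    finally have fx: "f x \<in> ball (f a) e" using fa by (simp add: dist_norm norm_minus_commute)
    show "((\<lambda>x. g (f x)) has_derivative (\<lambda>h. g' (f x) (f' x h))) (at x)"
      by (rule has_derivative_compose[OF d(3)[OF xx(1)] e(3)[OF fx]])
    fix h
    have "bounded_linear (g' (f x))" using e(3)[OF fx] has_derivative_bounded_linear by blast
    have 1: "norm (f' x h) \<le> (kf + L) * norm h"
    proof -
      have "norm (f' x h) \<le> norm (f' a h) + norm (f' x h - f' a h)"
        by (metis add_diff_cancel_left' add_diff_eq norm_triangle_ineq)
      also have "\<dots> \<le> kf * norm h + L * norm (x - a) * norm h"
        using kf(1)[of h] d(4)[OF xx(1), of h] by simp
      also have "L * norm (x - a) * norm h \<le> L * norm h"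
        using xx(3) d(2) by (intro mult_right_mono mult_left_le) auto
      finally show ?thesis by (simp add: algebra_simps)
    qed
    have "norm (g' (f x) (f' x h) - g' (f a) (f' a h))
        = norm ((g' (f x) (f' x h) - g' (f a) (f' x h)) + g' (f a) (f' x h - f' a h))"
      using blg by (simp add: bounded_linear.linear linear_diff)
    also have "\<dots> \<le> norm (g' (f x) (f' x h) - g' (f a) (f' x h)) + norm (g' (f a) (f' x h - f' a h))"
      by (rule norm_triangle_ineq)
    also have "norm (g' (f x) (f' x h) - g' (f a) (f' x h)) \<le> M * norm (f x - f a) * norm (f' x h)"
      by (rule e(4)[OF fx])
    also have "\<dots> \<le> M * (K * norm (x - a)) * ((kf + L) * norm h)"
      using e(2) fa 1 r(2) by (intro mult_mono mult_nonneg_nonneg) auto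
    also have "norm (g' (f a) (f' x h - f' a h)) \<le> kg * norm (f' x h - f' a h)"
      by (rule kg(1))
    also have "\<dots> \<le> kg * (L * norm (x - a) * norm h)"
      using d(4)[OF xx(1), of h] kg(2) by (intro mult_left_mono) auto
    finally show "norm (g' (f x) (f' x h) - g' (f a) (f' a h))
        \<le> (M * K * (kf + L) + kg * L) * norm (x - a) * norm h"
      by (simp add: algebra_simps)
  qed (use s e r kf kg d in auto)
qed

lemma c11_at_linear_compose:
  assumes "bounded_linear A" "c11_at f f' a"
  shows "c11_at (\<lambda>x. A (f x)) (\<lambda>x h. A (f' x h)) a"
  by (rule c11_at_compose[OF assms(2) c11_at_linear[OF assms(1)]])

lemma c11_at_add:
  assumes "c11_at f f' a" "c11_at g g' a"
  shows "c11_at (\<lambda>x. f x + g x) (\<lambda>x h. f' x h + g' x h) a"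
proof -
  have "bounded_linear (\<lambda>p::'b \<times> 'b. fst p + snd p)"
    by (intro bounded_linear_add bounded_linear_fst bounded_linear_snd)
  from c11_at_linear_compose[OF this c11_at_Pair[OF assms]] show ?thesis by simp
qed

lemma c11_at_sum:
  assumes "finite I" "\<And>i. i \<in> I \<Longrightarrow> c11_at (f i) (f' i) a"
  shows "c11_at (\<lambda>x. \<Sum>i\<in>I. f i x) (\<lambda>x h. \<Sum>i\<in>I. f' i x h) a"
  using assms by (induction I rule: finite_induct) (auto intro: c11_at_const c11_at_add)


text \<open>Scaling is bilinear on pairs, so its derivative depends linearly on the base point, with
  Lipschitz constant 2; the product rule is then an instance of the chain rule.\<close>

lemma c11_at_scaleR:
  fixes f :: "'d::euclidean_space \<Rightarrow> real" and g :: "'d \<Rightarrow> 'b::euclidean_space"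
  assumes "c11_at f f' a" "c11_at g g' a"
  shows "c11_at (\<lambda>x. f x *\<^sub>R g x) (\<lambda>x h. f x *\<^sub>R g' x h + f' x h *\<^sub>R g x) a"
proof -
  have "c11_at (\<lambda>p::real \<times> 'b. fst p *\<^sub>R snd p) (\<lambda>p h. fst p *\<^sub>R snd h + fst h *\<^sub>R snd p) q" for q
  proof (rule c11_atI[of 1 2])
    show "((\<lambda>p::real \<times> 'b. fst p *\<^sub>R snd p) has_derivative (\<lambda>h. fst p *\<^sub>R snd h + fst h *\<^sub>R snd p)) (at p)" for p
      by (auto intro!: derivative_eq_intros)
    fix p h :: "real \<times> 'b"
    have "(fst p *\<^sub>R snd h + fst h *\<^sub>R snd p) - (fst q *\<^sub>R snd h + fst h *\<^sub>R snd q)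
       = fst (p - q) *\<^sub>R snd h + fst h *\<^sub>R snd (p - q)"
      by (simp add: algebra_simps)
    also have "norm \<dots> \<le> norm (fst (p - q)) * norm (snd h) + norm (fst h) * norm (snd (p - q))"
      using norm_triangle_ineq[of "fst (p - q) *\<^sub>R snd h" "fst h *\<^sub>R snd (p - q)"] by simp
    also have "\<dots> \<le> norm (p - q) * norm h + norm h * norm (p - q)"
    proof -
      have *: "norm (fst u) \<le> norm u" "norm (snd u) \<le> norm u" for u :: "real \<times> 'b"
        by (metis norm_fst_le norm_snd_le prod.collapse)+
      show ?thesis by (intro add_mono mult_mono * norm_ge_zero)
    qed
    finally show "norm ((fst p *\<^sub>R snd h + fst h *\<^sub>R snd p) - (fst q *\<^sub>R snd h + fst h *\<^sub>R snd q))
       \<le> 2 * norm (p - q) * norm h" by (simp add: algebra_simps)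
  qed auto
  from c11_at_compose[OF c11_at_Pair[OF assms] this] show ?thesis by simp
qed

text \<open>By Cauchy-Schwarz, the derivative deviates no more than the gradient does, and
  \<open>G\<close>, being differentiable at \<open>a\<close>, is Lipschitz there.\<close>

lemma c11_at_potential:
  fixes \<phi> :: "'a::euclidean_space \<Rightarrow> real"
  assumes "open U" "a \<in> U" "\<And>x. x \<in> U \<Longrightarrow> (\<phi> has_derivative (\<lambda>h. G x \<bullet> h)) (at x)" "c11_at G G' a"
  shows "c11_at \<phi> (\<lambda>x h. G x \<bullet> h) a"
proof -
  obtain e where e: "e > 0" "ball a e \<subseteq> U"
    using assms(1,2) openE by blast
  obtain r K where r: "r > 0" "0 \<le> K" "\<And>x. x \<in> ball a r \<Longrightarrow> norm (G x - G a) \<le> K * norm (x - a)"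
    using has_derivative_imp_locally_Lipschitz_at[OF c11_at_has_derivative[OF assms(4)]] by blast
  show ?thesis
  proof (rule c11_atI[of "min e r" K])
    fix x assume x: "x \<in> ball a (min e r)"
    show "(\<phi> has_derivative (\<lambda>h. G x \<bullet> h)) (at x)" using assms(3) e x by auto
    fix h
    have "norm (G x \<bullet> h - G a \<bullet> h) = \<bar>(G x - G a) \<bullet> h\<bar>" by (simp add: inner_diff_left)
    also have "\<dots> \<le> norm (G x - G a) * norm h" by (rule Cauchy_Schwarz_ineq2)
    also have "\<dots> \<le> K * norm (x - a) * norm h" using r(3) x by (intro mult_right_mono) auto
    finally show "norm (G x \<bullet> h - G a \<bullet> h) \<le> K * norm (x - a) * norm h" .
  qed (use e r in auto)
qed

lemma injective_linear_lower_bound_near: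
  fixes A B :: "'a::euclidean_space \<Rightarrow> 'b::euclidean_space"
  assumes "linear A" "\<And>h. m * norm h \<le> norm (A h)" "\<And>h. norm (B h - A h) \<le> \<epsilon> * norm h"
  shows "(m - \<epsilon>) * norm h \<le> norm (B h)"
proof -
  have "norm (A h) \<le> norm (B h) + norm (B h - A h)"
    by (metis norm_minus_commute norm_triangle_sub)
  then have "m * norm h \<le> norm (B h) + \<epsilon> * norm h"
    using assms(2)[of h] assms(3)[of h] by linarith
  then show ?thesis by (simp add: algebra_simps)
qed

text \<open>An inverse function theorem in this class. Continuity of \<open>F'\<close> is known only
  at \<open>a\<close>: injectivity comes from closeness to \<open>F' a\<close>, openness of the
  image from invariance of domain, and the derivative of the inverse from invertibility of
  \<open>F' x\<close> at each nearby point.\<close>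

lemma c11_at_inverse:
  fixes F :: "'a::euclidean_space \<Rightarrow> 'a"
  assumes F: "c11_at F F' a" and inj: "\<And>h. F' a h = 0 \<Longrightarrow> h = 0"
  obtains g g' W where "open W" "F a \<in> W" "g (F a) = a" "\<And>q. q \<in> W \<Longrightarrow> F (g q) = q"
    "c11_at g g' (F a)" "\<And>k. F' a (g' (F a) k) = k"
proof -
  obtain d L where d: "d > 0" "0 \<le> L" "\<And>x. x \<in> ball a d \<Longrightarrow> (F has_derivative F' x) (at x)"
    "\<And>x h. x \<in> ball a d \<Longrightarrow> norm (F' x h - F' a h) \<le> L * norm (x - a) * norm h"
    by (rule c11_atE[OF F]) (rule that)
  have lin: "linear (F' x)" if "x \<in> ball a d" for x
    using d(3)[OF that] has_derivative_linear by blast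
  have lina: "linear (F' a)" using lin d(1) by simp
  have "inj (F' a)"
    using inj lina by (simp add: linear_injective_0)
  then obtain m where m: "m > 0" "\<And>h. m * norm h \<le> norm (F' a h)"
    using linear_inj_bounded_below_pos[OF lina] by (metis mult.commute)
  \<comment> \<open>On this ball \<open>F' x\<close> deviates from \<open>F' a\<close> by at most
    \<open>m / 2\<close>, so it keeps half of the lower bound \<open>m\<close> and is
    invertible.\<close>
  define e where "e = min d (m / (2 * (L + 1)))"
  have e: "e > 0" "e \<le> d" using d m by (auto simp: e_def)
  have low: "m / 2 * norm h \<le> norm (F' x h)" if "x \<in> ball a e" for x h
  proof -
    have xd: "x \<in> ball a d" and xm: "norm (x - a) < m / (2 * (L + 1))"
      using that by (auto simp: e_def dist_norm norm_minus_commute)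
    have "L * norm (x - a) \<le> (L + 1) * norm (x - a)" by (simp add: algebra_simps)
    also have "\<dots> \<le> m / 2" using xm d(2) by (simp add: field_simps)
    finally have "L * norm (x - a) \<le> m / 2" .
    then have "(m - m / 2) * norm h \<le> norm (F' x h)"
      by (intro injective_linear_lower_bound_near[OF lina m(2)] order_trans[OF d(4)[OF xd]] mult_right_mono) auto
    then show ?thesis by simp
  qed
  define G where "G x = inv (F' x)" for x
  have bijF: "bij (F' x)" if "x \<in> ball a e" for x
  proof -
    have lx: "linear (F' x)" using lin that e by auto
    have "h = 0" if "F' x h = 0" for h
      using low[OF \<open>x \<in> ball a e\<close>, of h] that m(1) by (simp add: mult_le_0_iff)
    then have "inj (F' x)" using lx by (simp add: linear_injective_0)
    then show ?thesis using lx linear_inj_imp_surj by (simp add: bij_def)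
  qed
  have FG: "F' x (G x k) = k" if "x \<in> ball a e" for x k
    using bijF[OF that] by (simp add: G_def bij_is_surj surj_f_inv_f)
  have linG: "linear (G x)" if x: "x \<in> ball a e" for x
    unfolding G_def using bijF[OF x] lin x e
    by (metis bij_betw_imp_inj_on dual_order.trans inj_linear_imp_inv_linear mem_ball order_less_le_trans)
  have normG: "norm (G x k) \<le> 2 / m * norm k" if "x \<in> ball a e" for x k
    using low[OF that, of "G x k"] FG[OF that, of k] m(1) by (simp add: field_simps)
  obtain r where r: "r > 0" "ball a r \<subseteq> ball a e" "inj_on F (ball a r)"
  proof (rule has_derivative_locally_injective[of a "ball a e" "G a" F' F])
    show "bounded_linear (G a)" using linG[of a] e by (simp add: linear_conv_bounded_linear)
    show "G a \<circ> F' a = id"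
      using bijF[of a] e by (auto simp: fun_eq_iff G_def bij_is_inj)
    show "\<And>x. x \<in> ball a e \<Longrightarrow> (F has_derivative F' x) (at x)" using d e by auto
    fix \<epsilon> :: real assume "\<epsilon> > 0"
    show "\<exists>\<delta>>0. \<forall>x. dist a x < \<delta> \<longrightarrow> onorm (\<lambda>v. F' x v - F' a v) < \<epsilon>"
    proof (intro exI[of _ "min d (\<epsilon> / (2 * (L + 1)))"] conjI allI impI)
      show "0 < min d (\<epsilon> / (2 * (L + 1)))" using d \<open>\<epsilon> > 0\<close> by simp
      fix x assume x: "dist a x < min d (\<epsilon> / (2 * (L + 1)))"
      then have "x \<in> ball a d" and n: "norm (x - a) < \<epsilon> / (2 * (L + 1))"
        by (auto simp: dist_norm norm_minus_commute)
      have "onorm (\<lambda>v. F' x v - F' a v) \<le> L * norm (x - a)"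
        by (rule onorm_bound) (use d \<open>x \<in> ball a d\<close> in auto)
      also have "\<dots> \<le> (L + 1) * norm (x - a)" by (simp add: algebra_simps)
      also have "\<dots> \<le> \<epsilon> / 2" using n d(2) by (simp add: field_simps)
      also have "\<dots> < \<epsilon>" using \<open>\<epsilon> > 0\<close> by simp
      finally show "onorm (\<lambda>v. F' x v - F' a v) < \<epsilon>" .
    qed
  qed (use e in auto)
  define B where "B = ball a r"
  define g where "g = inv_into B F"
  have contF: "continuous_on B F"
    unfolding B_def by (rule has_derivative_continuous_on[of _ _ F'])
      (meson d(3) e(2) has_derivative_at_withinI r(2) subsetD subset_ball)
  have openW: "open (F ` B)"
    by (rule invariance_of_domain) (use contF r in \<open>auto simp: B_def\<close>)
  have gF: "g (F x) = x" if "x \<in> B" for x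
    unfolding g_def using r(3) that by (simp add: B_def)
  have Fg: "F (g q) = q" and gB: "g q \<in> B" if "q \<in> F ` B" for q
    unfolding g_def using that by (auto simp: f_inv_into_f inv_into_into)
  have Be: "B \<subseteq> ball a e" "B \<subseteq> ball a d" using r e by (auto simp: B_def)
  have aB: "a \<in> B" using r by (simp add: B_def)
  have derg: "(g has_derivative G (g q)) (at q)" if q: "q \<in> F ` B" for q
  proof -
    have "(g has_derivative G (g q)) (at (F (g q)))"
      by (rule has_derivative_inverse_on[of B F F'])
        (use gB[OF q] Be gF d FG in \<open>auto simp: fun_eq_iff B_def subset_iff\<close>)
    then show ?thesis using Fg q by simp
  qed
  have gFa: "g (F a) = a" using gF aB by blast
  have "F a \<in> F ` B" using aB by blast
  then obtain \<rho> K where \<rho>: "\<rho> > 0" "0 \<le> K" "\<And>q. q \<in> ball (F a) \<rho> \<Longrightarrow> norm (g q - g (F a)) \<le> K * norm (q - F a)"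
    by (rule has_derivative_imp_locally_Lipschitz_at[OF derg]) (rule that)
  obtain s where s: "s > 0" "ball (F a) s \<subseteq> F ` B"
    using openW \<open>F a \<in> F ` B\<close> openE by blast
  have "c11_at g (\<lambda>q. G (g q)) (F a)"
  proof (rule c11_atI[of "min \<rho> s" "2 / m * (L * K * (2 / m))"])
    fix q assume q: "q \<in> ball (F a) (min \<rho> s)"
    then have qW: "q \<in> F ` B" using s by auto
    show "(g has_derivative G (g q)) (at q)" by (rule derg[OF qW])
    fix k
    have xB: "g q \<in> ball a e" "g q \<in> ball a d" "a \<in> ball a e" using gB[OF qW] Be aB by auto
    have bl: "linear (G a)" "linear (G (g q))" using linG xB by blast+
    \<comment> \<open>the resolvent identity \<open>B\<^sup>-\<^sup>1 - A\<^sup>-\<^sup>1 = B\<^sup>-\<^sup>1 (A - B) A\<^sup>-\<^sup>1\<close>\<close>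
    have "G (g q) (F' a (G a k) - F' (g q) (G a k)) = G (g q) k - G a k"
    proof -
      have "G (g q) (F' (g q) (G a k)) = G a k"
        using bijF[OF xB(1)] by (simp add: G_def bij_is_inj)
      then show ?thesis using bl FG[OF xB(3)] by (simp add: linear_diff)
    qed
    then have "norm (G (g q) k - G a k) \<le> 2 / m * norm (F' a (G a k) - F' (g q) (G a k))"
      using normG[OF xB(1)] by metis
    also have "\<dots> \<le> 2 / m * (L * norm (g q - a) * norm (G a k))"
      using d(4)[OF xB(2)] m(1) by (intro mult_left_mono) (auto simp: norm_minus_commute)
    also have "\<dots> \<le> 2 / m * (L * (K * norm (q - F a)) * (2 / m * norm k))"
      using \<rho>(3)[of q] q gFa normG[OF xB(3)] d(2) m(1) \<rho>(2)
      by (intro mult_left_mono mult_mono mult_nonneg_nonneg) auto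
    finally show "norm (G (g q) k - G (g (F a)) k) \<le> 2 / m * (L * K * (2 / m)) * norm (q - F a) * norm k"
      using gFa by (simp add: algebra_simps)
  qed (use \<rho> s d m in auto)
  then show thesis
    using that[of "F ` B" g "\<lambda>q. G (g q)"] openW aB gFa Fg FG[of a] e by auto
qed

section \<open>Smooth functions and their gradients\<close>

lemma frechet_derivative_Basis_expansion:
  fixes f :: "'a::euclidean_space \<Rightarrow> real"
  assumes "f differentiable (at x)"
  shows "frechet_derivative f (at x) h = (\<Sum>b\<in>Basis. (h \<bullet> b) * frechet_derivative f (at x) b)"
proof -
  have lin: "linear (frechet_derivative f (at x))" by (rule linear_frechet_derivative[OF assms])
  have "frechet_derivative f (at x) h = frechet_derivative f (at x) (\<Sum>b\<in>Basis. (h \<bullet> b) *\<^sub>R b)"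
    by (simp add: euclidean_representation)
  also have "\<dots> = (\<Sum>b\<in>Basis. (h \<bullet> b) *\<^sub>R frechet_derivative f (at x) b)"
    using lin by (simp add: linear_sum linear_scale)
  finally show ?thesis by simp
qed

text \<open>Each partial derivative is differentiable at \<open>a\<close>, hence Lipschitz there; as
  there are finitely many, they share a radius and their constants add up.\<close>

lemma Ck2_imp_c11_at:
  fixes f :: "'a::euclidean_space \<Rightarrow> real"
  assumes "Ck 2 f"
  shows "c11_at f (\<lambda>x. frechet_derivative f (at x)) a"
proof -
  let ?D = "\<lambda>b x. frechet_derivative f (at x) b"
  have df: "f differentiable (at x)" for x using assms by (simp add: numeral_2_eq_2)
  have dD: "?D b differentiable (at x)" if "b \<in> Basis" for b x
    using assms that by (simp add: numeral_2_eq_2)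
  have "\<forall>b\<in>Basis. \<exists>e L. e > 0 \<and> 0 \<le> L \<and> (\<forall>x\<in>ball a e. norm (?D b x - ?D b a) \<le> L * norm (x - a))"
  proof
    fix b :: 'a assume "b \<in> Basis"
    then obtain D' where "(?D b has_derivative D') (at a)"
      using dD unfolding differentiable_def by blast
    then obtain e L where "e > 0" "0 \<le> L" "\<And>x. x \<in> ball a e \<Longrightarrow> norm (?D b x - ?D b a) \<le> L * norm (x - a)"
      by (rule has_derivative_imp_locally_Lipschitz_at) (rule that)
    then show "\<exists>e L. e > 0 \<and> 0 \<le> L \<and> (\<forall>x\<in>ball a e. norm (?D b x - ?D b a) \<le> L * norm (x - a))"
      by (intro exI conjI ballI)
  qed
  then obtain e L where eL: "\<And>b. b \<in> Basis \<Longrightarrow> e b > 0 \<and> 0 \<le> L b \<and> (\<forall>x\<in>ball a (e b). norm (?D b x - ?D b a) \<le> L b * norm (x - a))"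
    by metis
  define \<epsilon> where "\<epsilon> = Min (e ` (Basis::'a set))"
  have \<epsilon>: "\<epsilon> > 0" "\<And>b. b \<in> Basis \<Longrightarrow> \<epsilon> \<le> e b" using eL by (auto simp: \<epsilon>_def)
  show ?thesis
  proof (rule c11_atI[of \<epsilon> "sum L Basis"])
    show "0 \<le> sum L Basis" using eL by (simp add: sum_nonneg)
    fix x assume x: "x \<in> ball a \<epsilon>"
    show "(f has_derivative frechet_derivative f (at x)) (at x)"
      using df frechet_derivative_works by blast
    fix h
    have "norm (frechet_derivative f (at x) h - frechet_derivative f (at a) h)
        = norm (\<Sum>b\<in>Basis. (h \<bullet> b) * (?D b x - ?D b a))"
      by (simp add: frechet_derivative_Basis_expansion[OF df, of _ h] sum_subtractf algebra_simps)
    also have "\<dots> \<le> (\<Sum>b\<in>Basis. norm h * (L b * norm (x - a)))"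
    proof (rule sum_norm_le)
      fix b :: 'a assume b: "b \<in> Basis"
      then have "x \<in> ball a (e b)" using x \<epsilon>(2)[OF b] by auto
      then show "norm ((h \<bullet> b) * (?D b x - ?D b a)) \<le> norm h * (L b * norm (x - a))"
        unfolding norm_mult using eL[OF b] b by (intro mult_mono) (auto simp: Basis_le_norm)
    qed
    finally show "norm (frechet_derivative f (at x) h - frechet_derivative f (at a) h) \<le> sum L Basis * norm (x - a) * norm h"
      by (simp add: sum_distrib_left sum_distrib_right algebra_simps)
  qed (use \<epsilon> in auto)
qed

text \<open>As \<open>gradient\<close> is a definite description, uniqueness has to come first;
  pairing two candidates with their difference shows it.\<close>

lemma gradient_works:
  fixes f :: "'a::euclidean_space \<Rightarrow> real"
  assumes "f differentiable (at x)"
  shows "(f has_derivative (\<lambda>h. gradient f x \<bullet> h)) (at x)"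
    and "gradient f x = (\<Sum>b\<in>Basis. frechet_derivative f (at x) b *\<^sub>R b)"
proof -
  let ?d = "\<Sum>b\<in>Basis. frechet_derivative f (at x) b *\<^sub>R b"
  have eq: "frechet_derivative f (at x) = (\<lambda>h. h \<bullet> ?d)"
    by (rule ext, subst frechet_derivative_Basis_expansion[OF assms])
       (simp add: inner_sum_right algebra_simps)
  have "(f has_derivative frechet_derivative f (at x)) (at x)"
    using assms frechet_derivative_works by blast
  then have 1: "GDERIV f x :> ?d" unfolding gderiv_def using eq by simp
  have "e = ?d" if "GDERIV f x :> e" for e
  proof -
    have "(\<lambda>h. h \<bullet> e) = (\<lambda>h. h \<bullet> ?d)"
      using that 1 unfolding gderiv_def by (rule has_derivative_unique)
    then have "(e - ?d) \<bullet> e = (e - ?d) \<bullet> ?d" by (rule fun_cong)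
    then have "(e - ?d) \<bullet> (e - ?d) = 0" by (simp only: inner_diff_right[of "e - ?d" e ?d] diff_self)
    then show ?thesis by (simp only: inner_eq_zero_iff right_minus_eq)
  qed
  then show 2: "gradient f x = ?d" unfolding gradient_def using 1 by (rule the_equality[rotated])
  show "(f has_derivative (\<lambda>h. gradient f x \<bullet> h)) (at x)"
    using 1 unfolding 2 gderiv_def by (simp add: inner_commute)
qed

lemma smooth_fun_differentiable: "smooth_fun f \<Longrightarrow> f differentiable (at x)"
  unfolding smooth_fun_def by (metis Ck.simps(2))

text \<open>The gradient costs one order of differentiability and \<open>Ck2_imp_c11_at\<close> two
  more, so third-order smoothness is drawn from \<open>smooth_fun\<close>.\<close>

lemma smooth_fun_c11_gradient:
  fixes f :: "'a::euclidean_space \<Rightarrow> real"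
  assumes "smooth_fun f"
  obtains G' where "c11_at (gradient f) G' a"
proof -
  have "Ck (Suc 2) f" using assms unfolding smooth_fun_def by blast
  then have C2: "Ck 2 (\<lambda>x. frechet_derivative f (at x) b)" if "b \<in> Basis" for b
    using that unfolding Ck.simps(2) by blast
  have eq: "gradient f = (\<lambda>x. \<Sum>b\<in>Basis. frechet_derivative f (at x) b *\<^sub>R b)"
    by (rule ext, rule gradient_works(2)[OF smooth_fun_differentiable[OF assms]])
  have "c11_at (gradient f)
     (\<lambda>x h. \<Sum>b\<in>Basis. frechet_derivative (\<lambda>x. frechet_derivative f (at x) b) (at x) h *\<^sub>R b) a"
    unfolding eq
  proof (rule c11_at_sum)
    fix b :: 'a assume "b \<in> Basis"
    from c11_at_linear_compose[OF bounded_linear_scaleR_left Ck2_imp_c11_at[OF C2[OF this]]]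
    show "c11_at (\<lambda>x. frechet_derivative f (at x) b *\<^sub>R b)
       (\<lambda>x h. frechet_derivative (\<lambda>x. frechet_derivative f (at x) b) (at x) h *\<^sub>R b) a" .
  qed simp
  then show thesis by (rule that)
qed

section \<open>Projections onto sets with regular active constraints\<close>

text \<open>The variational inequality for projections. Projections are identified through it below:
  a point is the projection as soon as the displacement is normal there.\<close>

lemma closest_point_eq_iff_normal_cone:
  fixes C :: "'a::euclidean_space set"
  assumes "closed C" "convex C" "C \<noteq> {}"
  shows "closest_point C y = x \<longleftrightarrow> y - x \<in> normal_cone C x"
proof
  assume x: "closest_point C y = x"
  then have "x \<in> C" using closest_point_in_set assms by blast
  moreover have "(y - x) \<bullet> (u - x) \<le> 0" if "u \<in> C" for u
    using closest_point_dot[OF assms(2,1) that, of y] x by simp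
  ultimately show "y - x \<in> normal_cone C x" by (simp add: normal_cone_def)
next
  assume n: "y - x \<in> normal_cone C x"
  have "dist y x \<le> dist y u" if "u \<in> C" for u
  proof -
    have "(norm (y - u))\<^sup>2 = (norm (y - x))\<^sup>2 - 2 * ((y - x) \<bullet> (u - x)) + (norm (u - x))\<^sup>2"
      unfolding power2_norm_eq_inner by (simp add: inner_diff_left inner_diff_right inner_commute)
    moreover have "(y - x) \<bullet> (u - x) \<le> 0" using n that by (simp add: normal_cone_def)
    ultimately have "(norm (y - x))\<^sup>2 \<le> (norm (y - u))\<^sup>2"
      using zero_le_power2[of "norm (u - x)"] by linarith
    then show ?thesis by (simp add: dist_norm abs_le_square_iff[symmetric])
  qed
  then show "closest_point C y = x"
    using closest_point_unique[OF assms(2,1)] n by (force simp: normal_cone_def)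
qed

lemma normal_cone_add: "u \<in> normal_cone C x \<Longrightarrow> v \<in> normal_cone C x \<Longrightarrow> u + v \<in> normal_cone C x"
  by (auto simp: normal_cone_def inner_add_left intro: add_nonpos_nonpos)

lemma normal_cone_scaleR: "v \<in> normal_cone C x \<Longrightarrow> 0 \<le> c \<Longrightarrow> c *\<^sub>R v \<in> normal_cone C x"
  by (auto simp: normal_cone_def mult_nonneg_nonpos)

lemma normal_cone_0: "x \<in> C \<Longrightarrow> 0 \<in> normal_cone C x"
  by (simp add: normal_cone_def)

lemma convex_normal_cone: "convex (normal_cone C x)"
  by (rule convexI) (intro normal_cone_add normal_cone_scaleR)

lemma normal_cone_sum: "x \<in> C \<Longrightarrow> (\<And>i. i \<in> I \<Longrightarrow> f i \<in> normal_cone C x) \<Longrightarrow> sum f I \<in> normal_cone C x"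
  by (induction I rule: infinite_finite_induct) (auto simp: normal_cone_0 normal_cone_add)

text \<open>Prolonging the segment from \<open>v + u\<close> to \<open>v\<close> a little beyond
  \<open>v\<close> stays in the cone and subtracts a multiple of \<open>u\<close>. In this form the
  relative interior later yields strictly positive multipliers.\<close>

lemma rel_interior_normal_cone_shrink:
  fixes C :: "'a::euclidean_space set"
  assumes "v \<in> rel_interior (normal_cone C x)" "u \<in> normal_cone C x"
  obtains e where "e > 0" "v - e *\<^sub>R u \<in> normal_cone C x"
proof -
  have v: "v \<in> normal_cone C x" using assms(1) rel_interior_subset by blast
  then have "v + u \<in> normal_cone C x" using assms(2) by (rule normal_cone_add)
  then obtain e where "e > 1" "(1 - e) *\<^sub>R (v + u) + e *\<^sub>R v \<in> normal_cone C x"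
    using assms(1) convex_rel_interior_iff[OF convex_normal_cone] v by blast
  then show thesis using that[of "e - 1"] by (simp add: algebra_simps)
qed

text \<open>The coordinate functionals on the independent vectors extend to the whole space, and the
  adjoint at 1 represents each of them as an inner product.\<close>

lemma lin_indep_family_dual_basis:
  fixes w :: "'i \<Rightarrow> 'a::euclidean_space"
  assumes "lin_indep_family w A"
  obtains e where "\<And>i j. i \<in> A \<Longrightarrow> j \<in> A \<Longrightarrow> w j \<bullet> e i = (if i = j then 1 else 0)"
proof -
  have inj: "inj_on w A" and ind: "independent (w ` A)"
    using assms by (auto simp: lin_indep_family_def)
  have "\<exists>a. \<forall>j\<in>A. w j \<bullet> a = (if i = j then 1 else 0)" if "i \<in> A" for i
  proof -
    obtain f :: "'a \<Rightarrow> real" where f: "linear f" "\<forall>x\<in>w ` A. f x = (if x = w i then 1 else 0)"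
      using linear_independent_extend[OF ind, of "\<lambda>x. if x = w i then 1 else 0"] by blast
    have "f x = x \<bullet> adjoint f 1" for x using adjoint_works[OF f(1), of x 1] by simp
    then show ?thesis using f(2) inj that by (metis (mono_tags, lifting) imageI inj_onD)
  qed
  then show thesis using that by metis
qed

text \<open>Near \<open>z\<close>, the set \<open>C\<close> is cut out by the constraints \<open>\<phi> l \<le> 0\<close> in the affine subspace through \<open>z\<close>
  along the range of the orthogonal projection \<open>P\<close>. The functions \<open>\<phi> l\<close> need not be convex; only their
  curvature along the common tangent directions matters.\<close>

locale local_constraints =
  fixes C U :: "'a::euclidean_space set" and A :: "'m::finite set"
    and \<phi> :: "'m \<Rightarrow> 'a \<Rightarrow> real" and G :: "'m \<Rightarrow> 'a \<Rightarrow> 'a" and G' :: "'m \<Rightarrow> 'a \<Rightarrow> 'a \<Rightarrow> 'a"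
    and P :: "'a \<Rightarrow> 'a" and z :: 'a
  assumes closed_C: "closed C" and convex_C: "convex C" and z_in_C: "z \<in> C"
    and linear_P: "linear P" and P_P: "\<And>x. P (P x) = P x" and P_adj: "\<And>x y. P x \<bullet> y = x \<bullet> P y"
    and open_U: "open U" and z_in_U: "z \<in> U"
    and C_affine: "\<And>x. x \<in> C \<Longrightarrow> P (x - z) = x - z"
    and C_local: "\<And>x. x \<in> U \<Longrightarrow> x \<in> C \<longleftrightarrow> P (x - z) = x - z \<and> (\<forall>l\<in>A. \<phi> l x \<le> 0)"
    and active: "\<And>l. l \<in> A \<Longrightarrow> \<phi> l z = 0"
    and deriv: "\<And>l x. l \<in> A \<Longrightarrow> x \<in> U \<Longrightarrow> (\<phi> l has_derivative (\<lambda>h. G l x \<bullet> h)) (at x)"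
    and c11_G: "\<And>l. l \<in> A \<Longrightarrow> c11_at (G l) (G' l) z"
    and curvature: "\<And>l d. l \<in> A \<Longrightarrow> P d = d \<Longrightarrow> \<forall>j\<in>A. G j z \<bullet> d = 0 \<Longrightarrow> 0 \<le> d \<bullet> G' l z d"
    and indep: "lin_indep_family (\<lambda>l. P (G l z)) A"
begin

text \<open>Convexity of \<open>C\<close> does the work of convexity of \<open>\<phi> l\<close>:
  with a positive slope, points of the segment towards \<open>u\<close> close to \<open>x\<close>
  would lie in \<open>C\<close> and in \<open>U\<close> and yet violate the constraint.\<close>

lemma gradient_nonpos:
  assumes "l \<in> A" "x \<in> C" "x \<in> U" "\<phi> l x = 0" "u \<in> C"
  shows "G l x \<bullet> (u - x) \<le> 0"
proof (rule ccontr)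
  assume "\<not> ?thesis"
  then have pos: "G l x \<bullet> (u - x) > 0" by simp
  define f where "f s = \<phi> l (x + s *\<^sub>R (u - x))" for s
  have "(f has_derivative (\<lambda>h. G l (x + 0 *\<^sub>R (u - x)) \<bullet> (h *\<^sub>R (u - x)))) (at 0)"
    unfolding f_def
    by (rule has_derivative_compose[of "\<lambda>s. x + s *\<^sub>R (u - x)" "\<lambda>h. h *\<^sub>R (u - x)" _ _ "\<phi> l"])
      (use deriv assms in \<open>auto intro!: derivative_eq_intros\<close>)
  then have "(f has_field_derivative (G l x \<bullet> (u - x))) (at 0)"
    by (simp add: has_field_derivative_def mult_commute_abs)
  from DERIV_pos_inc_right[OF this pos]
  obtain d where d: "d > 0" "\<And>h. 0 < h \<Longrightarrow> h < d \<Longrightarrow> f 0 < f h" by auto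
  have "((\<lambda>s. x + s *\<^sub>R (u - x)) \<longlongrightarrow> x + 0 *\<^sub>R (u - x)) (at 0)"
    by (intro tendsto_intros)
  then have "eventually (\<lambda>s. x + s *\<^sub>R (u - x) \<in> U) (at 0)"
    using open_U assms(3) by (auto dest: topological_tendstoD)
  then obtain r where r: "r > 0" "\<And>s::real. s \<noteq> 0 \<Longrightarrow> \<bar>s\<bar> < r \<Longrightarrow> x + s *\<^sub>R (u - x) \<in> U"
    unfolding eventually_at by (auto simp: dist_norm)
  define s where "s = min (min d r) 1 / 2"
  have s: "0 < s" "s < d" "s < r" "s < 1" using d(1) r(1) by (auto simp: s_def)
  have "(1 - s) *\<^sub>R x + s *\<^sub>R u \<in> C" using convex_C assms(2,5) s by (intro convexD) auto
  then have "x + s *\<^sub>R (u - x) \<in> C" by (simp add: algebra_simps)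
  moreover have "x + s *\<^sub>R (u - x) \<in> U" using r(2)[of s] s by simp
  ultimately have "f s \<le> 0" using C_local assms(1) by (simp add: f_def)
  moreover have "f 0 < f s" using d(2) s by simp
  moreover have "f 0 = 0" using assms(4) by (simp add: f_def)
  ultimately show False by simp
qed

lemma gradient_in_normal_cone: "l \<in> A \<Longrightarrow> G l z \<in> normal_cone C z"
  using gradient_nonpos active z_in_C z_in_U by (simp add: normal_cone_def)

lemma diff_in_range: "x \<in> C \<Longrightarrow> y \<in> C \<Longrightarrow> P (x - y) = x - y"
proof -
  assume "x \<in> C" "y \<in> C"
  then have "P (x - z) - P (y - z) = (x - z) - (y - z)"
    by (simp only: C_affine)
  then show ?thesis by (simp flip: linear_diff[OF linear_P])
qed

lemma orthogonal_part_in_normal_cone: "h - P h \<in> normal_cone C z"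
proof -
  have "(h - P h) \<bullet> (y - z) = 0" if "y \<in> C" for y
  proof -
    have "(h - P h) \<bullet> (y - z) = (h - P h) \<bullet> P (y - z)" using C_affine that by simp
    also have "\<dots> = P (h - P h) \<bullet> (y - z)" using P_adj by simp
    finally show ?thesis by (simp add: linear_diff[OF linear_P] P_P)
  qed
  then show ?thesis using z_in_C by (simp add: normal_cone_def)
qed

lemma tangent_direction_feasible:
  assumes "P d = d" "\<And>l. l \<in> A \<Longrightarrow> G l z \<bullet> d < 0"
  obtains s where "s > 0" "z + s *\<^sub>R d \<in> C"
proof -
  have ev: "eventually (\<lambda>s. \<phi> l (z + s *\<^sub>R d) \<le> 0) (at_right 0)" if l: "l \<in> A" for l
  proof -
    define f where "f s = \<phi> l (z + s *\<^sub>R d)" for s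
    have "(f has_derivative (\<lambda>h. G l (z + 0 *\<^sub>R d) \<bullet> (h *\<^sub>R d))) (at 0)"
      unfolding f_def
      by (rule has_derivative_compose[of "\<lambda>s. z + s *\<^sub>R d" "\<lambda>h. h *\<^sub>R d" _ _ "\<phi> l"])
        (use deriv l z_in_U in \<open>auto intro!: derivative_eq_intros\<close>)
    then have "(f has_field_derivative (G l z \<bullet> d)) (at 0)"
      by (simp add: has_field_derivative_def mult_commute_abs)
    from DERIV_neg_dec_right[OF this assms(2)[OF l]]
    obtain r where "r > 0" "\<And>h. 0 < h \<Longrightarrow> h < r \<Longrightarrow> f h < f 0" by auto
    moreover have "f 0 = 0" using active l by (simp add: f_def)
    ultimately have "eventually (\<lambda>s. f s \<le> 0) (at_right 0)"
      unfolding eventually_at_right_field by (metis less_eq_real_def)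
    then show ?thesis by (simp add: f_def)
  qed
  have "((\<lambda>s. z + s *\<^sub>R d) \<longlongrightarrow> z + 0 *\<^sub>R d) (at_right 0)"
    by (intro tendsto_intros)
  then have "eventually (\<lambda>s. z + s *\<^sub>R d \<in> U) (at_right 0)"
    using open_U z_in_U by (auto dest: topological_tendstoD)
  moreover have "eventually (\<lambda>s. \<forall>l\<in>A. \<phi> l (z + s *\<^sub>R d) \<le> 0) (at_right 0)"
    using ev by (simp add: eventually_ball_finite)
  moreover have "eventually (\<lambda>s::real. s > 0) (at_right 0)"
    by (simp add: eventually_at_right_less)
  ultimately have "eventually (\<lambda>s. s > 0 \<and> z + s *\<^sub>R d \<in> C) (at_right 0)"
  proof eventually_elim
    case (elim s)
    have "P (s *\<^sub>R d) = s *\<^sub>R d" using assms(1) by (simp add: linear_cmul[OF linear_P])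
    then show ?case using C_local elim by simp
  qed
  then show thesis using that eventually_happens' trivial_limit_at_right_real by blast
qed

text \<open>Instead of a Farkas argument, independence supplies dual vectors \<open>e i\<close> in
  the range of \<open>P\<close>, and the multipliers are read off as
  \<open>u \<bullet> e l\<close>.\<close>

lemma normal_cone_multipliers:
  assumes u: "u \<in> normal_cone C z"
  obtains \<mu> where "\<And>l. l \<in> A \<Longrightarrow> 0 \<le> \<mu> l" "P u = (\<Sum>l\<in>A. \<mu> l *\<^sub>R P (G l z))"
proof -
  obtain e0 where e0: "\<And>i j. i \<in> A \<Longrightarrow> j \<in> A \<Longrightarrow> P (G j z) \<bullet> e0 i = (if i = j then 1 else 0)"
    using lin_indep_family_dual_basis[OF indep] by metis
  define e where "e i = P (e0 i)" for i
  have Pe: "P (e i) = e i" for i by (simp add: e_def P_P)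
  have Ge: "G j z \<bullet> e i = (if i = j then 1 else 0)" if "i \<in> A" "j \<in> A" for i j
    using e0[OF that] P_adj by (simp add: e_def)
  have strict: "u \<bullet> d \<le> 0" if d: "P d = d" "\<And>l. l \<in> A \<Longrightarrow> G l z \<bullet> d < 0" for d
  proof -
    obtain s where s: "s > 0" "z + s *\<^sub>R d \<in> C" by (rule tangent_direction_feasible[OF d]) (assumption, rule that)
    then have "u \<bullet> (s *\<^sub>R d) \<le> 0" using u unfolding normal_cone_def by fastforce
    then show ?thesis using s(1) by (simp add: mult_le_0_iff)
  qed
  \<comment> \<open>A direction in which all active constraints strictly decrease. Adding small
    multiples of it turns weak inequalities into strict ones, for which feasible points
    exist.\<close>
  define d0 where "d0 = - (\<Sum>i\<in>A. e i)"
  have Pd0: "P d0 = d0" by (simp add: d0_def linear_neg[OF linear_P] linear_sum[OF linear_P] Pe)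
  have Gd0: "G l z \<bullet> d0 = -1" if "l \<in> A" for l
    using that Ge by (simp add: d0_def inner_sum_right)
  have weak: "u \<bullet> d \<le> 0" if d: "P d = d" "\<And>l. l \<in> A \<Longrightarrow> G l z \<bullet> d \<le> 0" for d
  proof -
    have "u \<bullet> d + s * (u \<bullet> d0) \<le> 0" if "s > 0" for s
    proof -
      have "u \<bullet> (d + s *\<^sub>R d0) \<le> 0"
      proof (rule strict)
        show "P (d + s *\<^sub>R d0) = d + s *\<^sub>R d0"
          by (simp add: linear_add[OF linear_P] linear_cmul[OF linear_P] d Pd0)
        show "G l z \<bullet> (d + s *\<^sub>R d0) < 0" if "l \<in> A" for l
          using d(2)[OF that] Gd0[OF that] \<open>s > 0\<close> by (simp add: inner_add_right)
      qed
      then show ?thesis by (simp add: inner_add_right)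
    qed
    then have "eventually (\<lambda>s. u \<bullet> d + s * (u \<bullet> d0) \<le> 0) (at_right 0)"
      by (simp add: eventually_at_right_less eventually_at_right_field) (meson zero_less_one)
    moreover have "((\<lambda>s. u \<bullet> d + s * (u \<bullet> d0)) \<longlongrightarrow> u \<bullet> d + 0 * (u \<bullet> d0)) (at_right 0)"
      by (intro tendsto_intros)
    ultimately show ?thesis
      using tendsto_upperbound trivial_limit_at_right_real by fastforce
  qed
  define \<mu> where "\<mu> l = u \<bullet> e l" for l
  define r where "r = P u - (\<Sum>l\<in>A. \<mu> l *\<^sub>R P (G l z))"
  have re: "r \<bullet> e i = 0" if "i \<in> A" for i
  proof -
    have "r \<bullet> e i = u \<bullet> P (e i) - (\<Sum>l\<in>A. \<mu> l * (G l z \<bullet> P (e i)))"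
      by (simp add: r_def inner_diff_left inner_sum_left P_adj)
    also have "\<dots> = 0" using that by (simp add: Pe Ge \<mu>_def if_distrib cong: if_cong)
    finally show ?thesis .
  qed
  have Pr: "P r = r"
    by (simp add: r_def linear_diff[OF linear_P] linear_sum[OF linear_P] linear_cmul[OF linear_P] P_P)
  \<comment> \<open>\<open>d\<close> is \<open>r\<close> corrected to be tangent to all active
    constraints. Both \<open>d\<close> and \<open>- d\<close> qualify for \<open>weak\<close>, so
    \<open>u \<bullet> d = 0\<close>; as \<open>r\<close> is orthogonal to every \<open>e i\<close>,
    this forces \<open>r \<bullet> r = 0\<close>.\<close>
  define d where "d = r - (\<Sum>i\<in>A. (G i z \<bullet> r) *\<^sub>R e i)"
  have Pd: "P d = d"
    by (simp add: d_def linear_diff[OF linear_P] linear_sum[OF linear_P] linear_cmul[OF linear_P] Pr Pe)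
  have Gd: "G j z \<bullet> d = 0" if "j \<in> A" for j
    using that by (simp add: d_def inner_diff_right inner_sum_right Ge if_distrib cong: if_cong)
  have "u \<bullet> d \<le> 0" using weak Pd Gd by simp
  moreover have "u \<bullet> (- d) \<le> 0" using weak[of "-d"] Pd Gd by (simp add: linear_neg[OF linear_P])
  ultimately have ud: "u \<bullet> d = 0" by simp
  have "r \<bullet> d = u \<bullet> P d - (\<Sum>l\<in>A. \<mu> l * (G l z \<bullet> P d))"
    by (simp add: r_def inner_diff_left inner_sum_left P_adj)
  also have "\<dots> = 0" by (simp add: Pd Gd ud)
  finally have "r \<bullet> d = 0" .
  then have "r \<bullet> r = 0" by (simp add: d_def inner_diff_right inner_sum_right re)
  then have "P u = (\<Sum>l\<in>A. \<mu> l *\<^sub>R P (G l z))" by (simp add: r_def)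
  moreover have "0 \<le> \<mu> l" if "l \<in> A" for l
    using weak[of "- e l"] that by (simp add: \<mu>_def linear_neg[OF linear_P] Pe Ge)
  ultimately show thesis using that by blast
qed

text \<open>Removing a small multiple \<open>e\<close> of the sum of the active gradients leaves a
  normal vector, whose multipliers are nonnegative; restoring it adds \<open>e\<close> to
  each.\<close>

lemma strict_multipliers:
  assumes v: "v \<in> rel_interior (normal_cone C z)"
  obtains \<mu> where "\<And>l. l \<in> A \<Longrightarrow> 0 < \<mu> l" "P v = (\<Sum>l\<in>A. \<mu> l *\<^sub>R P (G l z))"
proof -
  obtain e where e: "e > 0" "v - e *\<^sub>R (\<Sum>l\<in>A. G l z) \<in> normal_cone C z"
    using rel_interior_normal_cone_shrink[OF v]
    by (metis (no_types, lifting) gradient_in_normal_cone normal_cone_sum z_in_C)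
  obtain \<mu> where \<mu>: "\<And>l. l \<in> A \<Longrightarrow> 0 \<le> \<mu> l"
    "P (v - e *\<^sub>R (\<Sum>l\<in>A. G l z)) = (\<Sum>l\<in>A. \<mu> l *\<^sub>R P (G l z))"
    using normal_cone_multipliers[OF e(2)] by blast
  have "P v = (\<Sum>l\<in>A. (\<mu> l + e) *\<^sub>R P (G l z))"
    using \<mu>(2) by (simp add: linear_diff[OF linear_P] linear_sum[OF linear_P] linear_cmul[OF linear_P]
      algebra_simps sum.distrib scaleR_sum_right)
  moreover have "0 < \<mu> l + e" if "l \<in> A" for l using \<mu>(1)[OF that] e(1) by linarith
  ultimately show thesis by (rule that[rotated])
qed

text \<open>Stationarity and active constraints in the point and the multipliers. The multipliers of
  indices outside \<open>A\<close> are dummies, kept so that domain and codomain agree.\<close>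

definition kkt :: "'a \<times> (real^'m) \<Rightarrow> 'a \<times> (real^'m)" where
  "kkt q = (fst q + (\<Sum>l\<in>A. (snd q $ l) *\<^sub>R P (G l (fst q))),
            (\<Sum>l\<in>UNIV. (if l \<in> A then \<phi> l (fst q) else snd q $ l) *\<^sub>R axis l 1))"

definition kkt' :: "'a \<times> (real^'m) \<Rightarrow> 'a \<times> (real^'m) \<Rightarrow> 'a \<times> (real^'m)" where
  "kkt' q h = (fst h + (\<Sum>l\<in>A. (snd q $ l) *\<^sub>R P (G' l (fst q) (fst h)) + (snd h $ l) *\<^sub>R P (G l (fst q))),
            (\<Sum>l\<in>UNIV. (if l \<in> A then G l (fst q) \<bullet> fst h else snd h $ l) *\<^sub>R axis l 1))"

lemma c11_kkt: "c11_at kkt kkt' (z, \<kappa>)"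
proof -
  have nth: "bounded_linear (\<lambda>q::'a \<times> (real^'m). snd q $ l)" for l
    using bounded_linear_compose[OF bounded_linear_vec_nth bounded_linear_snd] .
  have blP: "bounded_linear P" using linear_P linear_conv_bounded_linear by blast
  have fst: "c11_at (\<lambda>q::'a \<times> (real^'m). fst q) (\<lambda>q h. fst h) (z, \<kappa>)"
    by (rule c11_at_linear[OF bounded_linear_fst])
  have G: "c11_at (\<lambda>q::'a \<times> (real^'m). G l (fst q)) (\<lambda>q h. G' l (fst q) (fst h)) (z, \<kappa>)" if "l \<in> A" for l
    by (rule c11_at_compose[OF fst]) (use c11_G that in simp)
  have \<phi>: "c11_at (\<lambda>q::'a \<times> (real^'m). \<phi> l (fst q)) (\<lambda>q h. G l (fst q) \<bullet> fst h) (z, \<kappa>)" if "l \<in> A" for l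
    by (rule c11_at_compose[OF fst, where g' = "\<lambda>x h. G l x \<bullet> h"])
      (use c11_at_potential[OF open_U z_in_U deriv c11_G] that in simp)
  have 1: "c11_at (\<lambda>q. (if l \<in> A then \<phi> l (fst q) else snd q $ l) *\<^sub>R axis l (1::real))
      (\<lambda>q h. (if l \<in> A then G l (fst q) \<bullet> fst h else snd h $ l) *\<^sub>R axis l 1) (z, \<kappa>)" for l
    by (cases "l \<in> A")
      (use c11_at_linear_compose[OF bounded_linear_scaleR_left \<phi>]
         c11_at_linear_compose[OF bounded_linear_scaleR_left c11_at_linear[OF nth]] in simp_all)
  have 2: "c11_at (\<lambda>q. (snd q $ l) *\<^sub>R P (G l (fst q)))
      (\<lambda>q h. (snd q $ l) *\<^sub>R P (G' l (fst q) (fst h)) + (snd h $ l) *\<^sub>R P (G l (fst q))) (z, \<kappa>)"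
    if "l \<in> A" for l
    by (rule c11_at_scaleR[OF c11_at_linear[OF nth] c11_at_linear_compose[OF blP G[OF that]]])
  show ?thesis
    unfolding kkt_def[abs_def] kkt'_def[abs_def]
    by (intro c11_at_Pair c11_at_add fst c11_at_sum 1 2) auto
qed

text \<open>Pairing the linearised stationarity with the primal part \<open>d\<close> kills the
  gradient terms and leaves nonnegative curvature terms, so \<open>d = 0\<close>; independence then
  removes the multiplier part.\<close>

lemma kkt'_injective:
  assumes \<kappa>: "\<And>l. l \<in> A \<Longrightarrow> 0 \<le> \<kappa> $ l" and 0: "kkt' (z, \<kappa>) h = 0"
  shows "h = 0"
proof -
  obtain d k where h: "h = (d, k)" by (cases h)
  have e1: "d + (\<Sum>l\<in>A. (\<kappa> $ l) *\<^sub>R P (G' l z d) + (k $ l) *\<^sub>R P (G l z)) = 0"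
    using 0 by (simp add: h kkt'_def zero_prod_def)
  have e2: "(if l \<in> A then G l z \<bullet> d else k $ l) = 0" for l
  proof -
    have "(\<Sum>l\<in>UNIV. (if l \<in> A then G l z \<bullet> d else k $ l) *\<^sub>R axis l (1::real)) = 0"
      using 0 by (simp add: h kkt'_def zero_prod_def cong: if_cong)
    then have "(\<Sum>l\<in>UNIV. (if l \<in> A then G l z \<bullet> d else k $ l) *\<^sub>R axis l (1::real)) $ l = 0"
      by simp
    then show ?thesis
      by (simp add: sum_component axis_def if_distrib[where f = "\<lambda>x. _ * x"] cong: if_cong split: if_splits)
  qed
  have Gd: "G l z \<bullet> d = 0" if "l \<in> A" for l using e2[of l] that by simp
  have k0: "k $ l = 0" if "l \<notin> A" for l using e2[of l] that by simp
  \<comment> \<open>Every term other than \<open>d\<close> lies in the range of \<open>P\<close>, so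
    comparing the equation with its image under \<open>P\<close> shows that \<open>d\<close> does
    too.\<close>
  have "P d + (\<Sum>l\<in>A. (\<kappa> $ l) *\<^sub>R P (G' l z d) + (k $ l) *\<^sub>R P (G l z)) = 0"
    using arg_cong[OF e1, of P]
    by (simp add: linear_add[OF linear_P] linear_sum[OF linear_P] linear_cmul[OF linear_P] linear_0[OF linear_P] P_P)
  then have Pd: "P d = d"
    using e1 unfolding eq_neg_iff_add_eq_0[symmetric] by (rule trans[OF _ sym])
  have "0 = d \<bullet> (d + (\<Sum>l\<in>A. (\<kappa> $ l) *\<^sub>R P (G' l z d) + (k $ l) *\<^sub>R P (G l z)))"
    using e1 by simp
  also have "\<dots> = d \<bullet> d + (\<Sum>l\<in>A. (\<kappa> $ l) * (P d \<bullet> G' l z d) + (k $ l) * (P d \<bullet> G l z))"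
    by (simp add: inner_add_right inner_sum_right P_adj)
  also have "\<dots> = d \<bullet> d + (\<Sum>l\<in>A. (\<kappa> $ l) * (d \<bullet> G' l z d))"
    by (simp add: Pd Gd inner_commute[of d "G _ z"])
  finally have "d \<bullet> d + (\<Sum>l\<in>A. (\<kappa> $ l) * (d \<bullet> G' l z d)) = 0" by simp
  moreover have "0 \<le> (\<Sum>l\<in>A. (\<kappa> $ l) * (d \<bullet> G' l z d))"
    using \<kappa> curvature Pd Gd by (intro sum_nonneg mult_nonneg_nonneg) auto
  ultimately have "d \<bullet> d \<le> 0" by linarith
  then have d0: "d = 0" by (metis antisym inner_eq_zero_iff inner_ge_zero)
  have "G' l z 0 = 0" if "l \<in> A" for l
    using c11_G[OF that] c11_at_has_derivative has_derivative_linear linear_0 by blast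
  then have s0: "(\<Sum>l\<in>A. (k $ l) *\<^sub>R P (G l z)) = 0"
    using e1 by (simp add: d0 linear_0[OF linear_P])
  obtain e where e: "\<And>i j. i \<in> A \<Longrightarrow> j \<in> A \<Longrightarrow> P (G j z) \<bullet> e i = (if i = j then 1 else 0)"
    using lin_indep_family_dual_basis[OF indep] by metis
  have "k $ i = 0" if "i \<in> A" for i
  proof -
    have "0 = (\<Sum>l\<in>A. (k $ l) *\<^sub>R P (G l z)) \<bullet> e i" using s0 by simp
    also have "\<dots> = k $ i" using that by (simp add: inner_sum_left e if_distrib cong: if_cong)
    finally show ?thesis by simp
  qed
  then have "k = 0" using k0 by (metis vec_eq_iff zero_index)
  then show ?thesis by (simp add: h d0 zero_prod_def)
qed

theorem projection_c11:
  assumes v: "v \<in> rel_interior (normal_cone C z)"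
  obtains J where "c11_at (closest_point C) J (z + v)"
    "\<And>h. J (z + v) h = 0 \<Longrightarrow> h \<in> span (normal_cone C z)"
proof -
  obtain \<mu> where \<mu>: "\<And>l. l \<in> A \<Longrightarrow> 0 < \<mu> l" "P v = (\<Sum>l\<in>A. \<mu> l *\<^sub>R P (G l z))"
    using strict_multipliers[OF v] by blast
  define \<kappa> :: "real^'m" where "\<kappa> = (\<chi> l. if l \<in> A then \<mu> l else 0)"
  have \<kappa>: "0 < \<kappa> $ l" if "l \<in> A" for l using \<mu>(1)[OF that] that by (simp add: \<kappa>_def)
  have F0: "kkt (z, \<kappa>) = (z + P v, 0)"
    by (simp add: kkt_def \<mu>(2) \<kappa>_def active if_distrib[where f = "\<lambda>x. x *\<^sub>R _"] cong: if_cong)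
  obtain g g' W where g: "open W" "kkt (z, \<kappa>) \<in> W" "g (kkt (z, \<kappa>)) = (z, \<kappa>)"
    "\<And>q. q \<in> W \<Longrightarrow> kkt (g q) = q" "c11_at g g' (kkt (z, \<kappa>))"
    "\<And>k. kkt' (z, \<kappa>) (g' (kkt (z, \<kappa>)) k) = k"
  proof (rule c11_at_inverse[OF c11_kkt])
    show "h = 0" if "kkt' (z, \<kappa>) h = 0" for h
      using kkt'_injective[OF _ that] \<kappa> less_imp_le by blast
  qed (rule that)
  \<comment> \<open>Only the part of \<open>y\<close> along the affine subspace matters:
    stationarity has the right-hand side \<open>z + P (y - z)\<close>, and 0 is demanded of the
    active constraints and of the dummy multipliers.\<close>
  define q :: "'a \<Rightarrow> 'a \<times> (real^'m)" where "q y = (P y, 0) + (z - P z, 0)" for y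
  have blP: "bounded_linear P" using linear_P linear_conv_bounded_linear by blast
  have qv: "q (z + v) = kkt (z, \<kappa>)"
    by (simp add: q_def F0 linear_add[OF linear_P])
  have blq: "bounded_linear (\<lambda>y. (P y, 0::real^'m))"
    by (intro bounded_linear_Pair blP bounded_linear_zero)
  have cq: "c11_at q (\<lambda>y h. (P h, 0)) (z + v)"
    unfolding q_def by (rule c11_at_affine[OF blq])
  define J where "J = (\<lambda>y h. fst (g' (q y) (P h, 0)))"
  have gq: "c11_at (\<lambda>y. g (q y)) (\<lambda>y h. g' (q y) (P h, 0)) (z + v)"
    by (rule c11_at_compose[OF cq]) (use g(5) qv in simp)
  have cJ: "c11_at (\<lambda>y. fst (g (q y))) J (z + v)"
    unfolding J_def by (rule c11_at_linear_compose[OF bounded_linear_fst gq])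
  have tq: "(q \<longlongrightarrow> q (z + v)) (nhds (z + v))" "((\<lambda>y. g (q y)) \<longlongrightarrow> g (q (z + v))) (nhds (z + v))"
    by (rule iffD1[OF tendsto_at_iff_tendsto_nhds], rule c11_at_continuous[unfolded continuous_at], rule cq gq)+
  \<comment> \<open>Three open conditions make the local solution a projection: the inverse is
    valid, the point stays in \<open>U\<close>, and the multipliers stay positive.\<close>
  have "eventually (\<lambda>y. q y \<in> W) (nhds (z + v))"
    using topological_tendstoD[OF tq(1)] g(1,2) qv by simp
  moreover have "eventually (\<lambda>y. fst (g (q y)) \<in> U) (nhds (z + v))"
    using topological_tendstoD[OF tendsto_fst[OF tq(2)] open_U] z_in_U g(3) qv by simp
  moreover have "eventually (\<lambda>y. \<forall>l\<in>A. 0 < snd (g (q y)) $ l) (nhds (z + v))"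
  proof (rule eventually_ball_finite; clarsimp)
    fix l assume "l \<in> A"
    have "((\<lambda>y. snd (g (q y)) $ l) \<longlongrightarrow> snd (g (q (z + v))) $ l) (nhds (z + v))"
      by (intro tendsto_intros tq(2))
    then show "eventually (\<lambda>y. 0 < snd (g (q y)) $ l) (nhds (z + v))"
      using \<kappa>[OF \<open>l \<in> A\<close>] g(3) qv by (auto dest: order_tendstoD(1))
  qed
  ultimately have "eventually (\<lambda>y. closest_point C y = fst (g (q y))) (nhds (z + v))"
  proof eventually_elim
    case (elim y)
    define x where "x = fst (g (q y))"
    define \<nu> where "\<nu> = snd (g (q y))"
    have "kkt (x, \<nu>) = q y" using g(4) elim by (simp add: x_def \<nu>_def)
    then have e1: "x + (\<Sum>l\<in>A. (\<nu> $ l) *\<^sub>R P (G l x)) = z + P (y - z)"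
      and e2: "(\<Sum>l\<in>UNIV. (if l \<in> A then \<phi> l x else \<nu> $ l) *\<^sub>R axis l (1::real)) = 0"
      by (simp_all add: kkt_def q_def linear_diff[OF linear_P] cong: if_cong)
    have \<phi>: "\<phi> l x = 0" if "l \<in> A" for l
    proof -
      have "(\<Sum>l\<in>UNIV. (if l \<in> A then \<phi> l x else \<nu> $ l) *\<^sub>R axis l (1::real)) $ l = 0"
        using e2 by simp
      then show ?thesis using that
        by (simp add: sum_component axis_def if_distrib[where f = "\<lambda>x. _ * x"] cong: if_cong split: if_splits)
    qed
    have xz: "x - z = P (y - z) - (\<Sum>l\<in>A. (\<nu> $ l) *\<^sub>R P (G l x))"
      using e1 by (simp add: algebra_simps)
    then have Pxz: "P (x - z) = x - z"
      by (simp add: linear_diff[OF linear_P] linear_sum[OF linear_P] linear_cmul[OF linear_P] P_P)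
    have xU: "x \<in> U" using elim by (simp add: x_def)
    have xC: "x \<in> C" using C_local[OF xU] Pxz \<phi> by simp
    have "y - x \<in> normal_cone C x"
      unfolding normal_cone_def
    proof (intro CollectI conjI ballI xC)
      fix u assume u: "u \<in> C"
      have "P (y - x) = P (y - z) - P (x - z)"
        by (simp add: linear_diff[OF linear_P])
      then have Pyx: "P (y - x) = P (\<Sum>l\<in>A. (\<nu> $ l) *\<^sub>R G l x)"
        using xz Pxz by (simp add: linear_sum[OF linear_P] linear_cmul[OF linear_P])
      have "(y - x) \<bullet> (u - x) = P (y - x) \<bullet> (u - x)"
        using diff_in_range[OF u xC] P_adj by metis
      also have "\<dots> = (\<Sum>l\<in>A. (\<nu> $ l) *\<^sub>R G l x) \<bullet> (u - x)"
        using diff_in_range[OF u xC] P_adj Pyx by metis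
      also have "\<dots> = (\<Sum>l\<in>A. (\<nu> $ l) * (G l x \<bullet> (u - x)))"
        by (simp add: inner_sum_left)
      also have "\<dots> \<le> 0"
        using elim gradient_nonpos[OF _ xC xU \<phi> u]
        by (intro sum_nonpos mult_nonneg_nonpos) (auto simp: \<nu>_def less_imp_le)
      finally show "(y - x) \<bullet> (u - x) \<le> 0" .
    qed
    then show ?case
      using closest_point_eq_iff_normal_cone[OF closed_C convex_C] z_in_C x_def by blast
  qed
  then obtain e where "e > 0" "\<And>y. y \<in> ball (z + v) e \<Longrightarrow> closest_point C y = fst (g (q y))"
    unfolding eventually_nhds_metric by (auto simp: dist_commute)
  then have "c11_at (closest_point C) J (z + v)" using c11_at_cong[OF cJ] by blast
  \<comment> \<open>A vector killed by \<open>J\<close> moves only the multipliers of the linearised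
    system, so \<open>P h\<close> is a combination of projected active gradients;
    \<open>h - P h\<close> is normal in any case.\<close>
  moreover have "h \<in> span (normal_cone C z)" if "J (z + v) h = 0" for h
  proof -
    define k where "k = snd (g' (q (z + v)) (P h, 0))"
    have "g' (q (z + v)) (P h, 0) = (0, k)"
      using that by (simp add: J_def k_def prod_eq_iff)
    then have "kkt' (z, \<kappa>) (0, k) = (P h, 0)" using g(6) qv by metis
    moreover have "G' l z 0 = 0" if "l \<in> A" for l
      using c11_G[OF that] c11_at_has_derivative has_derivative_linear linear_0 by blast
    ultimately have Ph: "P h = (\<Sum>l\<in>A. (k $ l) *\<^sub>R P (G l z))"
      by (simp add: kkt'_def linear_0[OF linear_P])
    have "P (G l z) \<in> span (normal_cone C z)" if "l \<in> A" for l
    proof -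
      have "G l z - (G l z - P (G l z)) \<in> span (normal_cone C z)"
        using gradient_in_normal_cone[OF that] orthogonal_part_in_normal_cone
        by (intro span_diff span_base)
      then show ?thesis by simp
    qed
    then have "P h \<in> span (normal_cone C z)" unfolding Ph by (intro span_sum span_scale)
    moreover have "h - P h \<in> span (normal_cone C z)"
      by (intro span_base orthogonal_part_in_normal_cone)
    ultimately have "P h + (h - P h) \<in> span (normal_cone C z)" by (rule span_add)
    then show ?thesis by simp
  qed
  ultimately show thesis by (rule that)
qed

end

text \<open>Displacements near \<open>v\<close> remain normal at \<open>z\<close>, so the projection
  is constant near \<open>z + v\<close>. Its derivative is zero, and the normal cone, having
  interior points, spans the whole space.\<close>

lemma projection_c11_interior_normal_cone:
  fixes C :: "'a::euclidean_space set"
  assumes "closed C" "convex C" "z \<in> C"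
    and ne: "interior (normal_cone C z) \<noteq> {}" and v: "v \<in> rel_interior (normal_cone C z)"
  obtains J where "c11_at (closest_point C) J (z + v)"
    "\<And>h. J (z + v) h = 0 \<Longrightarrow> h \<in> span (normal_cone C z)"
proof -
  have "v \<in> interior (normal_cone C z)" using v rel_interior_nonempty_interior[OF ne] by simp
  then obtain e where e: "e > 0" "ball v e \<subseteq> normal_cone C z"
    by (meson mem_interior)
  have "closest_point C y = z" if "y \<in> ball (z + v) e" for y
  proof -
    have "y - z \<in> ball v e" using that by (simp add: dist_norm algebra_simps)
    then have "y - z \<in> normal_cone C z" using e(2) by blast
    then show ?thesis using closest_point_eq_iff_normal_cone[OF assms(1,2)] assms(3) by blast
  qed
  then have "c11_at (closest_point C) (\<lambda>x h. 0) (z + v)"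
    by (intro c11_at_cong[OF c11_at_const e(1)]) auto
  moreover have "h \<in> span (normal_cone C z)" for h
  proof -
    define s where "s = e / (2 * (norm h + 1))"
    have s: "s > 0" using e(1) by (auto simp: s_def add_nonneg_pos)
    have "norm h < 2 * (norm h + 1)" by (smt (verit) norm_ge_zero)
    then have "e * norm h < e * (2 * (norm h + 1))" using e(1) by (rule mult_strict_left_mono)
    then have "s * norm h < e" by (simp add: s_def pos_divide_less_eq add_nonneg_pos)
    then have "v + s *\<^sub>R h \<in> normal_cone C z" "v \<in> normal_cone C z"
      using e s by (auto simp: dist_norm subset_iff)
    then have "(v + s *\<^sub>R h) - v \<in> span (normal_cone C z)" by (intro span_diff span_base)
    then have "(1 / s) *\<^sub>R ((v + s *\<^sub>R h) - v) \<in> span (normal_cone C z)" by (rule span_scale)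
    then show ?thesis using s by simp
  qed
  ultimately show thesis using that by blast
qed

section \<open>The projection onto the constraint set\<close>

text \<open>\<open>v\<close> is the displacement from \<open>z\<close> to the projected point. The
  kernel condition refers to the same span as the extended LICQ, which is how the two meet
  later.\<close>

definition smooth_projection_at :: "'a::euclidean_space set \<Rightarrow> 'a \<Rightarrow> 'a \<Rightarrow> bool" where
  "smooth_projection_at C z v \<longleftrightarrow> (\<exists>J. c11_at (closest_point C) J (z + v) \<and>
     (\<forall>h. J (z + v) h = 0 \<longrightarrow> h \<in> span (normal_cone C z)))"

lemma smooth_projection_at_relative_interior:
  fixes C U :: "'a::euclidean_space set"
  assumes "closed C" "convex C" "z \<in> C" "linear P" "\<And>x. P (P x) = P x" "\<And>x y. P x \<bullet> y = x \<bullet> P y"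
    "open U" "z \<in> U" "\<And>x. x \<in> C \<Longrightarrow> P (x - z) = x - z"
    "\<And>x. x \<in> U \<Longrightarrow> P (x - z) = x - z \<Longrightarrow> x \<in> C"
    "v \<in> rel_interior (normal_cone C z)"
  shows "smooth_projection_at C z v"
proof -
  \<comment> \<open>No inequality is active, so \<open>bool\<close> serves merely as some finite
    index type.\<close>
  interpret local_constraints C U "{} :: bool set" "\<lambda>_ _. 0" "\<lambda>_ _. 0" "\<lambda>_ _ _. 0" P z
    by (rule local_constraints.intro) (use assms in \<open>auto simp: lin_indep_family_def independent_empty\<close>)
  from projection_c11[OF assms(11)] show ?thesis
    unfolding smooth_projection_at_def by metis
qed

lemma orthogonal_projection_exists:
  fixes V :: "'a::euclidean_space set"
  assumes "subspace V"
  obtains P where "linear P" "\<And>x. P (P x) = P x" "\<And>x y. P x \<bullet> y = x \<bullet> P y" "\<And>x. P x = x \<longleftrightarrow> x \<in> V"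
proof -
  obtain B where B: "B \<subseteq> V" "pairwise orthogonal B" "\<And>x. x \<in> B \<Longrightarrow> norm x = 1" "independent B" "span B = V"
    using orthonormal_basis_subspace[OF assms] by metis
  have fin: "finite B" using B(4) independent_imp_finite by blast
  define P where "P x = (\<Sum>b\<in>B. (x \<bullet> b) *\<^sub>R b)" for x
  have lin: "linear P"
    by (rule linearI) (simp_all add: P_def inner_add_left scaleR_add_left sum.distrib scaleR_sum_right)
  have PV: "P x \<in> V" for x
    unfolding P_def using assms B(1) by (intro subspace_sum subspace_scale) auto
  have Pb: "P b = b" if "b \<in> B" for b
  proof -
    have "(b \<bullet> c) *\<^sub>R c = (if c = b then b else 0)" if "c \<in> B" for c
      using B(2,3) that \<open>b \<in> B\<close>
      by (auto simp: pairwise_def orthogonal_def dot_square_norm inner_commute)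
    then have "P b = (\<Sum>c\<in>B. if c = b then b else 0)" unfolding P_def by (intro sum.cong) auto
    then show ?thesis using fin that by simp
  qed
  have PP: "P x = x" if "x \<in> V" for x
  proof -
    have "x \<in> span B" using that B(5) by simp
    then show ?thesis
      by (rule span_induct) (auto simp: subspace_def linear_0[OF lin] linear_add[OF lin] linear_cmul[OF lin] Pb)
  qed
  show thesis
  proof (rule that[of P])
    show "P x \<bullet> y = x \<bullet> P y" for x y
      by (simp add: P_def inner_sum_left inner_sum_right inner_commute mult.commute)
    show "P x = x \<longleftrightarrow> x \<in> V" for x using PP PV by metis
    show "P (P x) = P x" for x using PP PV by blast
  qed (rule lin)
qed

lemma smooth_projection_at_affine:
  fixes C :: "'a::euclidean_space set"
  assumes "affine C" "z \<in> C" "v \<in> rel_interior (normal_cone C z)"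
  shows "smooth_projection_at C z v"
proof -
  define V where "V = (\<lambda>x. x - z) ` C"
  have sub: "subspace V"
    using affine_diffs_subspace_subtract[OF assms(1,2)] by (simp add: V_def)
  obtain P where P: "linear P" "\<And>x. P (P x) = P x" "\<And>x y. P x \<bullet> y = x \<bullet> P y" "\<And>x. P x = x \<longleftrightarrow> x \<in> V"
    using orthogonal_projection_exists[OF sub] by metis
  have "x - z \<in> V \<longleftrightarrow> x \<in> C" for x by (auto simp: V_def)
  then show ?thesis
    using assms P affine_closed affine_imp_convex
    by (intro smooth_projection_at_relative_interior[of C z P UNIV]) auto
qed

section \<open>Restriction to blocks of coordinates, and projections onto single blocks\<close>

lemma linear_restrict_to: "linear (restrict_to S)"
  by (rule linearI) (auto simp: restrict_to_def vec_eq_iff)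

lemma restrict_to_diff: "restrict_to S (x - y) = restrict_to S x - restrict_to S y"
  by (rule linear_diff[OF linear_restrict_to])

lemma restrict_to_add: "restrict_to S (x + y) = restrict_to S x + restrict_to S y"
  by (rule linear_add[OF linear_restrict_to])

lemma restrict_to_sum: "restrict_to S (sum f I) = (\<Sum>i\<in>I. restrict_to S (f i))"
  by (rule linear_sum[OF linear_restrict_to])

lemma restrict_to_restrict_to: "restrict_to S (restrict_to T x) = restrict_to (S \<inter> T) x"
  by (auto simp: restrict_to_def vec_eq_iff)

lemma restrict_to_empty: "restrict_to {} x = 0"
  by (simp add: restrict_to_def vec_eq_iff)

lemma restrict_to_inner: "restrict_to S x \<bullet> y = x \<bullet> restrict_to S y"
  by (auto simp: restrict_to_def inner_vec_def intro!: sum.cong)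

lemma restrict_to_eq_iff: "restrict_to S x = x \<longleftrightarrow> x \<in> coord_space S"
  by (auto simp: restrict_to_def coord_space_def vec_eq_iff)

lemma subspace_coord_space: "subspace (coord_space S)"
  by (simp add: subspace_def coord_space_def)

lemma closed_coord_space: "closed (coord_space S)"
  by (rule closed_subspace[OF subspace_coord_space])

lemma continuous_on_restrict_to: "continuous_on T (restrict_to S)"
  by (rule linear_continuous_on) (simp add: linear_restrict_to linear_conv_bounded_linear[symmetric])

lemma second_order_cone_smooth_projection:
  fixes C :: "(real^'n::finite) set"
  assumes soc: "second_order_cone S C" and clC: "closed C" and cvC: "convex C" and zC: "z \<in> C"
    and v: "v \<in> rel_interior (normal_cone C z)"
  shows "smooth_projection_at C z v"
proof -
  obtain k t where k: "k \<in> S" and t: "t \<ge> 0"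
    and C: "C = {v \<in> coord_space S. norm (restrict_to (S - {k}) v) \<le> t * v $ k \<and> 0 \<le> v $ k}"
    using soc unfolding second_order_cone_def by blast
  define R where "R = restrict_to (S - {k})"
  have Ccond: "x \<in> C \<longleftrightarrow> x \<in> coord_space S \<and> norm (R x) \<le> t * x $ k \<and> 0 \<le> x $ k" for x
    by (simp add: C R_def)
  have blR: "bounded_linear R"
    unfolding R_def using linear_restrict_to linear_conv_bounded_linear by blast
  have RR: "R (R x) = R x" and Rin: "R x \<bullet> y = x \<bullet> R y" for x y
    by (simp_all add: R_def restrict_to_restrict_to restrict_to_inner)
  have Rk: "R x $ k = 0" for x by (simp add: R_def restrict_to_def)
  have coord_split: "x = R x + (x $ k) *\<^sub>R axis k 1" if "x \<in> coord_space S" for x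
    using that by (auto simp: R_def restrict_to_def coord_space_def vec_eq_iff axis_def)
  have zS: "z \<in> coord_space S" using zC Ccond by simp
  have PS: "restrict_to S (x - z) = x - z \<longleftrightarrow> x \<in> coord_space S" for x
    using zS by (auto simp: restrict_to_eq_iff coord_space_def)
  have contk: "continuous_on UNIV (\<lambda>x::real^'n. x $ k)" by (intro continuous_intros)
  have contR: "continuous_on UNIV (\<lambda>x. norm (R x))"
    unfolding R_def by (intro continuous_on_norm continuous_on_restrict_to)
  have "z $ k = 0 \<or> z $ k > 0" using zC Ccond by force
  \<comment> \<open>The apex: points of the cone satisfy
    \<open>norm y \<le> (1 + t) * y $ k\<close>, so the ball of radius \<open>1 / (1 + t)\<close>
    around \<open>- axis k 1\<close> consists of normal vectors.\<close>
  moreover have ?thesis if zk: "z $ k = 0"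
  proof -
    have "R z = 0" using zC zk Ccond[of z] by simp
    then have z0: "z = 0" using coord_split[OF zS] zk by simp
    have "ball (- axis k (1::real)) (1 / (1 + t)) \<subseteq> normal_cone C z"
    proof
      fix u assume "u \<in> ball (- axis k (1::real)) (1 / (1 + t))"
      then have u: "norm (u + axis k 1) < 1 / (1 + t)"
        by (simp add: dist_norm norm_minus_commute)
      have "u \<bullet> y \<le> 0" if y: "y \<in> C" for y
      proof -
        have yk: "0 \<le> y $ k" "norm (R y) \<le> t * y $ k" "y \<in> coord_space S" using y Ccond by auto
        have "norm y \<le> norm (R y) + norm ((y $ k) *\<^sub>R axis k (1::real))"
          using coord_split[OF yk(3)] norm_triangle_ineq by metis
        also have "\<dots> \<le> (1 + t) * y $ k" using yk by (simp add: norm_axis_1 algebra_simps)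
        finally have ny: "norm y \<le> (1 + t) * y $ k" .
        have "(u + axis k 1) \<bullet> y \<le> norm (u + axis k 1) * norm y" by (rule norm_cauchy_schwarz)
        also have "\<dots> \<le> 1 / (1 + t) * ((1 + t) * y $ k)"
          using u ny t by (intro mult_mono) auto
        also have "\<dots> = y $ k" using t by simp
        finally show ?thesis by (simp add: inner_add_left inner_axis' )
      qed
      then show "u \<in> normal_cone C z" using zC z0 by (simp add: normal_cone_def)
    qed
    then have "interior (normal_cone C z) \<noteq> {}"
      using t interior_maximal[OF _ open_ball] by (metis centre_in_ball empty_iff subsetD zero_less_divide_1_iff add_pos_nonneg zero_less_one)
    then show ?thesis
      using projection_c11_interior_normal_cone[OF clC cvC zC _ v]
      unfolding smooth_projection_at_def by metis
  qed
  \<comment> \<open>For \<open>t = 0\<close> the cone is a ray, which away from its end is locally a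
    line.\<close>
  moreover have ?thesis if zk: "z $ k > 0" and t0: "t = 0"
  proof (rule smooth_projection_at_relative_interior[of C z "restrict_to {k}" "{x. 0 < x $ k}"])
    have R0: "R x = 0" if "x \<in> C" for x using that Ccond t0 by simp
    have single: "restrict_to {k} x = (x $ k) *\<^sub>R axis k 1" for x
      by (auto simp: restrict_to_def vec_eq_iff axis_def)
    have eq: "restrict_to {k} x = x" if "x \<in> C" for x
      using coord_split[of x] R0[OF that] Ccond[of x] that single by simp
    show "restrict_to {k} (x - z) = x - z" if "x \<in> C" for x
      using eq zC that by (simp add: restrict_to_diff)
    show "x \<in> C" if "x \<in> {x. 0 < x $ k}" "restrict_to {k} (x - z) = x - z" for x
    proof -
      have "restrict_to {k} x = x" using that(2) eq[OF zC] by (simp add: restrict_to_diff)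
      then have x: "x \<in> coord_space {k}" by (simp add: restrict_to_eq_iff)
      then have "x \<in> coord_space S" using k by (auto simp: coord_space_def)
      moreover have "R x = 0" using x by (auto simp: R_def restrict_to_def coord_space_def vec_eq_iff)
      ultimately show ?thesis using that(1) t0 Ccond by simp
    qed
    show "open {x::real^'n. 0 < x $ k}" by (intro open_Collect_less contk continuous_on_const)
  qed (use clC cvC zC zk v in \<open>auto simp: linear_restrict_to restrict_to_restrict_to restrict_to_inner\<close>)
  \<comment> \<open>With both inequalities strict, the cone is locally all of
    \<open>coord_space S\<close>.\<close>
  moreover have ?thesis if zk: "z $ k > 0" and lt: "norm (R z) < t * z $ k"
  proof (rule smooth_projection_at_relative_interior[of C z "restrict_to S" "{x. norm (R x) < t * x $ k} \<inter> {x. 0 < x $ k}"])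
    show "open ({x. norm (R x) < t * x $ k} \<inter> {x. 0 < x $ k})"
      by (intro open_Int open_Collect_less contk contR continuous_on_const continuous_on_mult)
  qed (use clC cvC zC zk v lt in \<open>auto simp: linear_restrict_to restrict_to_restrict_to restrict_to_inner PS Ccond\<close>)
  moreover have ?thesis if zk: "z $ k > 0" and bd: "norm (R z) = t * z $ k" and tpos: "t > 0"
  proof -
    \<comment> \<open>the squared constraint is not convex, but its gradient is linear and its curvature is
      nonnegative on the tangent space of the boundary\<close>
    define \<phi> where "\<phi> x = R x \<bullet> R x - t\<^sup>2 * (x $ k)\<^sup>2" for x
    define G where "G x = 2 *\<^sub>R R x - (2 * t\<^sup>2 * x $ k) *\<^sub>R axis k (1::real)" for x
    have \<phi>_iff: "\<phi> x \<le> 0 \<longleftrightarrow> norm (R x) \<le> t * x $ k" if "0 < x $ k" for x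
    proof -
      have "\<phi> x \<le> 0 \<longleftrightarrow> (norm (R x))\<^sup>2 \<le> (t * x $ k)\<^sup>2"
        by (simp add: \<phi>_def power2_norm_eq_inner power_mult_distrib)
      then show ?thesis using that t by (simp add: abs_le_square_iff[symmetric])
    qed
    have linG: "linear G"
      by (rule linearI) (simp_all add: G_def R_def linear_add[OF linear_restrict_to]
        linear_cmul[OF linear_restrict_to] algebra_simps)
    interpret local_constraints C "{x. 0 < x $ k}" "{k}" "\<lambda>_. \<phi>" "\<lambda>_. G" "\<lambda>_ _. G" "restrict_to S" z
    proof (rule local_constraints.intro)
      show "open {x::real^'n. 0 < x $ k}" by (intro open_Collect_less contk continuous_on_const)
      show "x \<in> C \<longleftrightarrow> restrict_to S (x - z) = x - z \<and> (\<forall>l\<in>{k}. \<phi> x \<le> 0)" if "x \<in> {x. 0 < x $ k}" for x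
        using that \<phi>_iff by (auto simp: PS Ccond)
      show "\<phi> z = 0" using bd by (simp add: \<phi>_def power_mult_distrib flip: power2_norm_eq_inner)
      show "(\<phi> has_derivative (\<lambda>h. G x \<bullet> h)) (at x)" for x
      proof -
        have "(\<phi> has_derivative (\<lambda>h. (R x \<bullet> R h + R h \<bullet> R x) - t\<^sup>2 * (2 * (h $ k * x $ k)))) (at x)"
          unfolding \<phi>_def
          by (auto intro!: derivative_eq_intros bounded_linear_imp_has_derivative[OF blR]
             bounded_linear_imp_has_derivative[OF bounded_linear_vec_nth])
        moreover have "(R x \<bullet> R h + R h \<bullet> R x) - t\<^sup>2 * (2 * (h $ k * x $ k)) = G x \<bullet> h" for h
        proof -
          have "R x \<bullet> R h = R x \<bullet> h" "R h \<bullet> R x = R x \<bullet> h"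
            by (metis RR Rin, metis RR Rin inner_commute)
          then show ?thesis by (simp add: G_def inner_diff_left inner_axis')
        qed
        ultimately show ?thesis by simp
      qed
      show "c11_at G (\<lambda>_. G) z" by (rule c11_at_linear) (use linG linear_conv_bounded_linear in blast)
      \<comment> \<open>Tangency fixes \<open>R z \<bullet> R d\<close>; as
        \<open>norm (R z) = t * z $ k\<close>, Cauchy-Schwarz bounds
        \<open>t * \<bar>d $ k\<bar>\<close> by \<open>norm (R d)\<close>, which outweighs the
        negative part of the curvature.\<close>
      show "0 \<le> d \<bullet> G d" if "restrict_to S d = d" "\<forall>j\<in>{k}. G z \<bullet> d = 0" for d
      proof -
        have "R z \<bullet> R d = R z \<bullet> d" by (metis RR Rin)
        then have "R z \<bullet> R d = t\<^sup>2 * z $ k * d $ k"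
          using that(2) by (simp add: G_def inner_diff_left inner_axis')
        moreover have "\<bar>R z \<bullet> R d\<bar> \<le> norm (R z) * norm (R d)" by (rule Cauchy_Schwarz_ineq2)
        ultimately have "t * z $ k * (t * \<bar>d $ k\<bar>) \<le> t * z $ k * norm (R d)"
          using bd zk tpos by (simp add: abs_mult power2_eq_square algebra_simps)
        then have "t * \<bar>d $ k\<bar> \<le> norm (R d)" using zk tpos by simp
        then have "(t * \<bar>d $ k\<bar>)\<^sup>2 \<le> (norm (R d))\<^sup>2" using t by (intro power_mono) auto
        then have "t\<^sup>2 * (d $ k)\<^sup>2 \<le> R d \<bullet> R d" by (simp add: power_mult_distrib power2_norm_eq_inner)
        moreover have "d \<bullet> R d = R d \<bullet> R d" by (metis RR Rin)
        ultimately show ?thesis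
          by (simp add: G_def inner_diff_right inner_axis power2_eq_square algebra_simps)
      qed
      have "restrict_to S (G z) $ k = - (2 * t\<^sup>2 * z $ k)"
        using k Rk by (simp add: restrict_to_def G_def)
      then have "restrict_to S (G z) \<noteq> 0" using tpos zk by auto
      then show "lin_indep_family (\<lambda>l. restrict_to S (G z)) {k}"
        by (simp add: lin_indep_family_def)
    qed (use clC cvC zC zk in \<open>auto simp: linear_restrict_to restrict_to_restrict_to restrict_to_inner PS Ccond\<close>)
    from projection_c11[OF v] show ?thesis
      unfolding smooth_projection_at_def by metis
  qed
  moreover have "norm (R z) \<le> t * z $ k" using zC Ccond by blast
  ultimately show ?thesis using t by fastforce
qed

text \<open>\<open>G\<close> is only assumed differentiable at \<open>z\<close>, so the argument
  uses slopes along the line: negative curvature would make the slope drop just after 0, whereas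
  slopes of a convex function increase.\<close>

lemma convex_on_imp_curvature_nonneg:
  fixes f :: "'a::euclidean_space \<Rightarrow> real"
  assumes cvx: "convex_on V f" and V: "\<And>s. z + s *\<^sub>R d \<in> V"
    and f: "\<And>x. (f has_derivative (\<lambda>h. G x \<bullet> h)) (at x)" and G: "(G has_derivative G') (at z)"
  shows "0 \<le> d \<bullet> G' d"
proof (rule ccontr)
  assume "\<not> ?thesis"
  then have neg: "G' d \<bullet> d < 0" by (simp add: inner_commute)
  define h where "h s = f (z + s *\<^sub>R d)" for s
  define h' where "h' s = G (z + s *\<^sub>R d) \<bullet> d" for s
  have dh: "(h has_field_derivative h' s) (at s)" for s
  proof -
    have "(h has_derivative (\<lambda>r. G (z + s *\<^sub>R d) \<bullet> (r *\<^sub>R d))) (at s)"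
      unfolding h_def
      by (rule has_derivative_compose[of "\<lambda>s. z + s *\<^sub>R d" "\<lambda>r. r *\<^sub>R d" _ _ f])
        (use f in \<open>auto intro!: derivative_eq_intros\<close>)
    then show ?thesis by (simp add: has_field_derivative_def h'_def mult_commute_abs)
  qed
  have cvh: "convex_on UNIV h"
  proof (rule convex_onI)
    fix u a b :: real assume "0 < u" "u < 1"
    then have "f ((1 - u) *\<^sub>R (z + a *\<^sub>R d) + u *\<^sub>R (z + b *\<^sub>R d)) \<le> (1 - u) * h a + u * h b"
      using convex_onD[OF cvx, of u "z + a *\<^sub>R d" "z + b *\<^sub>R d"] V by (simp add: h_def)
    moreover have "(1 - u) *\<^sub>R (z + a *\<^sub>R d) + u *\<^sub>R (z + b *\<^sub>R d) = z + ((1 - u) *\<^sub>R a + u *\<^sub>R b) *\<^sub>R d"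
      by (simp add: algebra_simps)
    ultimately show "h ((1 - u) *\<^sub>R a + u *\<^sub>R b) \<le> (1 - u) * h a + u * h b"
      by (simp add: h_def)
  qed simp
  have tangent: "h b - h a \<ge> h' a * (b - a)" for a b
    by (rule convex_on_imp_above_tangent[OF cvh]) (use dh in auto)
  have "(h' has_derivative (\<lambda>r. G' (r *\<^sub>R d) \<bullet> d)) (at 0)"
  proof -
    have "((\<lambda>s. G (z + s *\<^sub>R d)) has_derivative (\<lambda>r. G' (r *\<^sub>R d))) (at 0)"
      by (rule has_derivative_compose[of "\<lambda>s. z + s *\<^sub>R d" "\<lambda>r. r *\<^sub>R d" _ _ G])
        (use G in \<open>auto intro!: derivative_eq_intros\<close>)
    then show ?thesis unfolding h'_def by (rule has_derivative_inner_left)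
  qed
  then have "(h' has_field_derivative (G' d \<bullet> d)) (at 0)"
    using linear_cmul[OF has_derivative_linear[OF G]]
    by (simp add: has_field_derivative_def mult_commute_abs)
  from DERIV_neg_dec_right[OF this neg] obtain r where r: "r > 0" "\<And>s. 0 < s \<Longrightarrow> s < r \<Longrightarrow> h' s < h' 0"
    by auto
  define s where "s = r / 2"
  have s: "0 < s" "h' s < h' 0" using r by (auto simp: s_def)
  \<comment> \<open>The tangent inequalities at 0 and at \<open>s\<close>, added.\<close>
  have "h' 0 * s \<le> h' s * s" using tangent[of 0 s] tangent[of s 0] by (simp add: algebra_simps)
  then show False using s by simp
qed

lemma closed_sublevel_set:
  assumes "\<And>l. l < p \<Longrightarrow> smooth_fun (\<Phi> l)"
  shows "closed (sublevel_set S p \<Phi>)"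
proof -
  have cont: "continuous_on UNIV (\<Phi> l)" if "l < p" for l
    using smooth_fun_differentiable[OF assms[OF that]]
    by (simp add: continuous_on_eq_continuous_at differentiable_imp_continuous_within)
  have "sublevel_set S p \<Phi> = coord_space S \<inter> (\<Inter>l\<in>{..<p}. {x. \<Phi> l x \<le> 0})"
    by (auto simp: sublevel_set_def)
  also have "closed \<dots>"
    using cont by (intro closed_Int closed_INT closed_coord_space ballI closed_Collect_le continuous_on_const) auto
  finally show ?thesis .
qed

lemma regular_convex_sublevel_smooth_projection:
  fixes C :: "(real^'n::finite) set"
  assumes reg: "regular_convex_sublevel S C" and cvC: "convex C" and zC: "z \<in> C"
    and v: "v \<in> rel_interior (normal_cone C z)"
  shows "smooth_projection_at C z v"
proof -
  obtain p \<Phi> where sm: "\<And>l. l < p \<Longrightarrow> smooth_fun (\<Phi> l)" and cvx: "\<And>l. l < p \<Longrightarrow> convex_on (coord_space S) (\<Phi> l)"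
    and C: "C = sublevel_set S p \<Phi>"
    and licq: "\<And>x0. x0 \<in> C \<Longrightarrow> lin_indep_family (\<lambda>l. restrict_to S (gradient (\<Phi> l) x0)) {l. l < p \<and> \<Phi> l x0 = 0}"
    using reg unfolding regular_convex_sublevel_def by blast
  define B where "B = {l. l < p \<and> \<Phi> l z = 0}"
  define w where "w l = restrict_to S (gradient (\<Phi> l) z)" for l
  have ind: "lin_indep_family w B" unfolding w_def B_def by (rule licq[OF zC])
  have finB: "finite B" by (simp add: B_def)
  have "card B = card (w ` B)" using ind by (simp add: lin_indep_family_def card_image)
  also have "\<dots> \<le> CARD('n)" using ind independent_bound[of "w ` B"] by (simp add: lin_indep_family_def)
  \<comment> \<open>The multiplier vector needs a finite index type. Independent gradients number at
    most \<open>CARD('n)\<close>, so the active constraints can be renamed by coordinates.\<close>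
  finally obtain \<iota> :: "nat \<Rightarrow> 'n" where \<iota>: "inj_on \<iota> B"
    using card_le_inj[OF finB, of "UNIV :: 'n set"] by auto
  define \<kappa> where "\<kappa> = inv_into B \<iota>"
  have \<kappa>B: "\<kappa> m \<in> B" if "m \<in> \<iota> ` B" for m using that by (simp add: \<kappa>_def inv_into_into)
  have \<kappa>\<iota>: "\<kappa> (\<iota> l) = l" if "l \<in> B" for l using that \<iota> by (simp add: \<kappa>_def)
  have \<kappa>p: "\<kappa> m < p" "\<Phi> (\<kappa> m) z = 0" if "m \<in> \<iota> ` B" for m using \<kappa>B[OF that] by (auto simp: B_def)
  have "\<exists>G'. c11_at (gradient (\<Phi> l)) G' z" if "l < p" for l
    using smooth_fun_c11_gradient[OF sm[OF that]] by metis
  then obtain G' where G': "\<And>l. l < p \<Longrightarrow> c11_at (gradient (\<Phi> l)) (G' l) z" by metis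
  have deriv: "(\<Phi> l has_derivative (\<lambda>h. gradient (\<Phi> l) x \<bullet> h)) (at x)" if "l < p" for l x
    by (rule gradient_works(1)[OF smooth_fun_differentiable[OF sm[OF that]]])
  \<comment> \<open>Inactive constraints stay strict here, so within \<open>U\<close> only the
    active ones cut out \<open>C\<close>.\<close>
  define U where "U = (\<Inter>l\<in>{..<p} - B. {x. \<Phi> l x < 0})"
  have cont: "continuous_on UNIV (\<Phi> l)" if "l < p" for l
    using deriv[OF that] by (meson has_derivative_continuous continuous_at_imp_continuous_on)
  have zS: "z \<in> coord_space S" using zC by (simp add: C sublevel_set_def)
  have PS: "restrict_to S (x - z) = x - z \<longleftrightarrow> x \<in> coord_space S" for x
    using zS by (auto simp: restrict_to_eq_iff coord_space_def)
  interpret local_constraints C U "\<iota> ` B" "\<lambda>m. \<Phi> (\<kappa> m)" "\<lambda>m. gradient (\<Phi> (\<kappa> m))" "\<lambda>m. G' (\<kappa> m)" "restrict_to S" z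
  proof (rule local_constraints.intro)
    show "closed C" unfolding C by (rule closed_sublevel_set[OF sm])
    show "open U" unfolding U_def
      using cont by (intro open_INT ballI open_Collect_less continuous_on_const) auto
    show "z \<in> U" using zC by (force simp: U_def B_def C sublevel_set_def less_le)
    show "x \<in> C \<longleftrightarrow> restrict_to S (x - z) = x - z \<and> (\<forall>m\<in>\<iota> ` B. \<Phi> (\<kappa> m) x \<le> 0)" if "x \<in> U" for x
    proof -
      have "(\<forall>m\<in>\<iota> ` B. \<Phi> (\<kappa> m) x \<le> 0) \<longleftrightarrow> (\<forall>l\<in>B. \<Phi> l x \<le> 0)" using \<kappa>\<iota> by simp
      also have "\<dots> \<longleftrightarrow> (\<forall>l<p. \<Phi> l x \<le> 0)"
        using that by (force simp: U_def B_def)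
      finally show ?thesis by (simp add: PS C sublevel_set_def)
    qed
    show "0 \<le> d \<bullet> G' (\<kappa> m) z d" if "m \<in> \<iota> ` B" "restrict_to S d = d" for m d
    proof (rule convex_on_imp_curvature_nonneg[OF cvx[OF \<kappa>p(1)[OF that(1)]]])
      show "z + s *\<^sub>R d \<in> coord_space S" for s
        using zS that(2) by (simp add: restrict_to_eq_iff subspace_add subspace_scale subspace_coord_space)
      show "(\<Phi> (\<kappa> m) has_derivative (\<lambda>h. gradient (\<Phi> (\<kappa> m)) x \<bullet> h)) (at x)" for x
        by (rule deriv[OF \<kappa>p(1)[OF that(1)]])
      show "(gradient (\<Phi> (\<kappa> m)) has_derivative G' (\<kappa> m) z) (at z)"
        by (rule c11_at_has_derivative[OF G'[OF \<kappa>p(1)[OF that(1)]]])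
    qed
    show "lin_indep_family (\<lambda>m. restrict_to S (gradient (\<Phi> (\<kappa> m)) z)) (\<iota> ` B)"
    proof -
      have "inj_on \<kappa> (\<iota> ` B)" using \<kappa>\<iota> by (auto intro: inj_onI)
      moreover have im: "\<kappa> ` \<iota> ` B = B" using \<kappa>\<iota> by force
      ultimately have "inj_on (w \<circ> \<kappa>) (\<iota> ` B)"
        using ind by (simp add: lin_indep_family_def comp_inj_on)
      moreover have "(w \<circ> \<kappa>) ` \<iota> ` B = w ` B" by (simp only: image_comp[symmetric] im)
      ultimately have "inj_on (w \<circ> \<kappa>) (\<iota> ` B)" "(w \<circ> \<kappa>) ` \<iota> ` B = w ` B" .
      then show ?thesis using ind unfolding lin_indep_family_def w_def comp_def by metis
    qed
    show "restrict_to S (x - z) = x - z" if "x \<in> C" for x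
      using that by (simp add: PS C sublevel_set_def)
    show "c11_at (gradient (\<Phi> (\<kappa> m))) (G' (\<kappa> m)) z" if "m \<in> \<iota> ` B" for m
      by (rule G'[OF \<kappa>p(1)[OF that]])
    show "(\<Phi> (\<kappa> m) has_derivative (\<lambda>h. gradient (\<Phi> (\<kappa> m)) x \<bullet> h)) (at x)" if "m \<in> \<iota> ` B" for m x
      by (rule deriv[OF \<kappa>p(1)[OF that]])
    show "\<Phi> (\<kappa> m) z = 0" if "m \<in> \<iota> ` B" for m by (rule \<kappa>p(2)[OF that])
  qed (simp_all add: cvC zC linear_restrict_to restrict_to_restrict_to restrict_to_inner)
  from projection_c11[OF v] show ?thesis
    unfolding smooth_projection_at_def by metis
qed

lemma closed_second_order_cone:
  assumes "second_order_cone S C"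
  shows "closed C"
proof -
  obtain k t where C: "C = {v \<in> coord_space S. norm (restrict_to (S - {k}) v) \<le> t * v $ k \<and> 0 \<le> v $ k}"
    using assms unfolding second_order_cone_def by blast
  have "C = coord_space S \<inter> ({v. norm (restrict_to (S - {k}) v) \<le> t * v $ k} \<inter> {v. 0 \<le> v $ k})"
    using C by auto
  also have "closed \<dots>"
    by (intro closed_Int closed_coord_space closed_Collect_le continuous_intros continuous_on_restrict_to)
  finally show ?thesis .
qed

section \<open>The product structure of the constraint set\<close>

context
  fixes Q :: "('z::finite, 'w::finite) qp"
  assumes valid: "valid_qp Q"
begin

abbreviation (input) "rb b \<equiv> restrict_to (block Q b)"

lemma finite_blocks: "finite (blocks Q)"
proof -
  have "blocks Q \<subseteq> Sigma {..horizon Q + 1} (\<lambda>i. {..mult Q i})" by (auto simp: blocks_def)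
  then show ?thesis by (rule finite_subset) (intro finite_SigmaI, auto)
qed

lemma sum_restrict_blocks: "(\<Sum>b\<in>blocks Q. rb b x) = x"
proof -
  have "(\<Sum>b\<in>blocks Q. rb b x) $ k = x $ k" for k
  proof -
    have "(\<Sum>b\<in>blocks Q. rb b x) $ k = (\<Sum>b\<in>blocks Q. if zblk Q k = b then x $ k else 0)"
      by (simp add: restrict_to_def block_def)
    then show ?thesis using valid finite_blocks by (simp add: valid_qp_def)
  qed
  then show ?thesis by (simp add: vec_eq_iff)
qed

lemma restrict_restrict_block: "rb b (rb b' x) = (if b = b' then rb b x else 0)"
proof -
  have "block Q b \<inter> block Q b' = (if b = b' then block Q b else {})" by (auto simp: block_def)
  then show ?thesis by (simp add: restrict_to_restrict_to restrict_to_empty)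
qed

lemma Dblk_coord: "b \<in> blocks Q \<Longrightarrow> Dblk Q b \<subseteq> coord_space (block Q b)"
  using valid unfolding valid_qp_def smooth_sublevel_def second_order_cone_def sublevel_set_def by blast

lemma restrict_Dblk: "b \<in> blocks Q \<Longrightarrow> y \<in> Dblk Q b \<Longrightarrow> rb b y = y"
  using Dblk_coord restrict_to_eq_iff by blast

lemma restrict_Dblk_other: "b \<in> blocks Q \<Longrightarrow> y \<in> Dblk Q b \<Longrightarrow> rb b' y = (if b' = b then y else 0)"
  by (metis restrict_Dblk restrict_restrict_block)

lemma convex_Dblk: "b \<in> blocks Q \<Longrightarrow> convex (Dblk Q b)"
  using valid unfolding valid_qp_def by blast

lemma closed_Dblk: "b \<in> blocks Q \<Longrightarrow> closed (Dblk Q b)"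
  using valid closed_sublevel_set closed_second_order_cone
  unfolding valid_qp_def smooth_sublevel_def by metis

lemma Dset_Int: "Dset Q = (\<Inter>b\<in>blocks Q. rb b -` Dblk Q b)"
  by (auto simp: Dset_def)

lemma closed_Dset: "closed (Dset Q)"
  unfolding Dset_Int using closed_Dblk continuous_on_restrict_to
  by (intro closed_INT ballI closed_vimage) auto

lemma convex_Dset: "convex (Dset Q)"
  unfolding Dset_Int using convex_Dblk linear_restrict_to
  by (intro convex_INT convex_linear_vimage) auto

lemma Dset_nonempty: "Dset Q \<noteq> {}"
  using valid by (simp add: valid_qp_def)

text \<open>\<open>Dblk Q b\<close> lies in a coordinate subspace, so normality sees only the block
  part. Full vectors can therefore be tested against every block without restricting them.\<close>

lemma normal_cone_Dblk_cong:
  assumes "b \<in> blocks Q" "rb b v = rb b v'"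
  shows "v \<in> normal_cone (Dblk Q b) x \<longleftrightarrow> v' \<in> normal_cone (Dblk Q b) x"
proof -
  have "v \<bullet> (y - x) = v' \<bullet> (y - x)" if "y \<in> Dblk Q b" "x \<in> Dblk Q b" for y
  proof -
    have "rb b (y - x) = y - x" using that assms(1) by (simp add: restrict_to_diff restrict_Dblk)
    then show ?thesis using assms(2) restrict_to_inner by metis
  qed
  then show ?thesis by (auto simp: normal_cone_def)
qed

lemma normal_cone_Dset:
  assumes z: "z \<in> Dset Q"
  shows "v \<in> normal_cone (Dset Q) z \<longleftrightarrow> (\<forall>b\<in>blocks Q. v \<in> normal_cone (Dblk Q b) (rb b z))"
proof
  assume v: "v \<in> normal_cone (Dset Q) z"
  show "\<forall>b\<in>blocks Q. v \<in> normal_cone (Dblk Q b) (rb b z)"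
    unfolding normal_cone_def
  proof (intro ballI CollectI conjI)
    fix b assume b: "b \<in> blocks Q"
    show "rb b z \<in> Dblk Q b" using z b by (simp add: Dset_def)
    fix y assume y: "y \<in> Dblk Q b"
    \<comment> \<open>Replacing block \<open>b\<close> of \<open>z\<close> by \<open>y\<close> keeps
      the point in \<open>Dset Q\<close> and tests that block alone.\<close>
    have "rb b' (z + (y - rb b z)) = (if b' = b then y else rb b' z)" if "b' \<in> blocks Q" for b'
    proof -
      have "rb b' (y - rb b z) = rb b' (rb b (y - z))"
        using restrict_Dblk[OF b y] by (simp add: restrict_to_diff)
      then show ?thesis
        using restrict_Dblk_other[OF b y]
        by (simp add: restrict_to_add restrict_restrict_block restrict_to_diff)
    qed
    then have "z + (y - rb b z) \<in> Dset Q" using z y by (simp add: Dset_def)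
    then show "v \<bullet> (y - rb b z) \<le> 0" using v unfolding normal_cone_def by fastforce
  qed
next
  assume v: "\<forall>b\<in>blocks Q. v \<in> normal_cone (Dblk Q b) (rb b z)"
  have "v \<bullet> (y - z) \<le> 0" if y: "y \<in> Dset Q" for y
  proof -
    have "v \<bullet> (y - z) = (\<Sum>b\<in>blocks Q. v \<bullet> (rb b y - rb b z))"
      using sum_restrict_blocks[of "y - z"] by (simp add: restrict_to_diff flip: inner_sum_right)
    also have "\<dots> \<le> 0" using v y by (intro sum_nonpos) (auto simp: normal_cone_def Dset_def)
    finally show ?thesis .
  qed
  then show "v \<in> normal_cone (Dset Q) z" using z by (simp add: normal_cone_def)
qed

lemma closest_point_Dblk_cong:
  assumes "b \<in> blocks Q" "Dblk Q b \<noteq> {}" "rb b y = rb b y'"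
  shows "closest_point (Dblk Q b) y = closest_point (Dblk Q b) y'"
proof -
  let ?x = "closest_point (Dblk Q b) y'"
  have "y' - ?x \<in> normal_cone (Dblk Q b) ?x"
    using closest_point_eq_iff_normal_cone closed_Dblk convex_Dblk assms by blast
  then have "y - ?x \<in> normal_cone (Dblk Q b) ?x"
    using normal_cone_Dblk_cong[OF assms(1), of "y - ?x" "y' - ?x"] assms(3) by (simp add: restrict_to_diff)
  then show ?thesis
    using closest_point_eq_iff_normal_cone closed_Dblk convex_Dblk assms by blast
qed

lemma Dblk_nonempty: "b \<in> blocks Q \<Longrightarrow> Dblk Q b \<noteq> {}"
  using Dset_nonempty by (auto simp: Dset_def)

text \<open>Verified by blockwise normality. The second part recovers a block projection from the
  sum, which later separates the summands of the derivative.\<close>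

lemma closest_point_Dset:
  shows "closest_point (Dset Q) y = (\<Sum>b\<in>blocks Q. closest_point (Dblk Q b) y)"
    and "b \<in> blocks Q \<Longrightarrow> rb b (closest_point (Dset Q) y) = closest_point (Dblk Q b) y"
proof -
  let ?c = "\<lambda>b. closest_point (Dblk Q b) y"
  let ?x = "\<Sum>b\<in>blocks Q. ?c b"
  have cin: "?c b \<in> Dblk Q b" if "b \<in> blocks Q" for b
    by (rule closest_point_in_set[OF closed_Dblk[OF that] Dblk_nonempty[OF that]])
  have rx: "rb b ?x = ?c b" if b: "b \<in> blocks Q" for b
  proof -
    have "rb b ?x = (\<Sum>b'\<in>blocks Q. if b = b' then ?c b' else 0)"
      unfolding restrict_to_sum by (intro sum.cong refl restrict_Dblk_other cin)
    then show ?thesis using b finite_blocks by simp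
  qed
  have xD: "?x \<in> Dset Q" using rx cin by (simp add: Dset_def)
  have "y - ?x \<in> normal_cone (Dset Q) ?x"
    unfolding normal_cone_Dset[OF xD]
  proof
    fix b assume b: "b \<in> blocks Q"
    have "y - ?c b \<in> normal_cone (Dblk Q b) (?c b)"
      using closest_point_eq_iff_normal_cone[OF closed_Dblk convex_Dblk Dblk_nonempty] b by blast
    then show "y - ?x \<in> normal_cone (Dblk Q b) (rb b ?x)"
      using normal_cone_Dblk_cong[OF b, of "y - ?x" "y - ?c b"] rx[OF b] restrict_Dblk[OF b cin[OF b]]
      by (simp add: restrict_to_diff)
  qed
  then show 1: "closest_point (Dset Q) y = ?x"
    using closest_point_eq_iff_normal_cone[OF closed_Dset convex_Dset Dset_nonempty] by blast
  show "b \<in> blocks Q \<Longrightarrow> rb b (closest_point (Dset Q) y) = ?c b" using rx 1 by simp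
qed

lemma restrict_normal_cone_Dblk:
  assumes z: "z \<in> Dset Q" and b: "b \<in> blocks Q" and u: "u \<in> normal_cone (Dblk Q b) (rb b z)"
  shows "rb b u \<in> normal_cone (Dset Q) z"
  unfolding normal_cone_Dset[OF z]
proof
  fix b' assume b': "b' \<in> blocks Q"
  have "0 \<in> normal_cone (Dblk Q b') (rb b' z)"
    using z b' by (intro normal_cone_0) (simp add: Dset_def)
  then show "rb b u \<in> normal_cone (Dblk Q b') (rb b' z)"
    using u normal_cone_Dblk_cong[OF b', of "rb b u" "if b' = b then u else 0"]
    by (auto simp: restrict_restrict_block linear_0[OF linear_restrict_to] split: if_splits)
qed

text \<open>An element of a block cone, restricted to its block, is normal to the product; the
  prolongation past \<open>v\<close> available there is also one for the block, where only block
  parts count.\<close>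

lemma rel_interior_normal_cone_Dblk:
  assumes z: "z \<in> Dset Q" and v: "v \<in> rel_interior (normal_cone (Dset Q) z)" and b: "b \<in> blocks Q"
  shows "v \<in> rel_interior (normal_cone (Dblk Q b) (rb b z))"
proof -
  have vN: "v \<in> normal_cone (Dset Q) z" using v rel_interior_subset by blast
  then have ne: "normal_cone (Dblk Q b) (rb b z) \<noteq> {}" using normal_cone_Dset[OF z] b by blast
  have "\<exists>e>1. (1 - e) *\<^sub>R u + e *\<^sub>R v \<in> normal_cone (Dblk Q b) (rb b z)"
    if u: "u \<in> normal_cone (Dblk Q b) (rb b z)" for u
  proof -
    have "rb b u \<in> normal_cone (Dset Q) z" by (rule restrict_normal_cone_Dblk[OF z b u])
    then obtain e where e: "e > 1" "(1 - e) *\<^sub>R rb b u + e *\<^sub>R v \<in> normal_cone (Dset Q) z"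
      using v vN convex_rel_interior_iff[OF convex_normal_cone] by blast
    then have "(1 - e) *\<^sub>R rb b u + e *\<^sub>R v \<in> normal_cone (Dblk Q b) (rb b z)"
      using normal_cone_Dset[OF z] b by blast
    then have "(1 - e) *\<^sub>R u + e *\<^sub>R v \<in> normal_cone (Dblk Q b) (rb b z)"
      using normal_cone_Dblk_cong[OF b, of "(1 - e) *\<^sub>R rb b u + e *\<^sub>R v" "(1 - e) *\<^sub>R u + e *\<^sub>R v"]
      by (simp add: restrict_to_add linear_cmul[OF linear_restrict_to] restrict_restrict_block)
    then show ?thesis using e(1) by blast
  qed
  then show ?thesis using convex_rel_interior_iff[OF convex_normal_cone ne] by blast
qed

lemma smooth_projection_Dset:
  assumes types: "\<forall>b\<in>blocks Q. second_order_cone (block Q b) (Dblk Q b) \<or> affine (Dblk Q b) \<or>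
           regular_convex_sublevel (block Q b) (Dblk Q b)"
    and z: "z \<in> Dset Q" and v: "v \<in> rel_interior (normal_cone (Dset Q) z)"
  shows "smooth_projection_at (Dset Q) z v"
proof -
  have "smooth_projection_at (Dblk Q b) (rb b z) v" if b: "b \<in> blocks Q" for b
  proof -
    have zb: "rb b z \<in> Dblk Q b" using z b by (simp add: Dset_def)
    note vb = rel_interior_normal_cone_Dblk[OF z v b]
    from types b consider "second_order_cone (block Q b) (Dblk Q b)" | "affine (Dblk Q b)"
      | "regular_convex_sublevel (block Q b) (Dblk Q b)" by blast
    then show ?thesis
    proof cases
      case 1
      show ?thesis
        by (rule second_order_cone_smooth_projection[OF 1 closed_Dblk[OF b] convex_Dblk[OF b] zb vb])
    next
      case 2
      show ?thesis by (rule smooth_projection_at_affine[OF 2 zb vb])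
    next
      case 3
      show ?thesis by (rule regular_convex_sublevel_smooth_projection[OF 3 convex_Dblk[OF b] zb vb])
    qed
  qed
  then obtain J where J: "\<And>b. b \<in> blocks Q \<Longrightarrow> c11_at (closest_point (Dblk Q b)) (J b) (rb b z + v)"
    "\<And>b h. b \<in> blocks Q \<Longrightarrow> J b (rb b z + v) h = 0 \<Longrightarrow> h \<in> span (normal_cone (Dblk Q b) (rb b z))"
    unfolding smooth_projection_at_def by metis
  \<comment> \<open>The block results sit at \<open>rb b z + v\<close>, the product at
    \<open>z + v\<close>. The shift \<open>rb b z - z\<close> has no component in block
    \<open>b\<close>, so the block projection does not notice it.\<close>
  define K where "K b y = J b (y + (rb b z - z))" for b y
  have K: "c11_at (closest_point (Dblk Q b)) (K b) (z + v)" if b: "b \<in> blocks Q" for b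
  proof -
    have 1: "c11_at (\<lambda>y. y + (rb b z - z)) (\<lambda>_ h. h) (z + v)"
      by (rule c11_at_affine[OF bounded_linear_ident])
    have "c11_at (\<lambda>y. closest_point (Dblk Q b) (y + (rb b z - z))) (K b) (z + v)"
      unfolding K_def by (rule c11_at_compose[OF 1]) (use J(1)[OF b] in \<open>simp add: algebra_simps\<close>)
    moreover have "closest_point (Dblk Q b) (y + (rb b z - z)) = closest_point (Dblk Q b) y" for y
      by (rule closest_point_Dblk_cong[OF b Dblk_nonempty[OF b]])
        (simp add: restrict_to_add restrict_to_diff restrict_restrict_block)
    ultimately show ?thesis by simp
  qed
  define L where "L = (\<lambda>y h. \<Sum>b\<in>blocks Q. K b y h)"
  have L: "c11_at (closest_point (Dset Q)) L (z + v)"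
    unfolding closest_point_Dset(1)[abs_def] L_def by (rule c11_at_sum[OF finite_blocks K])
  moreover have "h \<in> span (normal_cone (Dset Q) z)" if h: "L (z + v) h = 0" for h
  proof -
    have "rb b h \<in> span (normal_cone (Dset Q) z)" if b: "b \<in> blocks Q" for b
    proof -
      \<comment> \<open>Restricting the summed derivative to one block isolates \<open>K b\<close>,
        so a vanishing sum makes every summand vanish.\<close>
      have "((\<lambda>y. rb b (closest_point (Dset Q) y)) has_derivative (\<lambda>h. rb b (L (z + v) h))) (at (z + v))"
        by (rule bounded_linear.has_derivative[OF _ c11_at_has_derivative[OF L]])
          (simp add: linear_restrict_to linear_conv_bounded_linear[symmetric])
      then have "(closest_point (Dblk Q b) has_derivative (\<lambda>h. rb b (L (z + v) h))) (at (z + v))"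
        by (simp add: closest_point_Dset(2)[OF b])
      then have "(\<lambda>h. rb b (L (z + v) h)) = K b (z + v)"
        using c11_at_has_derivative[OF K[OF b]] has_derivative_unique by blast
      then have "K b (z + v) h = 0" using h linear_0[OF linear_restrict_to] by metis
      then have "J b (rb b z + v) h = 0" by (simp add: K_def algebra_simps)
      then have "h \<in> span (normal_cone (Dblk Q b) (rb b z))" using J(2)[OF b] by blast
      then have "rb b h \<in> span (rb b ` normal_cone (Dblk Q b) (rb b z))"
        using linear_span_image[OF linear_restrict_to] by blast
      moreover have "rb b ` normal_cone (Dblk Q b) (rb b z) \<subseteq> normal_cone (Dset Q) z"
        using restrict_normal_cone_Dblk[OF z b] by blast
      ultimately show ?thesis using span_mono by blast
    qed
    then have "(\<Sum>b\<in>blocks Q. rb b h) \<in> span (normal_cone (Dset Q) z)" by (rule span_sum)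
    then show ?thesis by (simp add: sum_restrict_blocks)
  qed
  ultimately show ?thesis unfolding smooth_projection_at_def by blast
qed

end

section \<open>Newton steps safeguarded by an averaged operator\<close>

text \<open>The last assumption is firm nonexpansiveness. \<open>N\<close> stands for the
  \<open>M\<close>-norm, of which only the equivalence with the Euclidean norm and the triangle
  inequality are recorded.\<close>

locale averaged_operator =
  fixes T :: "'a::euclidean_space \<Rightarrow> 'a" and N :: "'a \<Rightarrow> real" and m K :: real
  assumes m_pos: "0 < m" and N_lower: "\<And>x. m * norm x \<le> N x" and N_upper: "\<And>x. N x \<le> K * norm x"
    and N_triangle: "\<And>x y. N (x + y) \<le> N x + N y"
    and averaged: "\<And>x y. (N (T x - T y))\<^sup>2 + (N ((x - T x) - (y - T y)))\<^sup>2 \<le> (N (x - y))\<^sup>2"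
begin

abbreviation R where "R x \<equiv> x - T x"

text \<open>Candidates \<open>p\<close> are arbitrary here: global convergence rests on the
  acceptance tests alone, and the Newton equation enters only the local estimates.\<close>

definition newton_run :: "real \<Rightarrow> real \<Rightarrow> (nat \<Rightarrow> 'a) \<Rightarrow> (nat \<Rightarrow> 'a) \<Rightarrow> bool" where
  "newton_run c \<sigma> x p \<longleftrightarrow> (\<forall>k. x (Suc k) =
     (if N (R (x k + p k)) \<le> c * N (R (x k)) \<and> N (p k) < \<sigma> * N (R (x k)) then x k + p k else T (x k)))"

lemma N_nonneg: "0 \<le> N x"
  using N_lower[of x] m_pos by (smt (verit) mult_nonneg_nonneg norm_ge_zero)

lemma N_0: "N 0 = 0"
  using N_upper[of 0] N_nonneg[of 0] by simp

lemma K_pos: "0 < K"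
proof -
  obtain b :: 'a where "b \<in> Basis" using nonempty_Basis by blast
  then show ?thesis using N_lower[of b] N_upper[of b] m_pos by simp
qed

lemma T_nonexpansive: "N (T x - T y) \<le> N (x - y)"
proof (rule power2_le_imp_le[OF _ N_nonneg])
  show "(N (T x - T y))\<^sup>2 \<le> (N (x - y))\<^sup>2"
    using averaged[of x y] zero_le_power2[of "N ((x - T x) - (y - T y))"] by linarith
qed

lemma R_nonexpansive: "N (R x - R y) \<le> N (x - y)"
proof (rule power2_le_imp_le[OF _ N_nonneg])
  show "(N (R x - R y))\<^sup>2 \<le> (N (x - y))\<^sup>2"
    using averaged[of x y] zero_le_power2[of "N (T x - T y)"] by linarith
qed

lemma newton_run_step:
  assumes "newton_run c \<sigma> x p"
  obtains (newton) "x (Suc k) = x k + p k" "N (R (x (Suc k))) \<le> c * N (R (x k))" "N (p k) < \<sigma> * N (R (x k))"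
  | (fixed_point) "x (Suc k) = T (x k)"
  using assms unfolding newton_run_def by metis

lemma newton_run_residual_mono:
  assumes "newton_run c \<sigma> x p" "c < 1"
  shows "N (R (x (Suc k))) \<le> N (R (x k))"
  using assms(1)
proof (cases rule: newton_run_step[of c \<sigma> x p k])
  case newton
  have "c * N (R (x k)) \<le> 1 * N (R (x k))" using assms(2) N_nonneg by (intro mult_right_mono) auto
  then show ?thesis using newton by simp
next
  case fixed_point
  \<comment> \<open>The residual at \<open>T (x k)\<close> is the difference of the images of
    \<open>x k\<close> and \<open>T (x k)\<close>, whose own difference is the residual at
    \<open>x k\<close>.\<close>
  then show ?thesis using T_nonexpansive[of "x k" "T (x k)"] by simp
qed

theorem newton_run_residual_tendsto_0:
  assumes run: "newton_run c \<sigma> x p" and c: "c < 1" and Txs: "T xs = xs"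
  shows "(\<lambda>k. N (R (x k))) \<longlonglongrightarrow> 0"
proof -
  define r where "r k = N (R (x k))" for k
  have dec: "decseq r"
    using newton_run_residual_mono[OF run c] by (simp add: r_def decseq_Suc_iff)
  obtain l where l: "r \<longlonglongrightarrow> l" "\<And>k. l \<le> r k"
    using decseq_convergent[OF dec, of 0] N_nonneg by (auto simp: r_def)
  have "0 \<le> l" using LIMSEQ_le_const[OF l(1)] N_nonneg by (auto simp: r_def)
  moreover have False if pos: "l > 0"
  proof -
    have "(\<lambda>k. c * r k) \<longlonglongrightarrow> c * l" by (intro tendsto_intros l(1))
    moreover have "c * l < l" using c pos by simp
    ultimately have "eventually (\<lambda>k. c * r k < l) sequentially" by (rule order_tendstoD(2))
    \<comment> \<open>Beyond \<open>k0\<close> an accepted Newton update would push the residual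
      below its limit, so only applications of \<open>T\<close> remain, each lowering the squared
      distance by at least \<open>l\<^sup>2\<close>.\<close>
    then obtain k0 where k0: "\<And>k. k \<ge> k0 \<Longrightarrow> c * r k < l"
      unfolding eventually_sequentially by blast
    have step: "(N (x (Suc k) - xs))\<^sup>2 \<le> (N (x k - xs))\<^sup>2 - l\<^sup>2" if "k \<ge> k0" for k
      using run
    proof (cases rule: newton_run_step[of c \<sigma> x p k])
      case newton
      then have "r (Suc k) < l" using k0[OF that] by (simp add: r_def)
      then show ?thesis using l(2)[of "Suc k"] by simp
    next
      case fixed_point
      have "(N (T (x k) - T xs))\<^sup>2 + (N (R (x k) - R xs))\<^sup>2 \<le> (N (x k - xs))\<^sup>2" by (rule averaged)
      then have "(N (x (Suc k) - xs))\<^sup>2 + (r k)\<^sup>2 \<le> (N (x k - xs))\<^sup>2"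
        using Txs fixed_point by (simp add: r_def)
      moreover have "l\<^sup>2 \<le> (r k)\<^sup>2" using l(2) pos by (intro power_mono) auto
      ultimately show ?thesis by linarith
    qed
    have "(N (x (k0 + n) - xs))\<^sup>2 \<le> (N (x k0 - xs))\<^sup>2 - real n * l\<^sup>2" for n
    proof (induction n)
      case (Suc n)
      then show ?case using step[of "k0 + n"] by (simp add: algebra_simps)
    qed simp
    then have "real n * l\<^sup>2 \<le> (N (x k0 - xs))\<^sup>2" for n
      by (smt (verit) zero_le_power2)
    then show False using reals_Archimedean3[of "l\<^sup>2"] pos by (metis not_le zero_less_power)
  qed
  ultimately have "l = 0" by fastforce
  then show ?thesis using l(1) by (simp add: r_def[abs_def])
qed

lemma continuous_R: "continuous_on S (\<lambda>x. norm (R x))"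
proof -
  have "(K / m)-lipschitz_on S T"
  proof (rule lipschitz_onI)
    fix x y
    have "m * norm (T x - T y) \<le> N (T x - T y)" by (rule N_lower)
    also have "\<dots> \<le> N (x - y)" by (rule T_nonexpansive)
    also have "\<dots> \<le> K * norm (x - y)" by (rule N_upper)
    finally show "dist (T x) (T y) \<le> K / m * dist x y"
      using m_pos by (simp add: dist_norm field_simps)
  qed (use K_pos m_pos in simp)
  then have "continuous_on S T" by (rule lipschitz_on_continuous_on)
  then show ?thesis by (intro continuous_intros)
qed

text \<open>The quantity \<open>N (x\<^sub>k - xs) + \<sigma> / (1 - c) * N (R x\<^sub>k)\<close> does not increase along a run, so a run
  stays bounded.\<close>

theorem newton_run_tendsto:
  assumes run: "newton_run c \<sigma> x p" and c: "c < 1" and \<sigma>: "0 \<le> \<sigma>"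
    and Txs: "T xs = xs" and unique: "\<And>y. T y = y \<Longrightarrow> y = xs"
  shows "x \<longlonglongrightarrow> xs"
proof -
  define V where "V k = N (x k - xs) + \<sigma> / (1 - c) * N (R (x k))" for k
  have coef: "0 \<le> \<sigma> / (1 - c)" using \<sigma> c by simp
  have "V (Suc k) \<le> V k" for k
    using run
  proof (cases rule: newton_run_step[of c \<sigma> x p k])
    case newton
    have "N (x (Suc k) - xs) \<le> N (x k - xs) + N (p k)"
      using N_triangle[of "x k - xs" "p k"] newton(1) by (simp add: algebra_simps)
    then have "V (Suc k) \<le> N (x k - xs) + \<sigma> * N (R (x k)) + \<sigma> / (1 - c) * (c * N (R (x k)))"
      unfolding V_def using newton(2,3) coef by (intro add_mono mult_left_mono) auto
    \<comment> \<open>\<open>\<sigma> + \<sigma> * c / (1 - c) = \<sigma> / (1 - c)\<close>: the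
      drop of the residual pays for the length of the step.\<close>
    also have "\<dots> = V k" using c by (simp add: V_def field_simps)
    finally show ?thesis .
  next
    case fixed_point
    have "N (x (Suc k) - xs) \<le> N (x k - xs)"
      using T_nonexpansive[of "x k" xs] fixed_point Txs by simp
    then show ?thesis unfolding V_def using newton_run_residual_mono[OF run c] coef
      by (intro add_mono mult_left_mono)
  qed
  then have V0: "V k \<le> V 0" for k by (induction k) (auto intro: order_trans)
  have bound: "norm (x k - xs) \<le> V 0 / m" for k
  proof -
    have "m * norm (x k - xs) \<le> N (x k - xs)" by (rule N_lower)
    also have "\<dots> \<le> V k" unfolding V_def by (subst le_add_same_cancel1) (intro mult_nonneg_nonneg coef N_nonneg)
    also note V0
    finally show ?thesis using m_pos by (simp add: field_simps)
  qed
  have res: "(\<lambda>k. norm (R (x k))) \<longlonglongrightarrow> 0"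
  proof (rule tendsto_sandwich[OF _ _ tendsto_const])
    show "(\<lambda>k. N (R (x k)) / m) \<longlonglongrightarrow> 0"
      using tendsto_divide[OF newton_run_residual_tendsto_0[OF run c Txs] tendsto_const, of m] m_pos by simp
    show "\<forall>\<^sub>F k in sequentially. norm (R (x k)) \<le> N (R (x k)) / m"
      using N_lower m_pos by (intro always_eventually allI) (simp add: field_simps)
  qed auto
  show ?thesis
  proof (rule tendstoI)
    fix e :: real assume e: "e > 0"
    \<comment> \<open>On this compact shell the residual has a positive minimum, as
      \<open>xs\<close> is the only fixed point; residuals tending to 0 keep late iterates out of
      it.\<close>
    define S where "S = cball xs (V 0 / m) - ball xs e"
    have "compact S" unfolding S_def by (intro compact_diff compact_cball open_ball)
    show "eventually (\<lambda>k. dist (x k) xs < e) sequentially"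
    proof (cases "S = {}")
      case True
      have "x k \<in> cball xs (V 0 / m)" for k using bound[of k] by (simp add: dist_norm norm_minus_commute)
      moreover have "cball xs (V 0 / m) \<subseteq> ball xs e" using True unfolding S_def by blast
      ultimately have "x k \<in> ball xs e" for k by blast
      then show ?thesis by (simp add: dist_commute)
    next
      case False
      obtain y where y: "y \<in> S" "\<And>u. u \<in> S \<Longrightarrow> norm (R y) \<le> norm (R u)"
        using continuous_attains_inf[OF \<open>compact S\<close> False continuous_R] by blast
      have "R y \<noteq> 0" using y(1) unique[of y] e by (auto simp: S_def)
      then have "eventually (\<lambda>k. norm (R (x k)) < norm (R y)) sequentially"
        using res by (intro order_tendstoD(2)[OF res]) simp
      then show ?thesis
      proof eventually_elim
        case (elim k)
        then have "x k \<notin> S" using y(2) not_le by blast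
        moreover have "x k \<in> cball xs (V 0 / m)" using bound[of k] by (simp add: dist_norm norm_minus_commute)
        ultimately show ?case by (simp add: S_def dist_commute)
      qed
    qed
  qed
qed

text \<open>Everything follows from a lower bound for \<open>I - J x\<close> near \<open>xs\<close>:
  it bounds the new error by the Taylor remainder and the step by the residual. For the residual
  test, the old distance is in turn bounded by the residual.\<close>

lemma newton_step_estimates:
  assumes Txs: "T xs = xs" and J: "c11_at T J xs" and inj: "\<And>v. J xs v = v \<Longrightarrow> v = 0" and c: "0 < c"
  obtains \<delta> C \<kappa> where "\<delta> > 0" "C > 0" "\<kappa> > 0"
    "\<And>x. x \<in> ball xs \<delta> \<Longrightarrow> bij (\<lambda>p. p - J x p)"
    "\<And>x p. x \<in> ball xs \<delta> \<Longrightarrow> p - J x p = T x - x \<Longrightarrow>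
       N (x + p - xs) \<le> C * (N (x - xs))\<^sup>2 \<and> N (R (x + p)) \<le> c * N (R x) \<and> N p \<le> \<kappa> * N (R x)"
proof -
  obtain e L where e: "e > 0" "0 \<le> L" "\<And>x. x \<in> ball xs e \<Longrightarrow> (T has_derivative J x) (at x)"
    "\<And>x h. x \<in> ball xs e \<Longrightarrow> norm (J x h - J xs h) \<le> L * norm (x - xs) * norm h"
    by (rule c11_atE[OF J]) (rule that)
  have linJ: "linear (J x)" if "x \<in> ball xs e" for x
    using e(3)[OF that] has_derivative_linear by blast
  have linA: "linear (\<lambda>p. p - J x p)" if "x \<in> ball xs e" for x
    by (intro linear_compose_sub linear_ident linJ that)
  have "xs \<in> ball xs e" using e(1) by simp
  note linA0 = linA[OF this] and linJ0 = linJ[OF this]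
  have "inj (\<lambda>p. p - J xs p)" using inj by (force simp: linear_injective_0[OF linA0])
  then obtain m0 where m0: "m0 > 0" "\<And>h. m0 * norm h \<le> norm (h - J xs h)"
    using linear_inj_bounded_below_pos[OF linA0] by (metis mult.commute)
  \<comment> \<open>\<open>a * d\<^sup>2\<close> will bound the new error: the remainder is at most
    \<open>2 * L * d\<^sup>2\<close>, and inverting costs the factor \<open>2 / m0\<close>.\<close>
  define a where "a = 4 * L / m0"
  have a: "0 \<le> a" using e m0 by (simp add: a_def)
  \<comment> \<open>The four radii ensure, in turn, differentiability, half of the lower bound
    \<open>m0\<close>, a new error of at most half the old distance, and reduction of the residual
    by the factor \<open>c\<close>.\<close>
  define \<delta> where "\<delta> = Min {e, m0 / (2 * (L + 1)), 1 / (2 * (a + 1)), c * m0 * m / (4 * K * (a + 1))}"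
  have \<delta>: "\<delta> > 0" using e m0 a c m_pos K_pos by (auto simp: \<delta>_def)
  have low: "m0 / 2 * norm h \<le> norm (h - J x h)" if x: "x \<in> ball xs \<delta>" for x h
  proof -
    have xe: "x \<in> ball xs e" and n: "norm (x - xs) < m0 / (2 * (L + 1))"
      using x by (auto simp: \<delta>_def dist_norm norm_minus_commute)
    have "L * norm (x - xs) \<le> (L + 1) * norm (x - xs)" by (simp add: algebra_simps)
    also have "\<dots> \<le> m0 / 2" using n e(2) by (simp add: field_simps)
    finally have *: "L * norm (x - xs) \<le> m0 / 2" .
    have "norm ((u - J x u) - (u - J xs u)) \<le> m0 / 2 * norm u" for u
    proof -
      have "norm ((u - J x u) - (u - J xs u)) = norm (J x u - J xs u)"
        by (simp add: norm_minus_commute)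
      also have "\<dots> \<le> L * norm (x - xs) * norm u" by (rule e(4)[OF xe])
      also have "\<dots> \<le> m0 / 2 * norm u" using * by (rule mult_right_mono) simp
      finally show ?thesis .
    qed
    from injective_linear_lower_bound_near[OF linA0 m0(2) this]
    show ?thesis by simp
  qed
  have bij: "bij (\<lambda>p. p - J x p)" if x: "x \<in> ball xs \<delta>" for x
  proof -
    have lin: "linear (\<lambda>p. p - J x p)" using x by (intro linA) (simp add: \<delta>_def)
    have "h = 0" if "h - J x h = 0" for h using low[OF x, of h] that m0(1) by (simp add: mult_le_0_iff)
    then have "inj (\<lambda>p. p - J x p)" by (simp add: linear_injective_0[OF lin])
    then show ?thesis using linear_inj_imp_surj[OF lin] by (simp add: bij_def)
  qed
  \<comment> \<open>One \<open>L\<close> comes from the mean value bound for \<open>T\<close> minus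
    \<open>J xs\<close>, the other from replacing \<open>J xs\<close> by \<open>J x\<close>.\<close>
  have remainder: "norm (T x - T xs - J x (x - xs)) \<le> 2 * L * (norm (x - xs))\<^sup>2" if x: "x \<in> ball xs e" for x
  proof -
    let ?d = "norm (x - xs)"
    have sub: "cball xs ?d \<subseteq> ball xs e" using x by (auto simp: dist_norm norm_minus_commute)
    have "norm ((T x - J xs x) - (T xs - J xs xs)) \<le> (L * ?d) * norm (x - xs)"
    proof (rule differentiable_bound[of "cball xs ?d" _ "\<lambda>y h. J y h - J xs h"])
      fix y assume y: "y \<in> cball xs ?d"
      then have ye: "y \<in> ball xs e" using sub by blast
      have "((\<lambda>y. T y - J xs y) has_derivative (\<lambda>h. J y h - J xs h)) (at y)"
        by (intro has_derivative_diff e(3) ye linear_imp_has_derivative linJ0)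
      then show "((\<lambda>y. T y - J xs y) has_derivative (\<lambda>h. J y h - J xs h)) (at y within cball xs ?d)"
        by (rule has_derivative_at_withinI)
      show "onorm (\<lambda>h. J y h - J xs h) \<le> L * ?d"
      proof (rule onorm_bound)
        fix h
        have "norm (J y h - J xs h) \<le> L * norm (y - xs) * norm h" by (rule e(4)[OF ye])
        also have "\<dots> \<le> L * ?d * norm h"
          using y e(2) by (intro mult_right_mono mult_left_mono) (auto simp: dist_norm norm_minus_commute)
        finally show "norm (J y h - J xs h) \<le> L * ?d * norm h" .
      qed (use e(2) in simp)
    qed (auto simp: dist_norm norm_minus_commute)
    then have "norm (T x - T xs - J xs (x - xs)) \<le> L * ?d * ?d"
      by (simp add: linear_diff[OF linJ0] algebra_simps)
    moreover have "norm (J x (x - xs) - J xs (x - xs)) \<le> L * ?d * ?d" by (rule e(4)[OF x])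
    moreover have "norm (T x - T xs - J x (x - xs))
        \<le> norm (T x - T xs - J xs (x - xs)) + norm (J x (x - xs) - J xs (x - xs))"
      using norm_triangle_ineq4[of "T x - T xs - J xs (x - xs)" "J x (x - xs) - J xs (x - xs)"] by simp
    ultimately show ?thesis by (simp add: power2_eq_square algebra_simps)
  qed
  define C where "C = K * a / m\<^sup>2 + 1"
  define \<kappa> where "\<kappa> = 2 * K / (m0 * m)"
  show thesis
  proof (rule that[of \<delta> C \<kappa>])
    show "C > 0" using K_pos a by (simp add: C_def add_nonneg_pos)
    show "\<kappa> > 0" using K_pos m0 m_pos by (simp add: \<kappa>_def)
    fix x p assume x: "x \<in> ball xs \<delta>" and p: "p - J x p = T x - x"
    define d where "d = norm (x - xs)"
    have d: "0 \<le> d" by (simp add: d_def)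
    have xe: "x \<in> ball xs e" and d1: "d < 1 / (2 * (a + 1))" and d2: "d < c * m0 * m / (4 * K * (a + 1))"
      using x by (auto simp: \<delta>_def d_def dist_norm norm_minus_commute)
    \<comment> \<open>Substituting the Newton equation eliminates \<open>p\<close>, leaving the
      Taylor remainder.\<close>
    have "(x + p - xs) - J x (x + p - xs) = T x - T xs - J x (x - xs)"
    proof -
      have "J x (x + p - xs) = J x (x - xs) + J x p"
        using linear_add[OF linJ[OF xe], of "x - xs" p] by (simp add: algebra_simps)
      moreover have "J x p = p - (T x - x)" using p by (simp add: algebra_simps)
      ultimately show ?thesis by (simp add: Txs algebra_simps)
    qed
    then have "m0 / 2 * norm (x + p - xs) \<le> 2 * L * d\<^sup>2"
      using low[OF x, of "x + p - xs"] remainder[OF xe] by (simp add: d_def)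
    then have e1: "norm (x + p - xs) \<le> a * d\<^sup>2" using m0(1) by (simp add: a_def field_simps)
    have np: "norm p \<le> 2 / m0 * norm (R x)"
      using low[OF x, of p] p m0(1) by (simp add: norm_minus_commute field_simps)
    have NR: "norm (R x) \<le> N (R x) / m" using N_lower[of "R x"] m_pos by (simp add: field_simps)
    have Ne: "N (x + p - xs) \<le> K * (a * d\<^sup>2)"
      using N_upper[of "x + p - xs"] e1 K_pos by (meson less_imp_le mult_left_mono order_trans)
    have dN: "d\<^sup>2 \<le> (N (x - xs))\<^sup>2 / m\<^sup>2"
    proof -
      have "(m * d)\<^sup>2 \<le> (N (x - xs))\<^sup>2" using N_lower[of "x - xs"] m_pos d by (intro power_mono) (auto simp: d_def)
      then show ?thesis using m_pos by (simp add: power_mult_distrib field_simps)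
    qed
    have "N (x + p - xs) \<le> C * (N (x - xs))\<^sup>2"
    proof -
      have "K * (a * d\<^sup>2) \<le> K * (a * ((N (x - xs))\<^sup>2 / m\<^sup>2))"
        using dN K_pos a by (intro mult_left_mono) auto
      also have "\<dots> \<le> C * (N (x - xs))\<^sup>2" by (simp add: C_def algebra_simps)
      finally show ?thesis using Ne by linarith
    qed
    moreover have "N p \<le> \<kappa> * N (R x)"
    proof -
      have "N p \<le> K * norm p" by (rule N_upper)
      also have "\<dots> \<le> K * (2 / m0 * (N (R x) / m))"
        using np NR K_pos m0(1)
        by (intro mult_left_mono order_trans[OF np mult_left_mono[OF NR]]) auto
      finally show ?thesis by (simp add: \<kappa>_def algebra_simps)
    qed
    moreover have "N (R (x + p)) \<le> c * N (R x)"
    proof -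
      \<comment> \<open>Since the new error is at most \<open>d / 2\<close>, the triangle inequality
        gives \<open>d \<le> 2 * norm p\<close>, and \<open>np\<close> bounds the step by the
        residual.\<close>
      have "a * d \<le> (a + 1) * d" using d by (simp add: algebra_simps)
      also have "\<dots> \<le> 1 / 2" using d1 a by (simp add: field_simps)
      finally have "a * d * d \<le> 1 / 2 * d" using d by (rule mult_right_mono)
      then have "a * d\<^sup>2 \<le> d / 2" by (simp add: power2_eq_square algebra_simps)
      moreover have "d \<le> norm (x + p - xs) + norm p"
        using norm_triangle_ineq4[of "x + p - xs" p] by (simp add: d_def)
      ultimately have "d \<le> 4 / m0 * norm (R x)" using e1 np by (simp add: field_simps)
      also have "\<dots> \<le> 4 / m0 * (N (R x) / m)" using NR m0(1) by (intro mult_left_mono) auto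
      finally have d3: "d \<le> 4 / (m0 * m) * N (R x)" by simp
      have "N (R (x + p)) \<le> N (x + p - xs)" using R_nonexpansive[of "x + p" xs] Txs by simp
      also have "\<dots> \<le> (K * (a + 1) * d) * d"
      proof -
        have "K * (a * d\<^sup>2) \<le> K * ((a + 1) * d\<^sup>2)"
          using K_pos by (intro mult_left_mono mult_right_mono) auto
        then show ?thesis using Ne by (simp add: power2_eq_square algebra_simps)
      qed
      also have "\<dots> \<le> (c * m0 * m / 4) * (4 / (m0 * m) * N (R x))"
      proof (intro mult_mono d3 d)
        have "0 < 4 * K * (a + 1)" using K_pos a by simp
        from d2[unfolded pos_less_divide_eq[OF this]]
        show "K * (a + 1) * d \<le> c * m0 * m / 4" by (simp add: algebra_simps)
      qed (use c m0 m_pos in auto)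
      also have "\<dots> = c * N (R x)" using m0 m_pos by simp
      finally show ?thesis .
    qed
    ultimately show "N (x + p - xs) \<le> C * (N (x - xs))\<^sup>2 \<and> N (R (x + p)) \<le> c * N (R x) \<and> N p \<le> \<kappa> * N (R x)"
      by blast
  qed (use \<delta> bij in auto)
qed

end

section \<open>Normal cones and the polar cone\<close>

lemma has_derivative_imp_directional_limit:
  fixes f :: "'a::real_normed_vector \<Rightarrow> 'b::real_normed_vector"
  assumes "(f has_derivative f') (at a)"
  shows "((\<lambda>s. (1 / s) *\<^sub>R (f (a + s *\<^sub>R v) - f a)) \<longlongrightarrow> f' v) (at 0)"
proof -
  have "((\<lambda>s. f (a + s *\<^sub>R v)) has_derivative (\<lambda>r. f' (r *\<^sub>R v))) (at 0)"
    by (rule has_derivative_compose[of "\<lambda>s. a + s *\<^sub>R v" "\<lambda>r. r *\<^sub>R v" _ _ f])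
      (use assms in \<open>auto intro!: derivative_eq_intros\<close>)
  then have "(\<lambda>s. norm (f (a + s *\<^sub>R v) - f a - s *\<^sub>R f' v) / norm s) \<midarrow>0\<rightarrow> 0"
    using linear_cmul[OF has_derivative_linear[OF assms]] by (simp add: has_derivative_at)
  moreover have "\<forall>\<^sub>F s in at (0::real). norm (f (a + s *\<^sub>R v) - f a - s *\<^sub>R f' v) / norm s
      = norm ((1 / s) *\<^sub>R (f (a + s *\<^sub>R v) - f a) - f' v)"
  proof (rule eventually_at_filter[THEN iffD2], rule always_eventually, safe)
    fix s :: real assume s: "s \<noteq> 0"
    have "(1 / s) *\<^sub>R (f (a + s *\<^sub>R v) - f a) - f' v = (1 / s) *\<^sub>R (f (a + s *\<^sub>R v) - f a - s *\<^sub>R f' v)"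
      using s by (simp add: scaleR_diff_right)
    then show "norm (f (a + s *\<^sub>R v) - f a - s *\<^sub>R f' v) / norm s
      = norm ((1 / s) *\<^sub>R (f (a + s *\<^sub>R v) - f a) - f' v)" by simp
  qed
  ultimately have "((\<lambda>s. norm ((1 / s) *\<^sub>R (f (a + s *\<^sub>R v) - f a) - f' v)) \<longlongrightarrow> 0) (at 0)"
    by (rule Lim_transform_eventually)
  then show ?thesis by (simp add: Lim_null[of _ "f' v"] tendsto_norm_zero_iff)
qed

lemma quadratic_form_sqrt_triangle:
  fixes M :: "'a::real_inner \<Rightarrow> 'a"
  assumes lin: "linear M" and sym: "\<And>u v. u \<bullet> M v = v \<bullet> M u" and pos: "\<And>v. v \<noteq> 0 \<Longrightarrow> 0 < v \<bullet> M v"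
  shows "sqrt ((u + v) \<bullet> M (u + v)) \<le> sqrt (u \<bullet> M u) + sqrt (v \<bullet> M v)"
proof -
  have nn: "0 \<le> v \<bullet> M v" for v using pos[of v] by (cases "v = 0") auto
  have "(u \<bullet> M v)\<^sup>2 \<le> (u \<bullet> M u) * (v \<bullet> M v)"
  proof (cases "v = 0")
    case False
    \<comment> \<open>The minimiser of the quadratic form at \<open>u - t *\<^sub>R v\<close>, as in
      the usual proof of Cauchy-Schwarz.\<close>
    define t where "t = (u \<bullet> M v) / (v \<bullet> M v)"
    have "0 \<le> (u - t *\<^sub>R v) \<bullet> M (u - t *\<^sub>R v)" by (rule nn)
    also have "\<dots> = u \<bullet> M u - 2 * t * (u \<bullet> M v) + t * t * (v \<bullet> M v)"
      using sym[of v u] by (simp add: linear_diff[OF lin] linear_cmul[OF lin] inner_diff_left inner_diff_right algebra_simps)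
    also have "\<dots> = u \<bullet> M u - (u \<bullet> M v)\<^sup>2 / (v \<bullet> M v)"
      using pos[OF False] by (simp add: t_def power2_eq_square)
    finally show ?thesis using pos[OF False] by (simp add: field_simps)
  qed (simp add: linear_0[OF lin])
  then have "\<bar>u \<bullet> M v\<bar> \<le> sqrt (u \<bullet> M u) * sqrt (v \<bullet> M v)"
    by (simp flip: real_sqrt_mult add: real_le_rsqrt)
  then have "(u + v) \<bullet> M (u + v) \<le> (sqrt (u \<bullet> M u) + sqrt (v \<bullet> M v))\<^sup>2"
    using sym[of v u] nn
    by (simp add: linear_add[OF lin] inner_add_left inner_add_right power2_sum)
  then show ?thesis using nn by (intro real_le_lsqrt add_nonneg_nonneg) auto
qed

lemma normal_cone_monotone:
  "u \<in> normal_cone C x \<Longrightarrow> v \<in> normal_cone C y \<Longrightarrow> 0 \<le> (u - v) \<bullet> (x - y)"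
proof -
  assume a: "u \<in> normal_cone C x" "v \<in> normal_cone C y"
  then have "u \<bullet> (y - x) \<le> 0" "v \<bullet> (x - y) \<le> 0" by (auto simp: normal_cone_def)
  then show ?thesis by (simp add: inner_diff_left inner_diff_right)
qed

text \<open>The prolongation criterion for \<open>v\<close>, applied to
  \<open>(1 / c) *\<^sub>R u\<close>. It bridges the relative interior hypothesis, which has no step
  size, and the argument of the projection, which carries \<alpha>.\<close>

lemma rel_interior_normal_cone_scaleR:
  fixes C :: "'a::euclidean_space set"
  assumes v: "v \<in> rel_interior (normal_cone C x)" and c: "0 < c"
  shows "c *\<^sub>R v \<in> rel_interior (normal_cone C x)"
proof -
  have vN: "v \<in> normal_cone C x" using v rel_interior_subset by blast
  then have ne: "normal_cone C x \<noteq> {}" by blast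
  have "\<exists>e>1. (1 - e) *\<^sub>R u + e *\<^sub>R (c *\<^sub>R v) \<in> normal_cone C x" if u: "u \<in> normal_cone C x" for u
  proof -
    have "(1 / c) *\<^sub>R u \<in> normal_cone C x" using u c by (simp add: normal_cone_scaleR)
    then obtain e where e: "e > 1" "(1 - e) *\<^sub>R ((1 / c) *\<^sub>R u) + e *\<^sub>R v \<in> normal_cone C x"
      using v convex_rel_interior_iff[OF convex_normal_cone ne] by blast
    then have "c *\<^sub>R ((1 - e) *\<^sub>R ((1 / c) *\<^sub>R u) + e *\<^sub>R v) \<in> normal_cone C x"
      using c by (intro normal_cone_scaleR) auto
    moreover have "c *\<^sub>R ((1 - e) *\<^sub>R ((1 / c) *\<^sub>R u) + e *\<^sub>R v) = (1 - e) *\<^sub>R u + e *\<^sub>R (c *\<^sub>R v)"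
      using c by (simp add: scaleR_add_right mult.commute)
    ultimately show ?thesis using e(1) by auto
  qed
  then show ?thesis using convex_rel_interior_iff[OF convex_normal_cone ne] by blast
qed

lemma transpose_mult_eq_sum_rows: "transpose A *v w = (\<Sum>r\<in>UNIV. (w $ r) *\<^sub>R row r A)"
  for A :: "real^'n::finite^'m::finite"
  by (simp add: vec_eq_iff vector_matrix_mult_def row_def mult.commute)

lemma
  fixes Q :: "('z::finite, 'w::finite) qp"
  shows closed_Kpolar: "closed (Kpolar Q)" and convex_Kpolar: "convex (Kpolar Q)"
    and Kpolar_nonempty: "Kpolar Q \<noteq> {}"
proof -
  have eq: "Kpolar Q = (\<Inter>r\<in>- eqrows Q. {w. w $ r \<le> 0})" by (auto simp: Kpolar_def)
  show "closed (Kpolar Q)"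
    unfolding eq by (intro closed_INT ballI closed_Collect_le continuous_intros)
  have "convex {w::real^'w. w $ r \<le> 0}" for r
    by (rule convexI) (auto intro!: add_nonpos_nonpos mult_nonneg_nonpos)
  then show "convex (Kpolar Q)" unfolding eq by (intro convex_INT)
  have "0 \<in> Kpolar Q" by (simp add: Kpolar_def)
  then show "Kpolar Q \<noteq> {}" by blast
qed

lemma normal_cone_Kpolar:
  fixes Q :: "('z::finite, 'w::finite) qp"
  shows "v \<in> normal_cone (Kpolar Q) w \<longleftrightarrow> w \<in> Kpolar Q \<and>
    (\<forall>r. if r \<in> eqrows Q then v $ r = 0 else 0 \<le> v $ r \<and> (w $ r < 0 \<longrightarrow> v $ r = 0))"
proof
  assume v: "v \<in> normal_cone (Kpolar Q) w"
  then have w: "w \<in> Kpolar Q" by (simp add: normal_cone_def)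
  \<comment> \<open>One coordinate is moved by \<open>t\<close>: equality rows allow both signs,
    inequality rows any decrease and an increase up to 0.\<close>
  have step: "v $ r * t \<le> 0" if "r \<in> eqrows Q \<or> w $ r + t \<le> 0" for r t
  proof -
    have "w + t *\<^sub>R axis r 1 \<in> Kpolar Q"
      using w that by (auto simp: Kpolar_def axis_def)
    then have "v \<bullet> (w + t *\<^sub>R axis r 1 - w) \<le> 0" using v unfolding normal_cone_def by blast
    then show ?thesis by (simp add: inner_axis mult.commute)
  qed
  have "if r \<in> eqrows Q then v $ r = 0 else 0 \<le> v $ r \<and> (w $ r < 0 \<longrightarrow> v $ r = 0)" for r
  proof (cases "r \<in> eqrows Q")
    case True
    then show ?thesis using step[of r 1] step[of r "-1"] by simp
  next
    case False
    then have "w $ r \<le> 0" using w by (simp add: Kpolar_def)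
    then have "0 \<le> v $ r" using step[of r "-1"] by simp
    moreover have "v $ r = 0" if "w $ r < 0"
      using step[of r "- (w $ r)"] that \<open>0 \<le> v $ r\<close> by (simp add: mult_le_0_iff zero_le_mult_iff)
    ultimately show ?thesis using False by simp
  qed
  then show "w \<in> Kpolar Q \<and> (\<forall>r. if r \<in> eqrows Q then v $ r = 0 else 0 \<le> v $ r \<and> (w $ r < 0 \<longrightarrow> v $ r = 0))"
    using w by blast
next
  assume a: "w \<in> Kpolar Q \<and> (\<forall>r. if r \<in> eqrows Q then v $ r = 0 else 0 \<le> v $ r \<and> (w $ r < 0 \<longrightarrow> v $ r = 0))"
  have "v \<bullet> (y - w) \<le> 0" if y: "y \<in> Kpolar Q" for y
    unfolding inner_vec_def
  proof (rule sum_nonpos)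
    fix r
    have ar: "if r \<in> eqrows Q then v $ r = 0 else 0 \<le> v $ r \<and> (w $ r < 0 \<longrightarrow> v $ r = 0)" using a by blast
    show "v $ r \<bullet> (y - w) $ r \<le> 0"
    proof (cases "r \<in> eqrows Q \<or> w $ r < 0")
      case False
      then have "w $ r = 0" "y $ r \<le> 0" using a y by (force simp: Kpolar_def)+
      then show ?thesis using False ar by (simp add: mult_nonneg_nonpos)
    qed (use ar in \<open>auto split: if_splits\<close>)
  qed
  then show "v \<in> normal_cone (Kpolar Q) w" using a by (simp add: normal_cone_def)
qed

lemma closest_point_Kpolar:
  fixes Q :: "('z::finite, 'w::finite) qp"
  shows "closest_point (Kpolar Q) y = (\<chi> r. if r \<in> eqrows Q then y $ r else min (y $ r) 0)"
  unfolding closest_point_eq_iff_normal_cone[OF closed_Kpolar convex_Kpolar Kpolar_nonempty] normal_cone_Kpolar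
  by (auto simp: Kpolar_def)

text \<open>The projection clips positive inequality coordinates. Near a \<open>y\<close> without
  zero inequality coordinates it coincides with this linear map, so its derivative is locally
  constant.\<close>

definition Kderiv :: "('z::finite, 'w::finite) qp \<Rightarrow> real^'w \<Rightarrow> real^'w \<Rightarrow> real^'w" where
  "Kderiv Q y h = (\<chi> r. if r \<in> eqrows Q \<or> y $ r < 0 then h $ r else 0)"

lemma closest_point_Kpolar_c11:
  fixes Q :: "('z::finite, 'w::finite) qp"
  assumes nz: "\<And>r. r \<notin> eqrows Q \<Longrightarrow> y $ r \<noteq> 0"
  shows "c11_at (closest_point (Kpolar Q)) (\<lambda>_. Kderiv Q y) y"
proof -
  have lin: "linear (Kderiv Q y)"
    by (rule linearI) (auto simp: Kderiv_def vec_eq_iff)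
  \<comment> \<open>The distance to the nearest kink, capped by 1, which also covers the absence of
    inequality rows.\<close>
  define e where "e = Min (insert 1 ((\<lambda>r. \<bar>y $ r\<bar>) ` (- eqrows Q)))"
  have e: "e > 0" "\<And>r. r \<notin> eqrows Q \<Longrightarrow> e \<le> \<bar>y $ r\<bar>" using nz by (auto simp: e_def)
  show ?thesis
  proof (rule c11_at_cong[of "Kderiv Q y" _ _ e])
    show "c11_at (Kderiv Q y) (\<lambda>_. Kderiv Q y) y"
      by (rule c11_at_linear) (use lin linear_conv_bounded_linear in blast)
    fix x assume x: "x \<in> ball y e"
    have near: "\<bar>x $ r - y $ r\<bar> < e" for r
      using component_le_norm_cart[of "x - y" r] x by (simp add: dist_norm norm_minus_commute)
    have "(if r \<in> eqrows Q then x $ r else min (x $ r) 0) = (if r \<in> eqrows Q \<or> y $ r < 0 then x $ r else 0)" for r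
      using near[of r] e(2)[of r] by (cases "r \<in> eqrows Q"; cases "y $ r < 0") (auto simp: min_def)
    then show "closest_point (Kpolar Q) x = Kderiv Q y x"
      by (simp add: closest_point_Kpolar Kderiv_def vec_eq_iff)
  qed (rule e(1))
qed

section \<open>The PIPG operator as a resolvent\<close>

lemma uminus_matrix_vector_mult: "(- A) *v x = - (A *v x)"
  for A :: "real^'n::finite^'m::finite"
  by (simp add: vec_eq_iff matrix_vector_mult_def sum_negf)

context
  fixes Q :: "('z::finite, 'w::finite) qp" and \<alpha> \<beta> :: real
  assumes valid: "valid_qp Q" and \<alpha>: "0 < \<alpha>" and \<beta>: "0 < \<beta>"
    and stepsize: "\<alpha> * (opnorm (Pmat Q) + \<beta> * (opnorm (Hmat Q))\<^sup>2) < 1"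
begin

definition Pm :: "real^'z \<Rightarrow> real^'z" where "Pm x = Pmat Q *v x"
definition Hm :: "real^'z \<Rightarrow> real^'w" where "Hm x = Hmat Q *v x"
definition Ht :: "real^'w \<Rightarrow> real^'z" where "Ht w = transpose (Hmat Q) *v w"

lemma linear_Pm: "linear Pm" and linear_Hm: "linear Hm" and linear_Ht: "linear Ht"
  unfolding Pm_def[abs_def] Hm_def[abs_def] Ht_def[abs_def] by (rule matrix_vector_mul_linear)+

lemma Ht_inner: "Ht w \<bullet> x = w \<bullet> Hm x"
  by (simp add: Ht_def Hm_def dot_lmul_matrix)

lemma Pm_component: "Pm x $ k = rho Q (zblk Q k) * x $ k"
  by (simp add: Pm_def Pmat_def matrix_vector_mult_def if_distrib[where f = "\<lambda>a. a * _"] cong: if_cong)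

lemma Pm_inner: "Pm x \<bullet> y = x \<bullet> Pm y"
  by (simp add: inner_vec_def Pm_component algebra_simps)

lemma Pm_pos: "x \<noteq> 0 \<Longrightarrow> 0 < x \<bullet> Pm x"
proof -
  assume "x \<noteq> 0"
  then obtain k where k: "x $ k \<noteq> 0" by (auto simp: vec_eq_iff)
  have rho: "0 < rho Q (zblk Q k)" for k using valid by (simp add: valid_qp_def)
  show ?thesis
    unfolding inner_vec_def
  proof (rule sum_pos2[of _ k])
    show "0 < x $ k \<bullet> Pm x $ k"
      using rho[of k] k by (simp add: Pm_component) (metis mult.left_commute mult_pos_pos not_real_square_gt_zero)
    show "0 \<le> x $ l \<bullet> Pm x $ l" for l
      using rho[of l] by (simp add: Pm_component) (metis less_imp_le mult.left_commute mult_nonneg_nonneg zero_le_square)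
  qed auto
qed

lemma Pm_nonneg: "0 \<le> x \<bullet> Pm x"
  using Pm_pos[of x] by (cases "x = 0") auto

section \<open>The metric of \<open>M\<close>\<close>

abbreviation (input) "M \<equiv> Mop Q \<alpha> \<beta>"

lemma M_apply: "M v = ((1 / \<alpha>) *\<^sub>R fst v - Pm (fst v) - Ht (snd v), (1 / \<beta>) *\<^sub>R snd v - Hm (fst v))"
  by (simp add: Mop_def block_op_def Pm_def Hm_def Ht_def matrix_vector_mult_diff_rdistrib
      scaleR_matrix_vector_assoc[symmetric] uminus_matrix_vector_mult)

lemma linear_M: "linear M"
  by (rule linearI) (simp_all add: M_apply linear_add[OF linear_Pm] linear_add[OF linear_Hm] linear_add[OF linear_Ht]
      linear_cmul[OF linear_Pm] linear_cmul[OF linear_Hm] linear_cmul[OF linear_Ht] algebra_simps)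

lemma M_inner: "u \<bullet> M v = (fst u \<bullet> fst v) / \<alpha> - fst u \<bullet> Pm (fst v) - snd v \<bullet> Hm (fst u)
    - snd u \<bullet> Hm (fst v) + (snd u \<bullet> snd v) / \<beta>"
  by (simp add: M_apply inner_prod_def inner_diff_right Ht_inner inner_commute[of "fst u" "Ht _"])

lemma M_sym: "u \<bullet> M v = v \<bullet> M u"
  unfolding M_inner using Pm_inner[of "fst u" "fst v"] by (simp add: inner_commute)

lemma M_coercive:
  obtains \<mu> where "\<mu> > 0" "\<And>v. \<mu> * (norm v)\<^sup>2 \<le> v \<bullet> M v"
proof -
  define p where "p = opnorm (Pmat Q)"
  define h where "h = opnorm (Hmat Q)"
  have h0: "0 \<le> h" unfolding h_def by (rule onorm_pos_le) (rule matrix_vector_mul_bounded_linear)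
  \<comment> \<open>The slack in the step size condition, divided by \<alpha>.\<close>
  define s where "s = 1 / \<alpha> - p - \<beta> * h\<^sup>2"
  have s: "s > 0" using stepsize \<alpha> by (simp add: s_def p_def h_def field_simps)
  \<comment> \<open>The cross term is split by Young's inequality with weight
    \<open>\<beta> * (1 + \<epsilon>)\<close>: this costs at most half of the slack in the primal
    part and leaves \<open>b * y\<^sup>2\<close> in the dual part.\<close>
  define \<epsilon> where "\<epsilon> = s / (2 * (\<beta> * h\<^sup>2 + 1))"
  have bh: "0 \<le> \<beta> * h\<^sup>2" using \<beta> by simp
  have \<epsilon>: "\<epsilon> > 0" using s bh by (simp add: \<epsilon>_def)
  have \<epsilon>2: "\<epsilon> * (\<beta> * h\<^sup>2) \<le> s / 2"
  proof -
    have "\<epsilon> * (\<beta> * h\<^sup>2) \<le> \<epsilon> * (\<beta> * h\<^sup>2 + 1)" using \<epsilon> by (intro mult_left_mono) auto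
    also have "\<dots> = s / 2" using bh by (simp add: \<epsilon>_def field_simps)
    finally show ?thesis .
  qed
  define b where "b = \<epsilon> / (\<beta> * (1 + \<epsilon>))"
  have b: "b > 0" using \<epsilon> \<beta> by (simp add: b_def)
  have "min (s / 2) b * (norm v)\<^sup>2 \<le> v \<bullet> M v" for v
  proof -
    define x where "x = norm (fst v)"
    define y where "y = norm (snd v)"
    have "fst v \<bullet> Pm (fst v) \<le> x * norm (Pm (fst v))" unfolding x_def by (rule norm_cauchy_schwarz)
    also have "\<dots> \<le> x * (p * x)"
      unfolding x_def p_def Pm_def by (intro mult_left_mono onorm matrix_vector_mul_bounded_linear) auto
    finally have 1: "fst v \<bullet> Pm (fst v) \<le> p * x\<^sup>2" by (simp add: power2_eq_square algebra_simps)
    have "snd v \<bullet> Hm (fst v) \<le> y * norm (Hm (fst v))" unfolding y_def by (rule norm_cauchy_schwarz)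
    also have "\<dots> \<le> y * (h * x)"
      unfolding x_def y_def h_def Hm_def by (intro mult_left_mono onorm matrix_vector_mul_bounded_linear) auto
    finally have 2: "snd v \<bullet> Hm (fst v) \<le> h * x * y" by (simp add: algebra_simps)
    have 3: "2 * (h * x * y) \<le> \<beta> * h\<^sup>2 * (1 + \<epsilon>) * x\<^sup>2 + y\<^sup>2 / (\<beta> * (1 + \<epsilon>))"
    proof -
      define t where "t = \<beta> * (1 + \<epsilon>)"
      have t: "t > 0" using \<beta> \<epsilon> by (simp add: t_def)
      have "0 \<le> (h * x * t - y)\<^sup>2 / t" using t by simp
      also have "\<dots> = t * h\<^sup>2 * x\<^sup>2 - 2 * (h * x * y) + y\<^sup>2 / t"
        using t by (simp add: field_simps power2_eq_square)
      finally show ?thesis by (simp add: t_def algebra_simps)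
    qed
    have 4: "y\<^sup>2 / \<beta> - y\<^sup>2 / (\<beta> * (1 + \<epsilon>)) = b * y\<^sup>2"
    proof -
      define t where "t = 1 + \<epsilon>"
      have "t > 0" using \<epsilon> by (simp add: t_def)
      moreover have "b = (t - 1) / (\<beta> * t)" by (simp add: b_def t_def)
      ultimately have "b = 1 / \<beta> - 1 / (\<beta> * t)" by (simp add: diff_divide_distrib)
      then show ?thesis unfolding t_def[symmetric] by (simp add: left_diff_distrib)
    qed
    have 5: "\<epsilon> * (\<beta> * h\<^sup>2) * x\<^sup>2 \<le> s / 2 * x\<^sup>2" using \<epsilon>2 by (rule mult_right_mono) simp
    have "v \<bullet> M v = x\<^sup>2 / \<alpha> - fst v \<bullet> Pm (fst v) - 2 * (snd v \<bullet> Hm (fst v)) + y\<^sup>2 / \<beta>"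
      by (simp add: M_inner x_def y_def power2_norm_eq_inner)
    moreover have "x\<^sup>2 / \<alpha> = s * x\<^sup>2 + p * x\<^sup>2 + \<beta> * h\<^sup>2 * x\<^sup>2" by (simp add: s_def algebra_simps)
    moreover have "\<beta> * h\<^sup>2 * (1 + \<epsilon>) * x\<^sup>2 = \<beta> * h\<^sup>2 * x\<^sup>2 + \<epsilon> * (\<beta> * h\<^sup>2) * x\<^sup>2" by (simp add: algebra_simps)
    ultimately have "s / 2 * x\<^sup>2 + b * y\<^sup>2 \<le> v \<bullet> M v"
      using 1 2 3 4 5 by linarith
    moreover have "min (s / 2) b * (norm v)\<^sup>2 \<le> s / 2 * x\<^sup>2 + b * y\<^sup>2"
    proof -
      have "(norm v)\<^sup>2 = x\<^sup>2 + y\<^sup>2" by (simp add: norm_prod_def x_def y_def)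
      moreover have "min (s / 2) b * x\<^sup>2 \<le> s / 2 * x\<^sup>2" "min (s / 2) b * y\<^sup>2 \<le> b * y\<^sup>2"
        by (intro mult_right_mono; simp)+
      ultimately show ?thesis by (simp add: algebra_simps)
    qed
    ultimately show ?thesis by linarith
  qed
  then show thesis using that[of "min (s / 2) b"] s b by simp
qed

section \<open>Monotonicity of the operator in this metric\<close>

abbreviation (input) "T \<equiv> pipg Q \<alpha> \<beta>"

lemma z_arg_eq: "z_arg Q \<alpha> x = fst x - \<alpha> *\<^sub>R (Pm (fst x) + qvec Q + Ht (snd x))"
  by (simp add: z_arg_def Pm_def Ht_def case_prod_beta)

lemma w_arg_eq: "w_arg Q \<alpha> \<beta> x = snd x + \<beta> *\<^sub>R (Hm (2 *\<^sub>R fst (T x) - fst x) - gvec Q)"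
  by (simp add: w_arg_def Hm_def pipg_def case_prod_beta)

lemma pipg_normal_cones:
  shows "z_arg Q \<alpha> x - fst (T x) \<in> normal_cone (Dset Q) (fst (T x))"
    and "w_arg Q \<alpha> \<beta> x - snd (T x) \<in> normal_cone (Kpolar Q) (snd (T x))"
  using closest_point_eq_iff_normal_cone[OF closed_Dset convex_Dset Dset_nonempty, OF valid valid valid]
    closest_point_eq_iff_normal_cone[OF closed_Kpolar convex_Kpolar Kpolar_nonempty, of Q]
  by (auto simp: pipg_def z_next_def)

text \<open>The strong monotonicity of \<open>P\<close> gives the term on the left, which the derivative of \<open>T\<close> inherits.\<close>

lemma pipg_firm:
  "fst (T x - T y) \<bullet> Pm (fst (T x - T y)) \<le> (T x - T y) \<bullet> M ((x - T x) - (y - T y))"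
proof -
  define a b u v where "a = fst (x - y)" and "b = snd (x - y)" and "u = fst (T x - T y)" and "v = snd (T x - T y)"
  have 1: "0 \<le> (a - \<alpha> *\<^sub>R (Pm a + Ht b) - u) \<bullet> u"
  proof -
    have eq: "(z_arg Q \<alpha> x - fst (T x)) - (z_arg Q \<alpha> y - fst (T y)) = a - \<alpha> *\<^sub>R (Pm a + Ht b) - u"
      by (simp add: z_arg_eq a_def b_def u_def linear_diff[OF linear_Pm] linear_diff[OF linear_Ht] algebra_simps)
    then show ?thesis
      using normal_cone_monotone[OF pipg_normal_cones(1) pipg_normal_cones(1), of x y]
      unfolding eq by (simp add: u_def)
  qed
  have 2: "0 \<le> (b + \<beta> *\<^sub>R (2 *\<^sub>R Hm u - Hm a) - v) \<bullet> v"
  proof -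
    have eq: "(w_arg Q \<alpha> \<beta> x - snd (T x)) - (w_arg Q \<alpha> \<beta> y - snd (T y)) = b + \<beta> *\<^sub>R (2 *\<^sub>R Hm u - Hm a) - v"
      by (simp add: w_arg_eq a_def b_def u_def v_def linear_diff[OF linear_Hm] linear_cmul[OF linear_Hm] algebra_simps)
    then show ?thesis
      using normal_cone_monotone[OF pipg_normal_cones(2) pipg_normal_cones(2), of x y]
      unfolding eq by (simp add: v_def)
  qed
  have 3: "0 \<le> (a \<bullet> u - u \<bullet> u) / \<alpha> - Pm a \<bullet> u - b \<bullet> Hm u"
  proof -
    have "0 \<le> ((a - \<alpha> *\<^sub>R (Pm a + Ht b) - u) \<bullet> u) / \<alpha>" using 1 \<alpha> by simp
    also have "\<dots> = (a \<bullet> u - u \<bullet> u) / \<alpha> - Pm a \<bullet> u - b \<bullet> Hm u"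
      using \<alpha> by (simp add: inner_diff_left inner_add_left Ht_inner field_simps)
    finally show ?thesis .
  qed
  have 4: "0 \<le> (b \<bullet> v - v \<bullet> v) / \<beta> + 2 * (Hm u \<bullet> v) - Hm a \<bullet> v"
  proof -
    have "0 \<le> ((b + \<beta> *\<^sub>R (2 *\<^sub>R Hm u - Hm a) - v) \<bullet> v) / \<beta>" using 2 \<beta> by simp
    also have "\<dots> = (b \<bullet> v - v \<bullet> v) / \<beta> + 2 * (Hm u \<bullet> v) - Hm a \<bullet> v"
      using \<beta> by (simp add: inner_diff_left inner_add_left field_simps)
    finally show ?thesis .
  qed
  have "(x - T x) - (y - T y) = (a - u, b - v)"
    by (simp add: a_def b_def u_def v_def prod_eq_iff)
  moreover have "T x - T y = (u, v)" by (simp add: u_def v_def prod_eq_iff)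
  \<comment> \<open>This equals \<open>u \<bullet> Pm u\<close> plus the right-hand sides of facts
    \<open>3\<close> and \<open>4\<close>. The term \<open>2 * (Hm u \<bullet> v)\<close>, due to
    the extrapolated point in \<open>w_arg\<close>, supplies both \<open>v \<bullet> Hm u\<close>
    terms that the symmetric \<open>M\<close> requires.\<close>
  ultimately have "(T x - T y) \<bullet> M ((x - T x) - (y - T y))
      = (u \<bullet> a - u \<bullet> u) / \<alpha> - u \<bullet> Pm a + u \<bullet> Pm u - (b \<bullet> Hm u - v \<bullet> Hm u)
        - (v \<bullet> Hm a - v \<bullet> Hm u) + (v \<bullet> b - v \<bullet> v) / \<beta>"
    by (simp add: M_inner inner_diff_left inner_diff_right linear_diff[OF linear_Pm] linear_diff[OF linear_Hm])
  then show ?thesis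
    using 3 4 unfolding u_def[symmetric] by (simp add: inner_commute)
qed

lemma averaged_operator_pipg: "\<exists>m K. averaged_operator T (mnorm Q \<alpha> \<beta>) m K"
proof -
  obtain \<mu> where \<mu>: "\<mu> > 0" "\<And>v. \<mu> * (norm v)\<^sup>2 \<le> v \<bullet> M v" using M_coercive by blast
  have pos: "0 < v \<bullet> M v" if "v \<noteq> 0" for v
  proof -
    have "0 < \<mu> * (norm v)\<^sup>2" using that \<mu>(1) by simp
    then show ?thesis using \<mu>(2)[of v] by linarith
  qed
  have nn: "0 \<le> v \<bullet> M v" for v using pos[of v] by (cases "v = 0") auto
  obtain B where B: "B > 0" "\<And>v. norm (M v) \<le> B * norm v"
    using linear_bounded_pos[OF linear_M] by blast
  have "averaged_operator T (mnorm Q \<alpha> \<beta>) (sqrt \<mu>) (sqrt B)"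
  proof (rule averaged_operator.intro)
    show "0 < sqrt \<mu>" using \<mu> by simp
    show "sqrt \<mu> * norm v \<le> mnorm Q \<alpha> \<beta> v" for v
      unfolding mnorm_def using \<mu> by (intro real_le_rsqrt) (simp add: power_mult_distrib)
    show "mnorm Q \<alpha> \<beta> v \<le> sqrt B * norm v" for v
    proof -
      have "v \<bullet> M v \<le> norm v * norm (M v)" by (rule norm_cauchy_schwarz)
      also have "\<dots> \<le> norm v * (B * norm v)" using B by (intro mult_left_mono) auto
      also have "\<dots> = (sqrt B * norm v)\<^sup>2" using B(1) by (simp add: power_mult_distrib) (simp add: power2_eq_square)
      finally show ?thesis
        unfolding mnorm_def using B(1) by (intro real_le_lsqrt) auto
    qed
    show "mnorm Q \<alpha> \<beta> (u + v) \<le> mnorm Q \<alpha> \<beta> u + mnorm Q \<alpha> \<beta> v" for u v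
      unfolding mnorm_def by (rule quadratic_form_sqrt_triangle[OF linear_M M_sym pos])
    show "(mnorm Q \<alpha> \<beta> (T x - T y))\<^sup>2 + (mnorm Q \<alpha> \<beta> ((x - T x) - (y - T y)))\<^sup>2 \<le> (mnorm Q \<alpha> \<beta> (x - y))\<^sup>2" for x y
    proof -
      define d r where "d = T x - T y" and "r = (x - T x) - (y - T y)"
      have xy: "x - y = d + r" by (simp add: d_def r_def)
      \<comment> \<open>The cross term in the expansion of the squared \<open>M\<close>-norm of
        \<open>d + r\<close>.\<close>
      have "0 \<le> d \<bullet> M r" using pipg_firm[of x y] Pm_nonneg[of "fst d"] by (simp add: d_def r_def)
      then have "d \<bullet> M d + r \<bullet> M r \<le> (x - y) \<bullet> M (x - y)"
        unfolding xy using M_sym[of r d] by (simp add: linear_add[OF linear_M] inner_add_left inner_add_right)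
      then show ?thesis using nn by (simp add: mnorm_def d_def r_def)
    qed
  qed
  then show ?thesis by blast
qed

text \<open>The linear part of \<open>z_arg\<close>; \<open>wmap\<close> is that of
  \<open>w_arg\<close> without the contribution of the projected point.\<close>

definition zmap :: "(real^'z) \<times> (real^'w) \<Rightarrow> real^'z" where
  "zmap v = fst v - \<alpha> *\<^sub>R (Pm (fst v) + Ht (snd v))"

definition wmap :: "(real^'z) \<times> (real^'w) \<Rightarrow> real^'w" where
  "wmap v = snd v - \<beta> *\<^sub>R Hm (fst v)"

lemma linear_zmap: "linear zmap" and linear_wmap: "linear wmap"
  by (auto intro!: linearI simp: zmap_def wmap_def linear_add[OF linear_Pm] linear_add[OF linear_Hm] linear_add[OF linear_Ht]
      linear_cmul[OF linear_Pm] linear_cmul[OF linear_Hm] linear_cmul[OF linear_Ht] algebra_simps)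

text \<open>\<open>Ht w\<close> is a combination of active rows, so the trivial intersection gives
  \<open>Ht w = 0\<close>, and independence of the rows gives \<open>w = 0\<close>. Both uniqueness
  of the multiplier and nonsingularity of the derivative reduce to this.\<close>

lemma licq_kernel:
  assumes licq: "extended_LICQ Q zs" and supp: "\<And>r. r \<notin> active_rows Q zs \<Longrightarrow> w $ r = 0"
    and span: "Ht w \<in> span (normal_cone (Dset Q) zs)"
  shows "w = 0"
proof -
  let ?A = "active_rows Q zs" and ?row = "\<lambda>r. row r (Hmat Q)"
  have eq: "Ht w = (\<Sum>r\<in>?A. (w $ r) *\<^sub>R ?row r)"
    unfolding Ht_def transpose_mult_eq_sum_rows by (rule sum.mono_neutral_right) (use supp in auto)
  have "Ht w \<in> span (?row ` ?A)"
    unfolding eq by (intro span_sum span_scale span_base) auto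
  then have Ht0: "Ht w = 0" using licq span unfolding extended_LICQ_def by blast
  have "lin_indep_family ?row ?A" using licq by (simp add: extended_LICQ_def)
  then obtain e where e: "\<And>i j. i \<in> ?A \<Longrightarrow> j \<in> ?A \<Longrightarrow> ?row j \<bullet> e i = (if i = j then 1 else 0)"
    by (rule lin_indep_family_dual_basis) (rule that)
  have "w $ i = 0" if i: "i \<in> ?A" for i
  proof -
    have "0 = (\<Sum>r\<in>?A. (w $ r) *\<^sub>R ?row r) \<bullet> e i" using Ht0 eq by simp
    also have "\<dots> = (\<Sum>r\<in>?A. if i = r then w $ r else 0)"
      unfolding inner_sum_left by (rule sum.cong) (use e i in auto)
    also have "\<dots> = w $ i" using i by simp
    finally show ?thesis by simp
  qed
  then show "w = 0" using supp by (metis vec_eq_iff zero_index)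
qed

lemma fixed_point_normal_cones:
  assumes fxp: "T (zs, ws) = (zs, ws)"
  shows "- (\<alpha> *\<^sub>R (Pm zs + qvec Q + Ht ws)) \<in> normal_cone (Dset Q) zs"
    and "Hm zs - gvec Q \<in> normal_cone (Kpolar Q) ws"
proof -
  show "- (\<alpha> *\<^sub>R (Pm zs + qvec Q + Ht ws)) \<in> normal_cone (Dset Q) zs"
    using pipg_normal_cones(1)[of "(zs, ws)"] by (simp add: fxp z_arg_eq)
  have "\<beta> *\<^sub>R (Hm zs - gvec Q) \<in> normal_cone (Kpolar Q) ws"
    using pipg_normal_cones(2)[of "(zs, ws)"] by (simp add: fxp w_arg_eq scaleR_2)
  then have "(1 / \<beta>) *\<^sub>R (\<beta> *\<^sub>R (Hm zs - gvec Q)) \<in> normal_cone (Kpolar Q) ws"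
    by (rule normal_cone_scaleR) (use \<beta> in simp)
  then show "Hm zs - gvec Q \<in> normal_cone (Kpolar Q) ws" using \<beta> by simp
qed

text \<open>Complementary slackness; it brings differences of multipliers within reach of
  \<open>licq_kernel\<close>.\<close>

lemma inactive_multiplier_zero:
  assumes "Hm zs - gvec Q \<in> normal_cone (Kpolar Q) ws" "r \<notin> active_rows Q zs"
  shows "ws $ r = 0"
proof -
  have r: "r \<notin> eqrows Q" "Hm zs $ r \<noteq> gvec Q $ r"
    using assms(2) by (auto simp: active_rows_def Hm_def)
  have "ws $ r < 0 \<longrightarrow> (Hm zs - gvec Q) $ r = 0" "ws \<in> Kpolar Q"
    using assms(1) r(1) unfolding normal_cone_Kpolar by metis+
  then have "\<not> ws $ r < 0" "ws $ r \<le> 0" using r by (auto simp: Kpolar_def)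
  then show ?thesis by simp
qed

lemma fixed_point_unique:
  assumes licq: "extended_LICQ Q zs" and fxp: "T (zs, ws) = (zs, ws)" and fxp': "T (z', w') = (z', w')"
  shows "(z', w') = (zs, ws)"
proof -
  \<comment> \<open>Residuals vanish at both fixed points, so the right-hand side of
    \<open>pipg_firm\<close> is zero.\<close>
  have "(z' - zs) \<bullet> Pm (z' - zs) \<le> 0"
    using pipg_firm[of "(z', w')" "(zs, ws)"] by (simp add: fxp fxp' linear_0[OF linear_M] flip: zero_prod_def)
  then have z: "z' = zs" using Pm_pos[of "z' - zs"] by fastforce
  note n = fixed_point_normal_cones[OF fxp]
  note n' = fixed_point_normal_cones[OF fxp', unfolded z]
  \<comment> \<open>Two multipliers for one primal point give two normal vectors there, which differ
    only by a multiple of \<open>Ht (w' - ws)\<close>.\<close>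
  have "(- (\<alpha> *\<^sub>R (Pm zs + qvec Q + Ht ws))) - (- (\<alpha> *\<^sub>R (Pm zs + qvec Q + Ht w'))) \<in> span (normal_cone (Dset Q) zs)"
    by (intro span_diff span_base n(1) n'(1))
  moreover have "(- (\<alpha> *\<^sub>R (Pm zs + qvec Q + Ht ws))) - (- (\<alpha> *\<^sub>R (Pm zs + qvec Q + Ht w'))) = \<alpha> *\<^sub>R Ht (w' - ws)"
    by (simp add: linear_diff[OF linear_Ht] algebra_simps)
  ultimately have "(1 / \<alpha>) *\<^sub>R (\<alpha> *\<^sub>R Ht (w' - ws)) \<in> span (normal_cone (Dset Q) zs)"
    by (metis span_scale)
  then have "Ht (w' - ws) \<in> span (normal_cone (Dset Q) zs)" using \<alpha> by simp
  then have "w' - ws = 0"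
    by (rule licq_kernel[OF licq, rotated]) (simp add: inactive_multiplier_zero[OF n(2)] inactive_multiplier_zero[OF n'(2)])
  then show ?thesis using z by simp
qed

text \<open>If the multiplier vanishes, \<open>axis r 1\<close> is normal, and a relative interior
  point can give up a little of it, so the constraint value is positive. The projection onto the
  polar cone is thus evaluated off its kinks.\<close>

lemma strict_complementarity_w_arg:
  assumes fxp: "T (zs, ws) = (zs, ws)"
    and ri: "Hm zs - gvec Q \<in> rel_interior (normal_cone (Kpolar Q) ws)" and r: "r \<notin> eqrows Q"
  shows "w_arg Q \<alpha> \<beta> (zs, ws) $ r < 0 \<and> ws $ r < 0 \<and> (Hm zs - gvec Q) $ r = 0 \<or> w_arg Q \<alpha> \<beta> (zs, ws) $ r > 0"
proof -
  let ?v = "Hm zs - gvec Q"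
  have vN: "?v \<in> normal_cone (Kpolar Q) ws" using ri rel_interior_subset by blast
  have arg: "w_arg Q \<alpha> \<beta> (zs, ws) $ r = ws $ r + \<beta> * ?v $ r"
    by (simp add: w_arg_eq fxp scaleR_2)
  have K: "ws \<in> Kpolar Q" using vN by (simp add: normal_cone_def)
  then have "ws $ r \<le> 0" using r by (simp add: Kpolar_def)
  show ?thesis
  proof (cases "ws $ r < 0")
    case True
    then have "?v $ r = 0" using vN r unfolding normal_cone_Kpolar by metis
    then show ?thesis using True arg by simp
  next
    case False
    then have w0: "ws $ r = 0" using \<open>ws $ r \<le> 0\<close> by simp
    then have "axis r 1 \<in> normal_cone (Kpolar Q) ws"
      using K r unfolding normal_cone_Kpolar by (simp add: axis_def)
    then obtain e where e: "e > 0" "?v - e *\<^sub>R axis r 1 \<in> normal_cone (Kpolar Q) ws"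
      using rel_interior_normal_cone_shrink[OF ri] by metis
    then have "0 \<le> (?v - e *\<^sub>R axis r 1) $ r" using r unfolding normal_cone_Kpolar by metis
    then have "e \<le> ?v $ r" by (simp add: axis_def)
    then have "0 < \<beta> * ?v $ r" using e(1) \<beta> by simp
    then show ?thesis using arg w0 by simp
  qed
qed

text \<open>\<open>JT\<close> is built from Jacobian matrices, the analysis from derivatives as
  functions. Both projections are differentiable throughout a neighbourhood of their arguments, so
  uniqueness of derivatives identifies the two.\<close>

lemma pipg_c11:
  assumes fxp: "T (zs, ws) = (zs, ws)"
    and JD: "c11_at (closest_point (Dset Q)) JD (z_arg Q \<alpha> (zs, ws))"
    and JK: "c11_at (closest_point (Kpolar Q)) JK (w_arg Q \<alpha> \<beta> (zs, ws))"
  obtains J where "J = (\<lambda>x h. (JD (z_arg Q \<alpha> x) (zmap h),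
      JK (w_arg Q \<alpha> \<beta> x) (wmap h + (2 * \<beta>) *\<^sub>R Hm (JD (z_arg Q \<alpha> x) (zmap h)))))"
    "c11_at T J (zs, ws)"
    "\<forall>\<^sub>F x in nhds (zs, ws). JT_defined Q \<alpha> \<beta> x \<and> JT Q \<alpha> \<beta> x = J x"
proof -
  define J where "J = (\<lambda>x h. (JD (z_arg Q \<alpha> x) (zmap h),
      JK (w_arg Q \<alpha> \<beta> x) (wmap h + (2 * \<beta>) *\<^sub>R Hm (JD (z_arg Q \<alpha> x) (zmap h)))))"
  have za: "z_arg Q \<alpha> = (\<lambda>x. zmap x + (- (\<alpha> *\<^sub>R qvec Q)))"
    by (rule ext) (simp add: z_arg_eq zmap_def algebra_simps)
  have cz: "c11_at (z_arg Q \<alpha>) (\<lambda>x. zmap) (zs, ws)"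
    unfolding za by (rule c11_at_affine) (use linear_zmap linear_conv_bounded_linear in blast)
  have cD: "c11_at (\<lambda>x. closest_point (Dset Q) (z_arg Q \<alpha> x)) (\<lambda>x h. JD (z_arg Q \<alpha> x) (zmap h)) (zs, ws)"
    by (rule c11_at_compose[OF cz JD])
  \<comment> \<open>\<open>w_arg\<close> contains the projected point, so the second projection is
    differentiated through the first.\<close>
  have wa: "w_arg Q \<alpha> \<beta> = (\<lambda>x. (wmap x + (- (\<beta> *\<^sub>R gvec Q))) + (2 * \<beta>) *\<^sub>R Hm (closest_point (Dset Q) (z_arg Q \<alpha> x)))"
  proof
    fix x
    have "Hm (2 *\<^sub>R u - y) = 2 *\<^sub>R Hm u - Hm y" for u y
      by (simp only: linear_diff[OF linear_Hm] linear_cmul[OF linear_Hm])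
    moreover have "fst (T x) = closest_point (Dset Q) (z_arg Q \<alpha> x)" by (simp add: pipg_def z_next_def)
    ultimately show "w_arg Q \<alpha> \<beta> x = (wmap x + (- (\<beta> *\<^sub>R gvec Q))) + (2 * \<beta>) *\<^sub>R Hm (closest_point (Dset Q) (z_arg Q \<alpha> x))"
      unfolding w_arg_eq wmap_def by (simp add: scaleR_diff_right mult.commute)
  qed
  have blw: "bounded_linear wmap" using linear_wmap linear_conv_bounded_linear by blast
  have blH: "bounded_linear (\<lambda>u. (2 * \<beta>) *\<^sub>R Hm u)"
    using linear_Hm linear_conv_bounded_linear bounded_linear_compose[OF bounded_linear_scaleR_right] by blast
  have cw: "c11_at (w_arg Q \<alpha> \<beta>) (\<lambda>x h. wmap h + (2 * \<beta>) *\<^sub>R Hm (JD (z_arg Q \<alpha> x) (zmap h))) (zs, ws)"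
    unfolding wa by (intro c11_at_add c11_at_affine blw) (rule c11_at_linear_compose[OF blH cD])
  have cK: "c11_at (\<lambda>x. closest_point (Kpolar Q) (w_arg Q \<alpha> \<beta> x))
      (\<lambda>x h. JK (w_arg Q \<alpha> \<beta> x) (wmap h + (2 * \<beta>) *\<^sub>R Hm (JD (z_arg Q \<alpha> x) (zmap h)))) (zs, ws)"
    by (rule c11_at_compose[OF cw JK])
  have "T = (\<lambda>x. (closest_point (Dset Q) (z_arg Q \<alpha> x), closest_point (Kpolar Q) (w_arg Q \<alpha> \<beta> x)))"
    by (rule ext) (simp add: pipg_def z_next_def)
  then have cT: "c11_at T J (zs, ws)"
    using c11_at_Pair[OF cD cK] by (simp add: J_def)
  have near: "\<forall>\<^sub>F y in nhds a. (f has_derivative f' y) (at y)" if "c11_at f f' a"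
    for f :: "'x::euclidean_space \<Rightarrow> 'y::euclidean_space" and f' a
    using c11_at_has_derivative_near[OF that] unfolding eventually_nhds_metric by (auto simp: dist_commute)
  have lim: "(f \<longlongrightarrow> f a) (nhds a)" if "c11_at f f' a"
    for f :: "'x::euclidean_space \<Rightarrow> 'y::euclidean_space" and f' a
    using c11_at_continuous[OF that] by (simp add: continuous_at tendsto_at_iff_tendsto_nhds)
  have "\<forall>\<^sub>F x in nhds (zs, ws). (closest_point (Dset Q) has_derivative JD (z_arg Q \<alpha> x)) (at (z_arg Q \<alpha> x))"
    by (rule eventually_compose_filterlim[OF near[OF JD] lim[OF cz]])
  moreover have "\<forall>\<^sub>F x in nhds (zs, ws). (closest_point (Kpolar Q) has_derivative JK (w_arg Q \<alpha> \<beta> x)) (at (w_arg Q \<alpha> \<beta> x))"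
    by (rule eventually_compose_filterlim[OF near[OF JK] lim[OF cw]])
  ultimately have "\<forall>\<^sub>F x in nhds (zs, ws). JT_defined Q \<alpha> \<beta> x \<and> JT Q \<alpha> \<beta> x = J x"
  proof eventually_elim
    case (elim x)
    have d: "closest_point (Dset Q) differentiable (at (z_arg Q \<alpha> x))"
      "closest_point (Kpolar Q) differentiable (at (w_arg Q \<alpha> \<beta> x))"
      using elim unfolding differentiable_def by blast+
    define A where "A = jacobian (closest_point (Dset Q)) (at (z_arg Q \<alpha> x))"
    define B where "B = jacobian (closest_point (Kpolar Q)) (at (w_arg Q \<alpha> \<beta> x))"
    have A: "A *v h = JD (z_arg Q \<alpha> x) h" for h
      unfolding A_def by (rule fun_cong[OF has_derivative_unique[OF jacobian_works[THEN iffD1, OF d(1)] elim(1)]])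
    have B: "B *v h = JK (w_arg Q \<alpha> \<beta> x) h" for h
      unfolding B_def by (rule fun_cong[OF has_derivative_unique[OF jacobian_works[THEN iffD1, OF d(2)] elim(2)]])
    have "JT Q \<alpha> \<beta> x h = (A *v zmap h, B *v (wmap h + (2 * \<beta>) *\<^sub>R Hm (A *v zmap h)))" for h
      unfolding JT_def Let_def A_def[symmetric] B_def[symmetric] block_op_def
      by (simp add: prod_eq_iff zmap_def wmap_def Pm_def Hm_def Ht_def matrix_vector_mult_diff_rdistrib
        matrix_vector_mult_add_rdistrib matrix_vector_mult_diff_distrib matrix_vector_right_distrib
        uminus_matrix_vector_mult matrix_vector_mult_scaleR
        matrix_vector_mul_assoc[symmetric] scaleR_matrix_vector_assoc[symmetric] algebra_simps del: transpose_matrix_vector)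
    then show ?case using d by (simp add: JT_defined_def J_def A B fun_eq_iff)
  qed
  then show thesis using that[OF J_def cT] by blast
qed

text \<open>The difference quotients \<open>q s\<close> of \<open>T\<close> along \<open>v\<close>
  inherit \<open>pipg_firm\<close> after division by \<open>s\<^sup>2\<close>. They tend to
  \<open>J v = v\<close>, so the factor \<open>v - q s\<close> disappears in the limit.\<close>

lemma derivative_eigenvector_primal_zero:
  assumes fxp: "T a = a" and J: "(T has_derivative J) (at a)" and v: "J v = v"
  shows "fst v = 0"
proof -
  define q where "q s = (1 / s) *\<^sub>R (T (a + s *\<^sub>R v) - T a)" for s :: real
  have q: "(q \<longlongrightarrow> v) (at 0)"
    using has_derivative_imp_directional_limit[OF J, of v] v by (simp add: q_def[abs_def])
  have "fst (q s) \<bullet> Pm (fst (q s)) \<le> q s \<bullet> M (v - q s)" if s: "s \<noteq> 0" for s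
  proof -
    define d where "d = T (a + s *\<^sub>R v) - T a"
    have "fst d \<bullet> Pm (fst d) \<le> d \<bullet> M (s *\<^sub>R v - d)"
      using pipg_firm[of "a + s *\<^sub>R v" a] by (simp add: d_def fxp algebra_simps)
    moreover have "d = s *\<^sub>R q s" "s *\<^sub>R v - d = s *\<^sub>R (v - q s)"
      using s by (simp_all add: q_def d_def scaleR_diff_right)
    ultimately have "s * s * (fst (q s) \<bullet> Pm (fst (q s))) \<le> s * s * (q s \<bullet> M (v - q s))"
      by (simp only: fst_scaleR linear_cmul[OF linear_Pm] linear_cmul[OF linear_M] inner_scaleR_left inner_scaleR_right mult.assoc)
    then show ?thesis using s by (simp add: mult_le_cancel_left_pos flip: power2_eq_square)
  qed
  then have "eventually (\<lambda>s. fst (q s) \<bullet> Pm (fst (q s)) \<le> q s \<bullet> M (v - q s)) (at 0)"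
    by (simp add: eventually_at_filter)
  moreover have "((\<lambda>s. fst (q s) \<bullet> Pm (fst (q s))) \<longlongrightarrow> fst v \<bullet> Pm (fst v)) (at 0)"
    unfolding Pm_def by (intro tendsto_inner tendsto_fst q bounded_linear.tendsto[OF matrix_vector_mul_bounded_linear])
  moreover have "((\<lambda>s. q s \<bullet> M (v - q s)) \<longlongrightarrow> v \<bullet> M (v - v)) (at 0)"
    by (intro tendsto_inner q bounded_linear.tendsto[OF linear_M[unfolded linear_conv_bounded_linear]] tendsto_diff tendsto_const)
  ultimately have "fst v \<bullet> Pm (fst v) \<le> v \<bullet> M (v - v)"
    by (intro tendsto_le[of "at 0"]) auto
  then have "fst v \<bullet> Pm (fst v) \<le> 0" by (simp add: linear_0[OF linear_M])
  then show ?thesis using Pm_pos[of "fst v"] by fastforce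
qed

lemma pipg_derivative_nonsingular:
  assumes licq: "extended_LICQ Q zs" and fxp: "T (zs, ws) = (zs, ws)"
    and types: "\<forall>b\<in>blocks Q. second_order_cone (block Q b) (Dblk Q b) \<or> affine (Dblk Q b) \<or>
           regular_convex_sublevel (block Q b) (Dblk Q b)"
    and riD: "- (Pmat Q *v zs + qvec Q + transpose (Hmat Q) *v ws) \<in> rel_interior (normal_cone (Dset Q) zs)"
    and riK: "Hmat Q *v zs - gvec Q \<in> rel_interior (normal_cone (Kpolar Q) ws)"
  obtains J where "c11_at T J (zs, ws)" "\<And>v. J (zs, ws) v = v \<Longrightarrow> v = 0"
    "\<forall>\<^sub>F x in nhds (zs, ws). JT_defined Q \<alpha> \<beta> x \<and> JT Q \<alpha> \<beta> x = J x"
proof -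
  define v where "v = - (Pm zs + qvec Q + Ht ws)"
  have riD': "\<alpha> *\<^sub>R v \<in> rel_interior (normal_cone (Dset Q) zs)"
    using riD \<alpha> unfolding v_def Pm_def Ht_def by (rule rel_interior_normal_cone_scaleR)
  then have zD: "zs \<in> Dset Q" using rel_interior_subset by (fastforce simp: normal_cone_def)
  have arg: "z_arg Q \<alpha> (zs, ws) = zs + \<alpha> *\<^sub>R v"
    by (simp add: z_arg_eq v_def scaleR_diff_right scaleR_add_right)
  obtain JD where JD: "c11_at (closest_point (Dset Q)) JD (z_arg Q \<alpha> (zs, ws))"
    "\<And>h. JD (z_arg Q \<alpha> (zs, ws)) h = 0 \<Longrightarrow> h \<in> span (normal_cone (Dset Q) zs)"
    using smooth_projection_Dset[OF valid types zD riD'] unfolding smooth_projection_at_def arg by blast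
  note strict = strict_complementarity_w_arg[OF fxp riK[folded Hm_def]]
  have JK: "c11_at (closest_point (Kpolar Q)) (\<lambda>_. Kderiv Q (w_arg Q \<alpha> \<beta> (zs, ws))) (w_arg Q \<alpha> \<beta> (zs, ws))"
    by (rule closest_point_Kpolar_c11) (use strict in force)
  obtain J where J: "J = (\<lambda>x h. (JD (z_arg Q \<alpha> x) (zmap h),
      Kderiv Q (w_arg Q \<alpha> \<beta> (zs, ws)) (wmap h + (2 * \<beta>) *\<^sub>R Hm (JD (z_arg Q \<alpha> x) (zmap h)))))"
    "c11_at T J (zs, ws)" "\<forall>\<^sub>F x in nhds (zs, ws). JT_defined Q \<alpha> \<beta> x \<and> JT Q \<alpha> \<beta> x = J x"
    by (rule pipg_c11[OF fxp JD(1) JK]) (rule that)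
  have "h = 0" if h: "J (zs, ws) h = h" for h
  proof -
    have h1: "fst h = 0"
      by (rule derivative_eigenvector_primal_zero[OF fxp c11_at_has_derivative[OF J(2)] h])
    define w where "w = snd h"
    have zm: "zmap h = - (\<alpha> *\<^sub>R Ht w)" and wm: "wmap h = w"
      by (simp_all add: zmap_def wmap_def h1 w_def linear_0[OF linear_Pm] linear_0[OF linear_Hm])
    \<comment> \<open>With \<open>fst h = 0\<close>, the first component of \<open>J h = h\<close>
      says that the derivative of the projection kills \<open>zmap h\<close>, a multiple of
      \<open>Ht w\<close>.\<close>
    have JD0: "JD (z_arg Q \<alpha> (zs, ws)) (zmap h) = 0"
      using h h1 unfolding J(1) by (metis fst_conv)
    then have "- (\<alpha> *\<^sub>R Ht w) \<in> span (normal_cone (Dset Q) zs)" using JD(2) zm by metis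
    then have "(- (1 / \<alpha>)) *\<^sub>R (- (\<alpha> *\<^sub>R Ht w)) \<in> span (normal_cone (Dset Q) zs)" by (rule span_scale)
    then have span: "Ht w \<in> span (normal_cone (Dset Q) zs)" using \<alpha> by simp
    have "Kderiv Q (w_arg Q \<alpha> \<beta> (zs, ws)) w = w"
      using h unfolding J(1) by (simp add: JD0 wm linear_0[OF linear_Hm] w_def prod_eq_iff)
    note Kw = this
    have supp: "r \<in> eqrows Q \<or> w_arg Q \<alpha> \<beta> (zs, ws) $ r < 0" if "w $ r \<noteq> 0" for r
    proof -
      have "Kderiv Q (w_arg Q \<alpha> \<beta> (zs, ws)) w $ r = w $ r" by (simp add: Kw)
      then show ?thesis using that by (simp add: Kderiv_def split: if_splits)
    qed
    \<comment> \<open>\<open>Kderiv\<close> retains only equality rows and rows with negative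
      argument; strict complementarity makes the latter active.\<close>
    have "w $ r = 0" if r: "r \<notin> active_rows Q zs" for r
    proof (rule ccontr)
      assume "w $ r \<noteq> 0"
      moreover have nr: "r \<notin> eqrows Q" "Hm zs $ r \<noteq> gvec Q $ r"
        using r by (auto simp: active_rows_def Hm_def)
      ultimately have "w_arg Q \<alpha> \<beta> (zs, ws) $ r < 0" using supp by blast
      then show False using strict[OF nr(1)] nr(2) by simp
    qed
    then have "w = 0" using licq_kernel[OF licq _ span] by blast
    then show ?thesis using h1 by (simp add: w_def prod_eq_iff)
  qed
  then show thesis by (rule that[OF J(2) _ J(3)])
qed

end

section \<open>Convergence of Newton-PIPG\<close>

text \<open>The rate is claimed for \<open>c > 0\<close>: with \<open>c = 0\<close> the first test
  accepts only a step that reaches residual zero exactly, so Newton steps may be rejected forever.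
  The threshold \<open>\<sigma>0\<close> is chosen before the run.\<close>

theorem theorem4p5:
  fixes Q :: "('z::finite, 'w::finite) qp" and \<alpha> \<beta> c :: real
  assumes "valid_qp Q"
    and "\<alpha> > 0" and "\<beta> > 0" and "0 \<le> c" and "c < 1"
    and "\<alpha> * (opnorm (Pmat Q) + \<beta> * (opnorm (Hmat Q))\<^sup>2) < 1"
    and "Fix (pipg Q \<alpha> \<beta>) \<noteq> {}"
  shows
    "(\<forall>\<sigma>>0. \<forall>x p. newton_pipg_run Q \<alpha> \<beta> c \<sigma> x p \<longrightarrow> (\<lambda>k. residual Q \<alpha> \<beta> (x k)) \<longlonglongrightarrow> 0)
     \<and>
     (\<forall>zs ws.
        optimal Q zs \<and> extended_LICQ Q zs \<and>
        (\<forall>b\<in>blocks Q. second_order_cone (block Q b) (Dblk Q b) \<or> affine (Dblk Q b) \<or>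
           regular_convex_sublevel (block Q b) (Dblk Q b)) \<and>
        (\<forall>y. closest_point (Dset Q) differentiable (at y) \<longrightarrow>
           transpose (jacobian (closest_point (Dset Q)) (at y)) =
             jacobian (closest_point (Dset Q)) (at y)) \<and>
        (zs, ws) \<in> Fix (pipg Q \<alpha> \<beta>) \<and>
        - (Pmat Q *v zs + qvec Q + transpose (Hmat Q) *v ws)
          \<in> rel_interior (normal_cone (Dset Q) zs) \<and>
        Hmat Q *v zs - gvec Q \<in> rel_interior (normal_cone (Kpolar Q) ws)
        \<longrightarrow>
        Fix (pipg Q \<alpha> \<beta>) = {(zs, ws)} \<and>
        (\<exists>\<sigma>0>0. \<forall>\<sigma>\<ge>\<sigma>0. \<forall>x p.
           newton_pipg_run Q \<alpha> \<beta> c \<sigma> x p \<and>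
           (\<forall>k. newton_regular Q \<alpha> \<beta> (x k) \<longrightarrow> newton_step Q \<alpha> \<beta> (x k) (p k))
           \<longrightarrow>
           x \<longlonglongrightarrow> (zs, ws) \<and>
           (c > 0 \<longrightarrow>
             (\<exists>C>0. \<exists>k0. \<forall>k\<ge>k0.
                mnorm Q \<alpha> \<beta> (x (Suc k) - (zs, ws)) \<le> C * (mnorm Q \<alpha> \<beta> (x k - (zs, ws)))\<^sup>2))))"
proof -
  let ?T = "pipg Q \<alpha> \<beta>" and ?N = "mnorm Q \<alpha> \<beta>"
  note par = assms(1-3,6)
  obtain m K where "averaged_operator ?T ?N m K" using averaged_operator_pipg[OF par] by blast
  then interpret averaged_operator ?T ?N m K .
  have run: "newton_run c \<sigma> x p" if "newton_pipg_run Q \<alpha> \<beta> c \<sigma> x p" for \<sigma> x p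
    using that unfolding newton_pipg_run_def newton_run_def residual_def by blast
  show ?thesis
  proof (intro conjI allI impI; (elim conjE)?)
    fix \<sigma> :: real and x p assume "newton_pipg_run Q \<alpha> \<beta> c \<sigma> x p"
    moreover obtain y where "?T y = y" using assms(7) by (auto simp: Fix_def)
    ultimately have "(\<lambda>k. ?N (R (x k))) \<longlonglongrightarrow> 0"
      by (intro newton_run_residual_tendsto_0[OF run assms(5)])
    then have lim: "(\<lambda>k. ?N (R (x k)) / m) \<longlonglongrightarrow> 0 / m"
      using m_pos by (intro tendsto_divide tendsto_const) auto
    show "(\<lambda>k. residual Q \<alpha> \<beta> (x k)) \<longlonglongrightarrow> 0"
    proof (rule Lim_null_comparison)
      show "\<forall>\<^sub>F k in sequentially. norm (residual Q \<alpha> \<beta> (x k)) \<le> ?N (R (x k)) / m"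
        using N_lower m_pos by (intro always_eventually allI) (simp add: residual_def field_simps)
    qed (use lim in simp)
  next
    fix zs ws
    assume licq: "extended_LICQ Q zs"
      and types: "\<forall>b\<in>blocks Q. second_order_cone (block Q b) (Dblk Q b) \<or> affine (Dblk Q b) \<or>
           regular_convex_sublevel (block Q b) (Dblk Q b)"
      and fxp: "(zs, ws) \<in> Fix ?T"
      and riD: "- (Pmat Q *v zs + qvec Q + transpose (Hmat Q) *v ws) \<in> rel_interior (normal_cone (Dset Q) zs)"
      and riK: "Hmat Q *v zs - gvec Q \<in> rel_interior (normal_cone (Kpolar Q) ws)"
    define xs where "xs = (zs, ws)"
    have Txs: "?T xs = xs" using fxp by (simp add: Fix_def xs_def)
    have unique: "y = xs" if "?T y = y" for y
      using fixed_point_unique[OF par licq, of ws "fst y" "snd y"] Txs that by (simp add: xs_def)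
    show "Fix ?T = {(zs, ws)}"
      unfolding Fix_def xs_def[symmetric] using Txs unique by blast
    obtain J where J: "c11_at ?T J xs" "\<And>v. J xs v = v \<Longrightarrow> v = 0"
      "\<forall>\<^sub>F x in nhds xs. JT_defined Q \<alpha> \<beta> x \<and> JT Q \<alpha> \<beta> x = J x"
      by (rule pipg_derivative_nonsingular[OF par licq Txs[unfolded xs_def] types riD riK, folded xs_def]) (rule that)
    have conv: "x \<longlonglongrightarrow> xs" if "newton_pipg_run Q \<alpha> \<beta> c \<sigma> x p" "0 \<le> \<sigma>" for \<sigma> x p
      using newton_run_tendsto[OF run[OF that(1)] assms(5) that(2) Txs unique] .
    show "\<exists>\<sigma>0>0. \<forall>\<sigma>\<ge>\<sigma>0. \<forall>x p.
           newton_pipg_run Q \<alpha> \<beta> c \<sigma> x p \<and>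
           (\<forall>k. newton_regular Q \<alpha> \<beta> (x k) \<longrightarrow> newton_step Q \<alpha> \<beta> (x k) (p k)) \<longrightarrow>
           x \<longlonglongrightarrow> (zs, ws) \<and>
           (c > 0 \<longrightarrow> (\<exists>C>0. \<exists>k0. \<forall>k\<ge>k0. ?N (x (Suc k) - (zs, ws)) \<le> C * (?N (x k - (zs, ws)))\<^sup>2))"
    proof (cases "c > 0")
      case False
      then show ?thesis using conv by (intro exI[of _ 1]) (auto simp: xs_def)
    next
      case True
      obtain \<delta> C \<kappa> where est: "\<delta> > 0" "C > 0" "\<kappa> > 0"
        "\<And>x. x \<in> ball xs \<delta> \<Longrightarrow> bij (\<lambda>p. p - J x p)"
        "\<And>x p. x \<in> ball xs \<delta> \<Longrightarrow> p - J x p = ?T x - x \<Longrightarrow>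
           ?N (x + p - xs) \<le> C * (?N (x - xs))\<^sup>2 \<and> ?N (R (x + p)) \<le> c * ?N (R x) \<and> ?N p \<le> \<kappa> * ?N (R x)"
        by (rule newton_step_estimates[OF Txs J(1,2) True]) (assumption, rule that)
      have "x \<longlonglongrightarrow> xs \<and> (\<exists>C>0. \<exists>k0. \<forall>k\<ge>k0. ?N (x (Suc k) - xs) \<le> C * (?N (x k - xs))\<^sup>2)"
        if \<sigma>: "\<kappa> + 1 \<le> \<sigma>" and r: "newton_pipg_run Q \<alpha> \<beta> c \<sigma> x p"
          and newton: "\<forall>k. newton_regular Q \<alpha> \<beta> (x k) \<longrightarrow> newton_step Q \<alpha> \<beta> (x k) (p k)" for \<sigma> x p
      proof -
        have lim: "x \<longlonglongrightarrow> xs" using conv[OF r] \<sigma> est(3) by simp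
        have "\<forall>\<^sub>F k in sequentially. JT_defined Q \<alpha> \<beta> (x k) \<and> JT Q \<alpha> \<beta> (x k) = J (x k)"
          by (rule eventually_compose_filterlim[OF J(3) lim])
        moreover have "\<forall>\<^sub>F k in sequentially. x k \<in> ball xs \<delta>"
          using lim est(1) by (intro topological_tendstoD) auto
        ultimately have "\<forall>\<^sub>F k in sequentially. ?N (x (Suc k) - xs) \<le> C * (?N (x k - xs))\<^sup>2"
        proof eventually_elim
          case (elim k)
          have "newton_regular Q \<alpha> \<beta> (x k)"
            using elim est(4)[of "x k"] by (simp add: newton_regular_def)
          then have p: "p k - J (x k) (p k) = ?T (x k) - x k"
            using newton elim unfolding newton_step_def by metis
          note e = est(5)[OF elim(2) p]
          show ?case
          \<comment> \<open>At residual zero the second test, being strict, fails, and the update by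
            \<open>T\<close> does not move the iterate. Otherwise \<sigma> exceeding \<kappa> leaves
            room for the strict inequality.\<close>
          proof (cases "R (x k) = 0")
            case True
            then have "x k = xs" using unique[of "x k"] by simp
            moreover have "x (Suc k) = x k"
              using run[OF r] True N_nonneg[of "p k"] unfolding newton_run_def by (simp add: N_0)
            ultimately show ?thesis by (simp add: N_0)
          next
            case False
            have "0 < m * norm (R (x k))" using False m_pos by simp
            then have "0 < ?N (R (x k))" using N_lower[of "R (x k)"] by linarith
            then have "\<kappa> * ?N (R (x k)) < \<sigma> * ?N (R (x k))" using \<sigma> by simp
            then have "x (Suc k) = x k + p k"
              using e run[OF r] unfolding newton_run_def by (smt (verit))
            then show ?thesis using e by simp
          qed
        qed
        then show ?thesis using lim est(2) unfolding eventually_sequentially by blast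
      qed
      then show ?thesis using est(3) by (intro exI[of _ "\<kappa> + 1"]) (auto simp: xs_def)
    qed
  qed
qed

end
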